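(* Let $\Theta$ be either $\Theta_{\mathcal T}$ (with data from the tournament model) or $\Theta_{\mathcal G}$ (with data from the graph model), and let $\Theta(\alpha,L)\subset\Theta$ be the corresponding Hölder class. There exists a universal constant $C<\infty$ such that for all $\alpha,L>0$, every integer $n\ge2$ and every $p\in[0,1]$ with $p\ge\frac{2\log n}{n}$, $$\sup_{\theta^*\in\Theta(\alpha,L)}\frac1{n^2}\,\mathbb E\|\hat\theta-\theta^*\|^2\le C\Big[L^{\frac1{\alpha+1}}\frac{\log n}{(np)^{\frac{2\alpha+1}{2\alpha+2}}}+\frac{(\log n)^2}{np}\Big].$$
   Context: Notation: $[n]=\{1,\dots,n\}$; $S_n$ is the set of permutations of $[n]$; for an $n\times n$ matrix $\theta$ and $\pi\in S_n$, $(\theta\circ\pi)_{ij}=\theta_{\pi(i),\pi(j)}$; $\|\cdot\|$ is the Frobenius norm; $\log$ is the natural logarithm. Parameter spaces: $\mathcal T$ is the set of $\theta\in[0,1]^{n\times n}$ such that $\theta_{ij}\le\theta_{ik}$ whenever $i\ne k$, $i\ne j$, $k<j$; $\theta_{ji}=1-\theta_{ij}$ for all $i\neq j$; $\theta_{ii}=0$ for all $i$; and $\theta_{ij}\le\frac12$ for all $i<j$. $\mathcal G$ is the set of $\theta\in[0,1]^{n\times n}$ such that $\theta_{ij}\le\theta_{ik}$ whenever $i\ne k$, $i\ne j$, $j<k$; $\theta_{ji}=\theta_{ij}$ for all $i\ne j$; and $\theta_{ii}=0$ for all $i$. Set $\Theta_{\mathcal T}=\{\theta\circ\pi:\theta\in\mathcal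 T,\pi\in S_n\}$ and $\Theta_{\mathcal G}=\{\theta\circ\pi:\theta\in\mathcal G,\pi\in S_n\}$. Hölder class: for $\alpha,L>0$, $\Theta(\alpha,L)$ is the set of $\theta\in\Theta$ for which there is $\pi\in S_n$ such that $\vartheta=\theta\circ\pi$ satisfies $|\vartheta_{ij}-\vartheta_{ik}|\le L\frac{|j-k|^\alpha}{n^\alpha}$ for all $i,j,k\in[n]$ with $i\ne j$, $i\ne k$. Data with true parameter $\theta^*$ and observation probability $p$: for $i<j$ there are independent outcomes with law $\mathrm{Bern}(\theta^*_{ij})$; each above-diagonal entry is observed with probability $p$, independently over entries and independently of the outcomes. For $i<j$ set $y_{ij}$ equal to the outcome if it is observed and $y_{ij}=\frac12$ if it is missing. The lower triangle is $y_{ji}=1-y_{ij}$ in the tournament model and $y_{ji}=y_{ij}$ in the graph model ($i<j$), and $y_{ii}=0$. Let $\hat p$ be the number of observed above-diagonal entries divided by $\binom n2$. Estimator: let $r_i=\sum_{j=1}^n y_{ij}$ and let $\hat\sigma$ be a permutation with $r_{\hat\sigma(1)}\le\dots\le r_{\hat\sigma(n)}$, ties being broken uniformly at random. Let $J$ be the $n\times n$ matrix with $J_{ij}=1$ for $i\ne j$ and $J_{ii}=0$. Let $\mathrm{Proj}$ be the Euclidean (Frobenius) projection onto the closed convex set $\mathcal T$ in the tournament model, and onto $\mathcal G$ in the graph model. Then $$\hat\theta=\mathrm{Proj}\Big(\big(\tfrac{y-J/2}{\hat p}+\tfrac J2\big)\circ\hat\sigma\Big)\circ\hat\sigma^{-1}\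 \text{ if }\hat p\ge\tfrac1n,\qquad \hat\theta=\tfrac J2\ \text{ otherwise}.$$ *)

theory Defs
  imports "HOL-Probability.Probability" "HOL-Combinatorics.Permutations"
begin

text \<open>
  The size \<open>n\<close> varies inside the statement, so an \<open>n \<times> n\<close> matrix is a function on index pairs,
  read on \<open>{1..n} \<times> {1..n}\<close>. All matrices below vanish outside this square, so that equality of
  functions is equality of matrices. A permutation in \<open>S\<^sub>n\<close> is a function \<open>\<pi>\<close> with
  \<open>\<pi> permutes {1..n}\<close>; it is the identity outside \<open>{1..n}\<close>.
\<close>

type_synonym matrix = "nat \<Rightarrow> nat \<Rightarrow> real"

definition frob :: "nat \<Rightarrow> matrix \<Rightarrow> real" where
  "frob n a = L2_set (\<lambda>(i, j). a i j) ({1..n} \<times> {1..n})"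

definition mat_perm :: "matrix \<Rightarrow> (nat \<Rightarrow> nat) \<Rightarrow> matrix" where
  "mat_perm \<theta> \<pi> = (\<lambda>i j. \<theta> (\<pi> i) (\<pi> j))"

definition unit_matrices :: "nat \<Rightarrow> matrix set" where
  "unit_matrices n =
     {\<theta>. (\<forall>i\<in>{1..n}. \<forall>j\<in>{1..n}. 0 \<le> \<theta> i j \<and> \<theta> i j \<le> 1) \<and>
         (\<forall>i j. i \<notin> {1..n} \<or> j \<notin> {1..n} \<longrightarrow> \<theta> i j = 0)}"

datatype model = Tournament | Graph

definition tournament_matrices :: "nat \<Rightarrow> matrix set" where
  "tournament_matrices n =
     {\<theta> \<in> unit_matrices n.
        (\<forall>i\<in>{1..n}. \<forall>j\<in>{1..n}. \<forall>k\<in>{1..n}. i \<noteq> k \<longrightarrow> i \<noteq> j \<longrightarrow> k < j \<longrightarrow> \<theta> i j \<le> \<theta> i k) \<and>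
        (\<forall>i\<in>{1..n}. \<forall>j\<in>{1..n}. i \<noteq> j \<longrightarrow> \<theta> j i = 1 - \<theta> i j) \<and>
        (\<forall>i\<in>{1..n}. \<theta> i i = 0) \<and>
        (\<forall>i\<in>{1..n}. \<forall>j\<in>{1..n}. i < j \<longrightarrow> \<theta> i j \<le> 1 / 2)}"

definition graph_matrices :: "nat \<Rightarrow> matrix set" where
  "graph_matrices n =
     {\<theta> \<in> unit_matrices n.
        (\<forall>i\<in>{1..n}. \<forall>j\<in>{1..n}. \<forall>k\<in>{1..n}. i \<noteq> k \<longrightarrow> i \<noteq> j \<longrightarrow> j < k \<longrightarrow> \<theta> i j \<le> \<theta> i k) \<and>
        (\<forall>i\<in>{1..n}. \<forall>j\<in>{1..n}. i \<noteq> j \<longrightarrow> \<theta> j i = \<theta> i j) \<and>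
        (\<forall>i\<in>{1..n}. \<theta> i i = 0)}"

fun ordered_class :: "model \<Rightarrow> nat \<Rightarrow> matrix set" where
  "ordered_class Tournament n = tournament_matrices n"
| "ordered_class Graph n = graph_matrices n"

definition Theta :: "model \<Rightarrow> nat \<Rightarrow> matrix set" where
  "Theta md n = {mat_perm \<theta> \<pi> | \<theta> \<pi>. \<theta> \<in> ordered_class md n \<and> \<pi> permutes {1..n}}"

definition Theta_Hoelder :: "model \<Rightarrow> nat \<Rightarrow> real \<Rightarrow> real \<Rightarrow> matrix set" where
  "Theta_Hoelder md n \<alpha> L =
     {\<theta> \<in> Theta md n. \<exists>\<pi>. \<pi> permutes {1..n} \<and>
        (\<forall>i\<in>{1..n}. \<forall>j\<in>{1..n}. \<forall>k\<in>{1..n}. i \<noteq> j \<longrightarrow> i \<noteq> k \<longrightarrow>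
           \<bar>mat_perm \<theta> \<pi> i j - mat_perm \<theta> \<pi> i k\<bar>
             \<le> L * (\<bar>real j - real k\<bar> powr \<alpha> / real n powr \<alpha>))}"

definition upper :: "nat \<Rightarrow> (nat \<times> nat) set" where
  "upper n = {(i, j). 1 \<le> i \<and> i < j \<and> j \<le> n}"

text \<open>
  A sample is a pair \<open>(z, w)\<close>: \<open>z\<close> gives the outcome of each above-diagonal entry (\<open>True\<close> is 1)
  and \<open>w\<close> tells which of these entries are observed.
\<close>

type_synonym sample = "(nat \<times> nat \<Rightarrow> bool) \<times> (nat \<times> nat \<Rightarrow> bool)"

definition sample_pmf :: "nat \<Rightarrow> real \<Rightarrow> matrix \<Rightarrow> sample pmf" where
  "sample_pmf n p \<theta> =
     pair_pmf (Pi_pmf (upper n) False (\<lambda>(i, j). bernoulli_pmf (\<theta> i j)))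
              (Pi_pmf (upper n) False (\<lambda>_. bernoulli_pmf p))"

definition entry :: "sample \<Rightarrow> nat \<times> nat \<Rightarrow> real" where
  "entry s e = (if snd s e then of_bool (fst s e) else 1 / 2)"

definition data_matrix :: "model \<Rightarrow> nat \<Rightarrow> sample \<Rightarrow> matrix" where
  "data_matrix md n s = (\<lambda>i j.
     if (i, j) \<in> upper n then entry s (i, j)
     else if (j, i) \<in> upper n then
       (case md of Tournament \<Rightarrow> 1 - entry s (j, i) | Graph \<Rightarrow> entry s (j, i))
     else 0)"

definition p_hat :: "nat \<Rightarrow> sample \<Rightarrow> real" where
  "p_hat n s = real (card {e \<in> upper n. snd s e}) / real (n choose 2)"

definition row_sum :: "nat \<Rightarrow> matrix \<Rightarrow> nat \<Rightarrow> real" where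
  "row_sum n y i = (\<Sum>j=1..n. y i j)"

definition sorting_perms :: "nat \<Rightarrow> matrix \<Rightarrow> (nat \<Rightarrow> nat) set" where
  "sorting_perms n y = {\<sigma>. \<sigma> permutes {1..n} \<and> mono_on {1..n} (\<lambda>i. row_sum n y (\<sigma> i))}"

definition J :: "nat \<Rightarrow> matrix" where
  "J n = (\<lambda>i j. if i \<in> {1..n} \<and> j \<in> {1..n} \<and> i \<noteq> j then 1 else 0)"

text \<open>
  The minimizer is unique for the classes used here: they are nonempty, closed and convex, and
  their members vanish outside \<open>{1..n} \<times> {1..n}\<close>.
\<close>

definition Proj :: "model \<Rightarrow> nat \<Rightarrow> matrix \<Rightarrow> matrix" where
  "Proj md n a = arg_min_on (\<lambda>b. frob n (\<lambda>i j. a i j - b i j)) (ordered_class md n)"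

definition estimator :: "model \<Rightarrow> nat \<Rightarrow> sample \<Rightarrow> (nat \<Rightarrow> nat) \<Rightarrow> matrix" where
  "estimator md n s \<sigma> =
     (if p_hat n s \<ge> 1 / real n then
        mat_perm
          (Proj md n
            (mat_perm (\<lambda>i j. (data_matrix md n s i j - J n i j / 2) / p_hat n s + J n i j / 2) \<sigma>))
          (inv \<sigma>)
      else (\<lambda>i j. J n i j / 2))"

text \<open>
  Given the data, breaking ties uniformly at random means that the sorting permutation is drawn
  uniformly from all permutations that sort the row sums.
\<close>

definition estimator_pmf :: "model \<Rightarrow> nat \<Rightarrow> real \<Rightarrow> matrix \<Rightarrow> matrix pmf" where
  "estimator_pmf md n p \<theta> =
     bind_pmf (sample_pmf n p \<theta>) (\<lambda>s.
       map_pmf (estimator md n s) (pmf_of_set (sorting_perms n (data_matrix md n s))))"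

definition risk :: "model \<Rightarrow> nat \<Rightarrow> real \<Rightarrow> matrix \<Rightarrow> real" where
  "risk md n p \<theta> =
     1 / (real n)\<^sup>2 *
     measure_pmf.expectation (estimator_pmf md n p \<theta>) (\<lambda>t. (frob n (\<lambda>i j. t i j - \<theta> i j))\<^sup>2)"

end

theory Submission imports Defs begin

text \<open>
  Write \<open>\<theta>\<^sup>* = \<phi> \<circ> \<pi>\<close> with \<open>\<phi>\<close> in the ordered class, let \<open>Z\<close> be the centred noise of the data rescaled by
  the true \<open>p\<close>, and put \<open>T = Proj (\<dots> \<circ> \<sigma>)\<close>. Since \<open>T\<close> minimizes the distance to the sorted data,
  \<open>\<parallel>T - \<phi>\<parallel>\<^sup>2\<close> is at most twice the inner product of \<open>T - \<phi>\<close> with the sum of three terms: the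
  ordering error \<open>\<theta>\<^sup>* \<circ> \<sigma> - \<phi>\<close>, the effect of replacing \<open>p\<close> by its estimate, and the noise \<open>Z \<circ> \<sigma>\<close>.

  The ordering error is controlled row by row. Row sums of the noise are at most of order
  \<open>n \<surd>r\<close> with \<open>r = log n / (n p)\<close>, and sorting is stable in the sup norm, so the row of true rank \<open>i\<close> and
  the row placed at position \<open>i\<close> have row sums that differ by \<open>O(n \<surd>r)\<close>. The difference of the two rows
  has constant sign, hence this bounds its \<open>\<ell>\<^sub>1\<close> norm; Hoelder continuity turns that into a bound on its
  sup norm of order \<open>(L r\<^bsup>\<alpha>/2\<^esup>)\<^bsup>1/(\<alpha>+1)\<^esup>\<close>, and the product of the two bounds its square sum.

  The noise term must be controlled uniformly over all permutations \<open>\<sigma>\<close> and all monotone \<open>T\<close>. A monotone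
  matrix is a sum over dyadic scales of increments that are constant on blocks, nonnegative, and at
  scale \<open>2\<^sup>l\<close> have total at most \<open>2n/2\<^sup>l\<close>. Rounding the increments at each scale to integer multiples of a
  common weight, with the direction of rounding chosen by the noise, produces a matrix from a finite set
  of log-cardinality \<open>O(n (log n)\<^sup>2)\<close> that does not decrease the inner product with the noise
  and is within \<open>O(\<surd>n log n)\<close> of \<open>T\<close>. One union bound over this set and over \<open>\<sigma>\<close>, with a single fixed
  exponential moment of order \<open>p\<close>, then gives an error term that is absorbed into \<open>\<parallel>T - \<phi>\<parallel>\<^sup>2\<close>.
\<close>

section \<open>Rounding in a simplex\<close>

text \<open>A linear functional on the polytope \<open>0 \<le> r \<le> \<tau>\<close>,
  \<open>sum r A \<le> \<tau> * m\<close> is maximized at an extreme point, that is, at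
  \<open>\<tau>\<close> times the indicator of a set of at most \<open>m\<close> elements. The proof
  takes the best such set \<open>F\<close> and certifies it by a multiplier \<open>\<mu>\<close> for
  the budget constraint.\<close>

lemma sum_weighted_le_top:
  fixes r x :: "'a \<Rightarrow> real"
  assumes fin: "finite A" and r: "\<And>a. a \<in> A \<Longrightarrow> 0 \<le> r a \<and> r a \<le> \<tau>"
    and S: "sum r A \<le> \<tau> * real m" and t0: "\<tau> \<ge> 0"
  obtains F where "F \<subseteq> A" "card F \<le> m" "(\<Sum>a\<in>A. r a * x a) \<le> (\<Sum>a\<in>F. \<tau> * x a)"
proof -
  let ?FF = "{F. F \<subseteq> A \<and> card F \<le> m}"
  have finFF: "finite ?FF" using fin by simp
  have ne: "{} \<in> ?FF" by simp
  define F where "F = arg_max_on (sum x) ?FF"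
  have F: "F \<in> ?FF" "\<And>G. G \<in> ?FF \<Longrightarrow> sum x G \<le> sum x F"
  proof -
    have "Max (sum x ` ?FF) \<in> sum x ` ?FF" using finFF ne by (intro Max_in) auto
    then obtain F0 where F0: "F0 \<in> ?FF" "sum x F0 = Max (sum x ` ?FF)" by (metis (lifting) imageE)
    have "\<And>G. G \<in> ?FF \<Longrightarrow> sum x G \<le> sum x F0" using F0 finFF by simp
    then have "is_arg_max (sum x) (\<lambda>F. F \<in> ?FF) F0" using F0 by (force simp: is_arg_max_def not_less)
    then have "is_arg_max (sum x) (\<lambda>F. F \<in> ?FF) F"
      unfolding F_def arg_max_on_def arg_max_def by (rule someI)
    then show "F \<in> ?FF" "\<And>G. G \<in> ?FF \<Longrightarrow> sum x G \<le> sum x F" by (auto simp: is_arg_max_def not_less)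
  qed
  have finF: "finite F" using F fin by (auto intro: finite_subset)
  have xF: "x a \<ge> 0" if "a \<in> F" for a
  proof -
    have "F - {a} \<in> ?FF" using F finF by (auto intro: order_trans[OF card_Diff1_le])
    from F(2)[OF this] that finF show ?thesis by (simp add: sum_diff1)
  qed
  \<comment> \<open>The multiplier separates the values of \<open>x\<close> on \<open>F\<close> from
    those off \<open>F\<close>; the last conjunct is the slackness condition. It is \<open>0\<close>
    if \<open>F\<close> does not exhaust the budget, and otherwise the least value of
    \<open>x\<close> on \<open>F\<close>. For \<open>m = 0\<close> the set \<open>F\<close> is empty
    and any nonnegative upper bound of \<open>x\<close> serves.\<close>
  have "\<exists>\<mu>\<ge>0. (\<forall>a\<in>F. \<mu> \<le> x a) \<and> (\<forall>a\<in>A-F. x a \<le> \<mu>) \<and> \<mu> * (sum r A - \<tau> * real (card F)) \<le> 0"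
  proof (cases "card F < m")
    case True
    have "x a \<le> 0" if "a \<in> A - F" for a
    proof -
      have "insert a F \<in> ?FF" using F finF that True by auto
      from F(2)[OF this] that finF show ?thesis by simp
    qed
    then show ?thesis using xF by (intro exI[of _ 0]) auto
  next
    case False
    then have c: "card F = m" using F by simp
    show ?thesis
    proof (cases "m = 0")
      case True
      then have "F = {}" using c finF by simp
      moreover have "sum r A = 0" using True S r by (simp add: antisym sum_nonneg)
      moreover have "\<forall>a\<in>A. x a \<le> (\<Sum>a\<in>A. \<bar>x a\<bar>)"
        using fin member_le_sum[of _ A "\<lambda>a. \<bar>x a\<bar>"] by (force intro: order_trans[OF abs_ge_self])
      ultimately show ?thesis by (intro exI[of _ "\<Sum>a\<in>A. \<bar>x a\<bar>"]) (auto intro: sum_nonneg)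
    next
      case False
      then have neF: "F \<noteq> {}" using c by auto
      define \<mu> where "\<mu> = Min (x ` F)"
      have "\<mu> \<in> x ` F" unfolding \<mu>_def using neF finF by (intro Min_in) auto
      then obtain c0 where c0: "c0 \<in> F" "\<mu> = x c0" by auto
      \<comment> \<open>Exchanging the minimizer \<open>c0\<close> for \<open>a\<close> keeps the
        cardinality at \<open>m\<close>, so optimality of \<open>F\<close> forbids a gain.\<close>
      have "x a \<le> \<mu>" if a: "a \<in> A - F" for a
      proof -
        have "card (insert a (F - {c0})) = m" using c c0 a finF False by (simp add: card_insert_if)
        then have "insert a (F - {c0}) \<in> ?FF" using F finF a by auto
        from F(2)[OF this] show ?thesis using a c0 finF by (simp add: sum_diff1)
      qed
      moreover have "\<mu> \<le> x a" if "a \<in> F" for a using that finF \<mu>_def by simp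
      moreover have "\<mu> \<ge> 0" using xF c0 by simp
      moreover have "sum r A - \<tau> * real (card F) \<le> 0" using S c by simp
      ultimately show ?thesis by (intro exI[of _ \<mu>]) (auto simp: mult_nonneg_nonpos)
    qed
  qed
  then obtain \<mu> where l: "\<mu> \<ge> 0" "\<And>a. a \<in> F \<Longrightarrow> \<mu> \<le> x a" "\<And>a. a \<in> A-F \<Longrightarrow> x a \<le> \<mu>"
    "\<mu> * (sum r A - \<tau> * real (card F)) \<le> 0" by blast
  have FA: "F \<subseteq> A" using F by simp
  have "(\<Sum>a\<in>A. r a * x a) - (\<Sum>a\<in>F. \<tau> * x a) = (\<Sum>a\<in>A-F. r a * x a) - (\<Sum>a\<in>F. (\<tau> - r a) * x a)"
    using sum.subset_diff[OF FA fin, of "\<lambda>a. r a * x a"]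
    by (simp add: left_diff_distrib sum_subtractf)
  \<comment> \<open>Off \<open>F\<close> the coefficient \<open>r a\<close> is nonnegative and
    \<open>x a \<le> \<mu>\<close>; on \<open>F\<close> the coefficient \<open>\<tau> - r a\<close>
    is nonnegative and \<open>x a \<ge> \<mu>\<close>.\<close>
  also have "\<dots> \<le> (\<Sum>a\<in>A-F. r a * \<mu>) - (\<Sum>a\<in>F. (\<tau> - r a) * \<mu>)"
    using r l FA by (intro diff_mono sum_mono mult_left_mono) auto
  also have "\<dots> = \<mu> * (sum r A - \<tau> * real (card F))"
    using sum.subset_diff[OF FA fin, of r]
    by (simp add: algebra_simps sum_subtractf flip: sum_distrib_left)
  also have "\<dots> \<le> 0" by (rule l)
  finally show thesis using F that by auto
qed

text \<open>Every coordinate is first rounded down to a multiple of \<open>\<tau>\<close>. The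
  remainders satisfy the hypotheses of \<open>sum_weighted_le_top\<close>, which selects at most
  \<open>m\<close> coordinates to round up instead, so that the functional \<open>x\<close> does not
  decrease. Both steps use at most \<open>m\<close> units, whence \<open>2 * m\<close>.\<close>

lemma simplex_rounding:
  fixes d x :: "'a \<Rightarrow> real"
  assumes fin: "finite A" and d: "\<And>a. a \<in> A \<Longrightarrow> 0 \<le> d a"
    and S: "sum d A \<le> \<tau> * real m" and t0: "\<tau> > 0"
  obtains k :: "'a \<Rightarrow> nat" where "sum k A \<le> 2 * m" "\<And>a. a \<in> A \<Longrightarrow> \<bar>\<tau> * real (k a) - d a\<bar> \<le> \<tau>"
    "(\<Sum>a\<in>A. d a * x a) \<le> (\<Sum>a\<in>A. \<tau> * real (k a) * x a)"
proof -
  define q where "q = (\<lambda>a. nat \<lfloor>d a / \<tau>\<rfloor>)"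
  have q: "\<tau> * real (q a) \<le> d a \<and> d a < \<tau> * real (q a) + \<tau>" if "a \<in> A" for a
  proof -
    have "d a / \<tau> \<ge> 0" using d that t0 by simp
    then have "real (q a) = of_int \<lfloor>d a / \<tau>\<rfloor>" unfolding q_def by simp
    then have "real (q a) \<le> d a / \<tau>" "d a / \<tau> < real (q a) + 1" by linarith+
    then show ?thesis using t0 by (simp add: field_simps)
  qed
  have "\<tau> * real (sum q A) \<le> sum d A" using q by (simp add: sum_distrib_left sum_mono)
  then have "\<tau> * real (sum q A) \<le> \<tau> * real m" using S by linarith
  then have sq: "sum q A \<le> m" using t0 by (simp only: mult_le_cancel_left_pos of_nat_le_iff)
  have "(\<Sum>a\<in>A. d a - \<tau> * real (q a)) \<le> sum d A" using t0 by (intro sum_mono) simp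
  then have S': "(\<Sum>a\<in>A. d a - \<tau> * real (q a)) \<le> \<tau> * real m" using S by linarith
  have rr: "0 \<le> d a - \<tau> * real (q a) \<and> d a - \<tau> * real (q a) \<le> \<tau>" if "a \<in> A" for a using q[OF that] by linarith
  obtain F where F: "F \<subseteq> A" "card F \<le> m"
      "(\<Sum>a\<in>A. (d a - \<tau> * real (q a)) * x a) \<le> (\<Sum>a\<in>F. \<tau> * x a)"
    using sum_weighted_le_top[OF fin rr S' less_imp_le[OF t0], of x] by blast
  define k where "k = (\<lambda>a. q a + of_bool (a \<in> F))"
  have AF: "A \<inter> F = F" using F by auto
  have "sum k A = sum q A + card F" unfolding k_def using fin AF
    by (simp add: sum.distrib of_bool_def Int_def[symmetric] flip: sum.inter_filter)
  then have "sum k A \<le> 2 * m" using sq F by simp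
  moreover have "\<bar>\<tau> * real (k a) - d a\<bar> \<le> \<tau>" if "a \<in> A" for a
    using q[OF that] t0 unfolding k_def by (auto simp: of_bool_def algebra_simps)
  moreover have "(\<Sum>a\<in>A. d a * x a) \<le> (\<Sum>a\<in>A. \<tau> * real (k a) * x a)"
  proof -
    have "(\<Sum>a\<in>A. \<tau> * real (k a) * x a) = (\<Sum>a\<in>A. \<tau> * real (q a) * x a) + (\<Sum>a\<in>A. if a \<in> F then \<tau> * x a else 0)"
      unfolding k_def by (subst sum.distrib[symmetric], intro sum.cong) (auto simp: algebra_simps)
    also have "(\<Sum>a\<in>A. if a \<in> F then \<tau> * x a else 0) = (\<Sum>a\<in>F. \<tau> * x a)"
      using fin AF by (simp flip: sum.inter_restrict)
    finally show ?thesis using F(3) by (simp add: left_diff_distrib sum_subtractf)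
  qed
  ultimately show thesis by (rule that)
qed

text \<open>Turning multiplicities into a list makes the number of possible roundings a number of
  lists of bounded length.\<close>

lemma list_with_multiplicities:
  fixes k :: "'a \<Rightarrow> nat"
  assumes "finite A"
  obtains xs where "set xs \<subseteq> A" "length xs = sum k A"
    "\<And>h :: 'a \<Rightarrow> real. sum_list (map h xs) = (\<Sum>a\<in>A. real (k a) * h a)"
proof -
  have "\<exists>xs. set xs \<subseteq> A \<and> length xs = sum k A \<and>
    (\<forall>h :: 'a \<Rightarrow> real. sum_list (map h xs) = (\<Sum>a\<in>A. real (k a) * h a))"
    using assms
  proof (induction A)
    case (insert a A)
    then obtain xs where "set xs \<subseteq> A \<and> length xs = sum k A \<and>
      (\<forall>h :: 'a \<Rightarrow> real. sum_list (map h xs) = (\<Sum>a\<in>A. real (k a) * h a))" by blast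
    then show ?case using insert
      by (intro exI[of _ "replicate (k a) a @ xs"]) (auto simp: sum_list_replicate)
  qed auto
  then show thesis using that by blast
qed

text \<open>A diagonal step is a step in the first index followed by one in the second. Each kind
  telescopes along the \<open>A\<close> lines in its direction, with total at most \<open>1\<close>
  per line.\<close>

lemma sum_diagonal_increments_le:
  fixes h :: "nat \<Rightarrow> nat \<Rightarrow> real"
  assumes h: "\<And>a b. a \<le> A \<Longrightarrow> b \<le> A \<Longrightarrow> 0 \<le> h a b \<and> h a b \<le> 1"
  shows "(\<Sum>a=1..A. \<Sum>b=1..A. h a b - h (a-1) (b-1)) \<le> 2 * real A"
proof -
  have tel: "(\<Sum>b=1..A. f b - f (b-1)) \<le> 1" if "\<And>b. b \<le> A \<Longrightarrow> 0 \<le> f b \<and> f b \<le> 1" for f :: "nat \<Rightarrow> real"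
  proof -
    have "(\<Sum>b=1..A. f b - f (b-1)) = f A - f 0"
      by (induction A) simp_all
    then show ?thesis using that[of A] that[of 0] by simp
  qed
  have "(\<Sum>a=1..A. \<Sum>b=1..A. h a b - h (a-1) (b-1)) =
     (\<Sum>a=1..A. \<Sum>b=1..A. h a b - h (a-1) b) + (\<Sum>a=1..A. \<Sum>b=1..A. h (a-1) b - h (a-1) (b-1))"
    by (simp flip: sum.distrib)
  also have "(\<Sum>a=1..A. \<Sum>b=1..A. h a b - h (a-1) b) = (\<Sum>b=1..A. \<Sum>a=1..A. h a b - h (a-1) b)"
    by (rule sum.swap)
  also have "\<dots> \<le> (\<Sum>b=1..A. 1)" by (intro sum_mono tel h) auto
  also have "(\<Sum>a=1..A. \<Sum>b=1..A. h (a-1) b - h (a-1) (b-1)) \<le> (\<Sum>b=1..A. 1)"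
    by (intro sum_mono tel h) auto
  finally show ?thesis by simp
qed

section \<open>Dyadic block approximation of monotone matrices\<close>

text \<open>
  A triple \<open>(l, a, b)\<close> stands for the block of side \<open>2\<^sup>l\<close> with corner \<open>(2\<^sup>l a, 2\<^sup>l b)\<close>. A block with
  \<open>2\<^sup>l > n\<close> has weight \<open>0\<close>; such triples pad all lists to the same length.
\<close>

definition block_matrix :: "nat \<Rightarrow> (nat \<times> nat \<times> nat) list \<Rightarrow> matrix" where
  "block_matrix n xs = (\<lambda>i j. \<Sum>(l, a, b)\<leftarrow>xs.
     if i div 2 ^ l = a \<and> j div 2 ^ l = b then real (n div 2 ^ l) / real n else 0)"

definition block_lists :: "nat \<Rightarrow> nat \<Rightarrow> (nat \<times> nat \<times> nat) list set" where
  "block_lists n K = {xs. set xs \<subseteq> {..K} \<times> {..n} \<times> {..n} \<and> length xs = 4 * n * K}"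

lemma block_matrix_append: "block_matrix n (xs @ ys) i j = block_matrix n xs i j + block_matrix n ys i j"
  by (simp add: block_matrix_def)

lemma block_matrix_concat:
  "block_matrix n (concat (map ys [0..<K])) i j = (\<Sum>l<K. block_matrix n (ys l) i j)"
proof (induction K)
  case 0
  then show ?case by (simp add: block_matrix_def)
qed (simp add: block_matrix_append)

lemma block_matrix_nonneg: "0 \<le> block_matrix n xs i j"
  unfolding block_matrix_def by (intro sum_list_nonneg) auto

section \<open>Multiscale increments of a monotone matrix\<close>

text \<open>The value at the corner of a block minus the value at the corner of its parent, the
  block of twice the side that contains it.\<close>

definition level_increment :: "matrix \<Rightarrow> nat \<Rightarrow> matrix" where
  "level_increment g l a b =
     g (2 ^ l * a) (2 ^ l * b) - g (2 ^ Suc l * (a div 2)) (2 ^ Suc l * (b div 2))"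

lemma level_increment_telescope:
  "(\<Sum>l<K. level_increment g l (i div 2 ^ l) (j div 2 ^ l)) = g i j - g (2 ^ K * (i div 2 ^ K)) (2 ^ K * (j div 2 ^ K))"
proof (induction K)
  case (Suc K)
  have "i div 2 ^ K div 2 = i div 2 ^ Suc K" for i :: nat
    by (metis div_mult2_eq power_Suc mult.commute)
  then show ?case using Suc by (simp add: level_increment_def)
qed simp

text \<open>The matrix of interest lives on \<open>{1..n}\<close>; row and column \<open>0\<close>
  are a zero boundary. It makes the coarsest corner value in the telescoping sum vanish, and with it
  all increments of blocks of index \<open>0\<close>.\<close>

locale monotone_grid =
  fixes n :: nat and g :: matrix
  assumes n: "n \<ge> 1"
    and g01: "\<And>i j. i \<le> n \<Longrightarrow> j \<le> n \<Longrightarrow> 0 \<le> g i j \<and> g i j \<le> 1"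
    and g0: "\<And>j. j \<le> n \<Longrightarrow> g 0 j = 0" "\<And>i. i \<le> n \<Longrightarrow> g i 0 = 0"
    and mono: "\<And>i i' j j'. i \<le> i' \<Longrightarrow> j \<le> j' \<Longrightarrow> i' \<le> n \<Longrightarrow> j' \<le> n \<Longrightarrow> g i j \<le> g i' j'"
begin

lemma scaled_le: "a \<le> n div 2 ^ l \<Longrightarrow> 2 ^ l * a \<le> n"
  by (metis div_times_less_eq_dividend mult.commute mult_le_mono2 order_trans)

lemma level_increment_nonneg:
  assumes "a \<le> n div 2 ^ l" "b \<le> n div 2 ^ l"
  shows "0 \<le> level_increment g l a b"
proof -
  have "2 ^ Suc l * (a div 2) \<le> 2 ^ l * a" for a :: nat
    by (simp add: mult.assoc mult.left_commute)
  then show ?thesis unfolding level_increment_def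
    using mono[of "2 ^ Suc l * (a div 2)" "2 ^ l * a" "2 ^ Suc l * (b div 2)" "2 ^ l * b"]
      assms[THEN scaled_le] by simp
qed

lemma level_increment_zero:
  assumes "a \<le> n div 2 ^ l" "b \<le> n div 2 ^ l" "a = 0 \<or> b = 0"
  shows "level_increment g l a b = 0"
proof -
  have "g (2 ^ l * a) (2 ^ l * b) = 0" using assms scaled_le[of _ l] g0 by auto
  moreover have "g (2 ^ Suc l * (a div 2)) (2 ^ Suc l * (b div 2)) = 0"
  proof -
    have "2 ^ Suc l * (c div 2) \<le> n" if "c \<le> n div 2 ^ l" for c
      using scaled_le[OF that] by (intro order_trans[OF _ scaled_le[OF that]]) (simp add: mult.assoc mult.left_commute)
    then show ?thesis using assms g0 by auto
  qed
  ultimately show ?thesis by (simp add: level_increment_def)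
qed

text \<open>The parent corner dominates the corner of the diagonal predecessor
  \<open>(a-1, b-1)\<close>, so by monotonicity an increment is at most a diagonal increment of the
  grid sampled at multiples of \<open>2 ^ l\<close>.\<close>

lemma sum_level_increment_le:
  defines "A \<equiv> \<lambda>l. n div 2 ^ l"
  shows "(\<Sum>a=1..A l. \<Sum>b=1..A l. level_increment g l a b) \<le> 2 * real (A l)"
proof -
  define h where "h = (\<lambda>a b. g (2 ^ l * a) (2 ^ l * b))"
  have "(\<Sum>a=1..A l. \<Sum>b=1..A l. level_increment g l a b) \<le> (\<Sum>a=1..A l. \<Sum>b=1..A l. h a b - h (a-1) (b-1))"
  proof (intro sum_mono)
    fix a b assume ab: "a \<in> {1..A l}" "b \<in> {1..A l}"
    have le: "2 ^ l * (c - 1) \<le> 2 ^ Suc l * (c div 2)" for c :: nat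
    proof -
      have "c - 1 \<le> 2 * (c div 2)" by presburger
      then have "2 ^ l * (c - 1) \<le> 2 ^ l * (2 * (c div 2))" by (rule mult_le_mono2)
      then show ?thesis by (simp add: mult.assoc mult.left_commute)
    qed
    have up: "2 ^ Suc l * (c div 2) \<le> n" if "c \<in> {1..A l}" for c
      using scaled_le[of c l] that A_def
      by (intro order_trans[OF _ scaled_le[of c l]]) (auto simp: mult.assoc mult.left_commute)
    show "level_increment g l a b \<le> h a b - h (a-1) (b-1)"
      unfolding level_increment_def h_def using mono[OF le le up up, OF ab] by simp
  qed
  also have "\<dots> \<le> 2 * real (A l)"
    unfolding h_def by (intro sum_diagonal_increments_le g01 scaled_le) (auto simp: A_def)
  finally show ?thesis .
qed

text \<open>The increments of one level are the vector \<open>d\<close> to which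
  \<open>simplex_rounding\<close> applies, and the functional \<open>x\<close> collects the total of
  \<open>X\<close> on each block. The rounded multiplicities are stored as a list of blocks.\<close>

lemma level_approximation:
  fixes X :: matrix and l :: nat
  defines "\<delta> \<equiv> \<lambda>i j. level_increment g l (i div 2 ^ l) (j div 2 ^ l)"
  obtains ys where "set ys \<subseteq> {l} \<times> {..n} \<times> {..n}" "length ys \<le> 4 * n"
    "(\<Sum>i=1..n. \<Sum>j=1..n. X i j * \<delta> i j) \<le> (\<Sum>i=1..n. \<Sum>j=1..n. X i j * block_matrix n ys i j)"
    "(\<Sum>i=1..n. \<Sum>j=1..n. (block_matrix n ys i j - \<delta> i j)\<^sup>2) \<le> 6 * real n"
    "\<And>i j. i \<in> {1..n} \<Longrightarrow> j \<in> {1..n} \<Longrightarrow> \<bar>block_matrix n ys i j - \<delta> i j\<bar> \<le> 1 / 2 ^ l"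
proof -
  define A where "A = n div 2 ^ l"
  define G where "G = {1..A} \<times> {1..A}"
  \<comment> \<open>The weight of a block of this level. The increments sum to at most
    \<open>2 * A = \<tau> * (2 * n)\<close>, so at every level at most \<open>4 * n\<close> blocks
    are needed.\<close>
  define \<tau> where "\<tau> = real A / real n"
  define d where "d = (\<lambda>(a, b). level_increment g l a b)"
  define m where "m = (\<lambda>(i :: nat) (j :: nat). (i div 2 ^ l, j div 2 ^ l))"
  have finG: "finite G" by (simp add: G_def)
  have A2: "A * 2 ^ l \<le> n" unfolding A_def by (rule div_times_less_eq_dividend)
  have mle: "i div 2 ^ l \<le> A" if "i \<in> {1..n}" for i using that unfolding A_def by (auto intro: div_le_mono)
  \<comment> \<open>\<open>G\<close> omits the blocks with an index \<open>0\<close>; their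
    increments vanish by \<open>level_increment_zero\<close>.\<close>
  have \<delta>G: "\<delta> i j = (\<Sum>Q\<in>G. of_bool (m i j = Q) * d Q)" if "i \<in> {1..n}" "j \<in> {1..n}" for i j
  proof -
    have "(\<Sum>Q\<in>G. of_bool (m i j = Q) * d Q) = (\<Sum>Q\<in>G. if m i j = Q then d Q else 0)"
      by (intro sum.cong) auto
    also have "\<dots> = (if m i j \<in> G then d (m i j) else 0)" using finG by (simp add: sum.delta)
    also have "\<dots> = \<delta> i j"
      using level_increment_zero[of "i div 2 ^ l" l "j div 2 ^ l"] mle[OF that(1)] mle[OF that(2)]
      unfolding \<delta>_def G_def m_def d_def A_def by auto
    finally show ?thesis by simp
  qed
  show thesis
  proof (cases "A = 0")
    case True
    then have "G = {}" by (simp add: G_def)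
    then have "\<delta> i j = 0" if "i \<in> {1..n}" "j \<in> {1..n}" for i j using \<delta>G[OF that] by simp
    then show thesis by (intro that[of "[]"]) (simp_all add: block_matrix_def)
  next
    case False
    then have \<tau>0: "\<tau> > 0" using n by (simp add: \<tau>_def)
    define x where "x = (\<lambda>Q. \<Sum>i=1..n. \<Sum>j=1..n. of_bool (m i j = Q) * X i j)"
    have d0: "0 \<le> d Q" if "Q \<in> G" for Q
      using that unfolding G_def d_def A_def by (auto intro: level_increment_nonneg)
    have Sd: "sum d G \<le> 2 * real A"
      using sum_level_increment_le[of l] by (simp add: G_def d_def A_def sum.cartesian_product)
    then have Sd': "sum d G \<le> \<tau> * real (2 * n)" using n by (simp add: \<tau>_def)
    obtain k where k: "sum k G \<le> 2 * (2 * n)" "\<And>Q. Q \<in> G \<Longrightarrow> \<bar>\<tau> * real (k Q) - d Q\<bar> \<le> \<tau>"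
        "(\<Sum>Q\<in>G. d Q * x Q) \<le> (\<Sum>Q\<in>G. \<tau> * real (k Q) * x Q)"
      using simplex_rounding[OF finG d0 Sd' \<tau>0, of x] by blast
    obtain zs where zs: "set zs \<subseteq> G" "length zs = sum k G"
        "\<And>h :: nat \<times> nat \<Rightarrow> real. sum_list (map h zs) = (\<Sum>Q\<in>G. real (k Q) * h Q)"
      using list_with_multiplicities[OF finG, of k] by metis
    define ys where "ys = map (\<lambda>(a, b). (l, a, b)) zs"
    have bm: "block_matrix n ys i j = (\<Sum>Q\<in>G. of_bool (m i j = Q) * (\<tau> * real (k Q)))" for i j
    proof -
      have "block_matrix n ys i j = sum_list (map (\<lambda>Q. of_bool (m i j = Q) * \<tau>) zs)"
        unfolding block_matrix_def ys_def map_map o_def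
      proof (intro arg_cong[where f = sum_list] map_cong refl)
        fix Q :: "nat \<times> nat"
        obtain a b where "Q = (a, b)" by (cases Q)
        then show "(case (case Q of (a, b) \<Rightarrow> (l, a, b)) of (l, a, b) \<Rightarrow>
            if i div 2 ^ l = a \<and> j div 2 ^ l = b then real (n div 2 ^ l) / real n else 0) = of_bool (m i j = Q) * \<tau>"
          by (cases "i div 2 ^ l = a \<and> j div 2 ^ l = b") (simp_all add: m_def \<tau>_def A_def)
      qed
      also have "\<dots> = (\<Sum>Q\<in>G. real (k Q) * (of_bool (m i j = Q) * \<tau>))" by (rule zs)
      finally show ?thesis by (simp add: mult_ac)
    qed
    have swap: "(\<Sum>i=1..n. \<Sum>j=1..n. X i j * (\<Sum>Q\<in>G. of_bool (m i j = Q) * f Q)) = (\<Sum>Q\<in>G. f Q * x Q)" for f :: "_ \<Rightarrow> real"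
    proof -
      have "(\<Sum>i=1..n. \<Sum>j=1..n. X i j * (\<Sum>Q\<in>G. of_bool (m i j = Q) * f Q)) =
         (\<Sum>i=1..n. \<Sum>Q\<in>G. \<Sum>j=1..n. of_bool (m i j = Q) * X i j * f Q)"
        unfolding sum_distrib_left by (subst sum.swap) (simp add: mult_ac)
      also have "\<dots> = (\<Sum>Q\<in>G. f Q * x Q)"
        unfolding x_def sum_distrib_left by (subst sum.swap) (simp add: mult_ac)
      finally show ?thesis .
    qed
    define e where "e = (\<lambda>Q. \<tau> * real (k Q) - d Q)"
    have diff: "block_matrix n ys i j - \<delta> i j = (if m i j \<in> G then e (m i j) else 0)"
      if "i \<in> {1..n}" "j \<in> {1..n}" for i j
    proof -
      have "block_matrix n ys i j - \<delta> i j = (\<Sum>Q\<in>G. if m i j = Q then e Q else 0)"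
        unfolding bm \<delta>G[OF that] sum_subtractf[symmetric] by (intro sum.cong) (auto simp: e_def)
      then show ?thesis using finG by (simp add: sum.delta)
    qed
    have \<tau>l: "\<tau> \<le> 1 / 2 ^ l"
    proof -
      have "real A * 2 ^ l \<le> real n" using A2 by (simp flip: of_nat_le_iff[where ?'a = real])
      then show ?thesis using n unfolding \<tau>_def by (simp add: field_simps)
    qed
    have abs: "\<bar>block_matrix n ys i j - \<delta> i j\<bar> \<le> 1 / 2 ^ l" if "i \<in> {1..n}" "j \<in> {1..n}" for i j
    proof (cases "m i j \<in> G")
      case True
      then show ?thesis using diff[OF that] k(2)[of "m i j"] \<tau>l by (simp add: e_def)
    qed (simp add: diff[OF that])
    have cell: "(\<Sum>i=1..n. of_bool (i div 2 ^ l = a)) \<le> (2 ^ l :: real)" for a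
    proof -
      have "{i \<in> {1..n}. i div 2 ^ l = a} \<subseteq> {2 ^ l * a..<2 ^ l * a + 2 ^ l}"
      proof
        fix i assume "i \<in> {i \<in> {1..n}. i div 2 ^ l = a}"
        then have "i = 2 ^ l * a + i mod 2 ^ l" by auto
        moreover have "i mod 2 ^ l < 2 ^ l" by simp
        ultimately show "i \<in> {2 ^ l * a..<2 ^ l * a + 2 ^ l}" by (metis add_le_cancel_left atLeastLessThan_iff le_add1 nat_add_left_cancel_less)
      qed
      then have "card {i \<in> {1..n}. i div 2 ^ l = a} \<le> card {2 ^ l * a..<2 ^ l * a + 2 ^ l}"
        by (intro card_mono) auto
      then have "card {i \<in> {1..n}. i div 2 ^ l = a} \<le> 2 ^ l" by simp
      then have "real (card {i \<in> {1..n}. i div 2 ^ l = a}) \<le> 2 ^ l"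
        by (metis of_nat_le_iff of_nat_numeral of_nat_power)
      moreover have "(\<Sum>i=1..n. of_bool (i div 2 ^ l = a)) = real (card {i \<in> {1..n}. i div 2 ^ l = a})"
        by (simp add: of_bool_def flip: sum.inter_filter)
      ultimately show ?thesis by simp
    qed
    have "(\<Sum>i=1..n. \<Sum>j=1..n. (block_matrix n ys i j - \<delta> i j)\<^sup>2)
        = (\<Sum>i=1..n. \<Sum>j=1..n. \<Sum>Q\<in>G. of_bool (m i j = Q) * (e Q)\<^sup>2)"
    proof (intro sum.cong refl)
      fix i j assume ij: "i \<in> {1..n}" "j \<in> {1..n}"
      have "(\<Sum>Q\<in>G. of_bool (m i j = Q) * (e Q)\<^sup>2) = (\<Sum>Q\<in>G. if m i j = Q then (e Q)\<^sup>2 else 0)"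
        by (intro sum.cong) auto
      then show "(block_matrix n ys i j - \<delta> i j)\<^sup>2 = (\<Sum>Q\<in>G. of_bool (m i j = Q) * (e Q)\<^sup>2)"
        using finG diff[OF ij] by (simp add: sum.delta)
    qed
    also have "\<dots> = (\<Sum>i=1..n. \<Sum>Q\<in>G. \<Sum>j=1..n. of_bool (m i j = Q) * (e Q)\<^sup>2)"
      by (intro sum.cong refl sum.swap)
    also have "\<dots> = (\<Sum>Q\<in>G. \<Sum>i=1..n. \<Sum>j=1..n. of_bool (m i j = Q) * (e Q)\<^sup>2)"
      by (rule sum.swap)
    \<comment> \<open>A block has at most \<open>2 ^ l * 2 ^ l\<close> entries. One factor of the
      squared error is bounded by \<open>\<tau>\<close> and the other is kept, so that the total
      error, at most \<open>6 * A\<close>, enters in place of the number of blocks.\<close>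
    also have "\<dots> \<le> (\<Sum>Q\<in>G. 2 ^ l * 2 ^ l * (\<tau> * \<bar>e Q\<bar>))"
    proof (intro sum_mono)
      fix Q assume Q: "Q \<in> G"
      obtain a b where ab: "Q = (a, b)" by (cases Q)
      have "(\<Sum>i=1..n. \<Sum>j=1..n. of_bool (m i j = Q) * (e Q)\<^sup>2) =
         (\<Sum>i=1..n. of_bool (i div 2 ^ l = a)) * (\<Sum>j=1..n. of_bool (j div 2 ^ l = b)) * (e Q)\<^sup>2"
        unfolding m_def ab sum_product sum_distrib_right by (intro sum.cong refl) auto
      also have "\<dots> \<le> 2 ^ l * 2 ^ l * (e Q)\<^sup>2"
        by (intro mult_right_mono mult_mono cell sum_nonneg) auto
      also have "\<dots> \<le> 2 ^ l * 2 ^ l * (\<tau> * \<bar>e Q\<bar>)"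
      proof -
        have "(e Q)\<^sup>2 = \<bar>e Q\<bar> * \<bar>e Q\<bar>" by (simp add: power2_eq_square)
        also have "\<dots> \<le> \<tau> * \<bar>e Q\<bar>" using k(2)[OF Q] by (intro mult_right_mono) (auto simp: e_def)
        finally show ?thesis by (intro mult_left_mono) auto
      qed
      finally show "(\<Sum>i=1..n. \<Sum>j=1..n. of_bool (m i j = Q) * (e Q)\<^sup>2) \<le> 2 ^ l * 2 ^ l * (\<tau> * \<bar>e Q\<bar>)" .
    qed
    also have "\<dots> = 2 ^ l * 2 ^ l * \<tau> * (\<Sum>Q\<in>G. \<bar>e Q\<bar>)" by (simp add: sum_distrib_left mult_ac)
    also have "\<dots> \<le> 2 ^ l * 2 ^ l * \<tau> * (6 * real A)"
    proof (intro mult_left_mono)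
      have "(\<Sum>Q\<in>G. \<bar>e Q\<bar>) \<le> (\<Sum>Q\<in>G. \<tau> * real (k Q) + d Q)"
        unfolding e_def using d0 \<tau>0 by (intro sum_mono) (smt (verit) mult_nonneg_nonneg of_nat_0_le_iff)
      also have "\<dots> = \<tau> * real (sum k G) + sum d G" by (simp add: sum.distrib sum_distrib_left)
      also have "\<dots> \<le> \<tau> * real (4 * n) + 2 * real A"
        using k(1) Sd \<tau>0 by (intro add_mono mult_left_mono) (auto simp del: of_nat_sum)
      also have "\<dots> = 6 * real A" using n by (simp add: \<tau>_def)
      finally show "(\<Sum>Q\<in>G. \<bar>e Q\<bar>) \<le> 6 * real A" .
    qed (use \<tau>0 in auto)
    also have "\<dots> = 6 * (real (A * 2 ^ l))\<^sup>2 / real n" by (simp add: \<tau>_def power2_eq_square)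
    also have "\<dots> \<le> 6 * (real n)\<^sup>2 / real n"
      using A2 by (intro divide_right_mono mult_left_mono power_mono) (auto simp del: of_nat_mult)
    also have "\<dots> = 6 * real n" by (simp add: power2_eq_square)
    finally have sq: "(\<Sum>i=1..n. \<Sum>j=1..n. (block_matrix n ys i j - \<delta> i j)\<^sup>2) \<le> 6 * real n" .
    have "(\<Sum>i=1..n. \<Sum>j=1..n. X i j * \<delta> i j) = (\<Sum>Q\<in>G. d Q * x Q)"
      unfolding swap[symmetric] by (intro sum.cong refl) (auto simp: \<delta>G)
    also have "\<dots> \<le> (\<Sum>i=1..n. \<Sum>j=1..n. X i j * block_matrix n ys i j)"
      unfolding bm swap by (rule k(3))
    finally have lin: "(\<Sum>i=1..n. \<Sum>j=1..n. X i j * \<delta> i j) \<le> (\<Sum>i=1..n. \<Sum>j=1..n. X i j * block_matrix n ys i j)" .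
    have AN: "A \<le> n" by (simp add: A_def)
    show thesis
      using zs k(1) AN by (intro that[of ys] lin sq abs) (auto simp: ys_def G_def)
  qed
qed

text \<open>The levels below \<open>K\<close> are approximated separately and added. The linear
  inequality adds up, and Cauchy-Schwarz over the levels gives the factor \<open>K\<^sup>2\<close>
  in the squared error.\<close>

lemma block_approximation:
  fixes X :: matrix
  assumes K: "n < 2 ^ K"
  obtains xs where "xs \<in> block_lists n K"
    "(\<Sum>i=1..n. \<Sum>j=1..n. X i j * g i j) \<le> (\<Sum>i=1..n. \<Sum>j=1..n. X i j * block_matrix n xs i j)"
    "(\<Sum>i=1..n. \<Sum>j=1..n. (block_matrix n xs i j - g i j)\<^sup>2) \<le> 6 * real n * (real K)\<^sup>2"
    "\<And>i j. i \<in> {1..n} \<Longrightarrow> j \<in> {1..n} \<Longrightarrow> block_matrix n xs i j \<le> 3"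
proof -
  define \<delta> where "\<delta> = (\<lambda>l i j. level_increment g l (i div 2 ^ l) (j div 2 ^ l))"
  have "\<exists>ys. \<forall>l. set (ys l) \<subseteq> {l} \<times> {..n} \<times> {..n} \<and> length (ys l) \<le> 4 * n \<and>
    (\<Sum>i=1..n. \<Sum>j=1..n. X i j * \<delta> l i j) \<le> (\<Sum>i=1..n. \<Sum>j=1..n. X i j * block_matrix n (ys l) i j) \<and>
    (\<Sum>i=1..n. \<Sum>j=1..n. (block_matrix n (ys l) i j - \<delta> l i j)\<^sup>2) \<le> 6 * real n \<and>
    (\<forall>i\<in>{1..n}. \<forall>j\<in>{1..n}. \<bar>block_matrix n (ys l) i j - \<delta> l i j\<bar> \<le> 1 / 2 ^ l)"
  proof (intro choice allI)
    fix l
    obtain ys where "set ys \<subseteq> {l} \<times> {..n} \<times> {..n}" "length ys \<le> 4 * n"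
      "(\<Sum>i=1..n. \<Sum>j=1..n. X i j * \<delta> l i j) \<le> (\<Sum>i=1..n. \<Sum>j=1..n. X i j * block_matrix n ys i j)"
      "(\<Sum>i=1..n. \<Sum>j=1..n. (block_matrix n ys i j - \<delta> l i j)\<^sup>2) \<le> 6 * real n"
      "\<And>i j. i \<in> {1..n} \<Longrightarrow> j \<in> {1..n} \<Longrightarrow> \<bar>block_matrix n ys i j - \<delta> l i j\<bar> \<le> 1 / 2 ^ l"
      unfolding \<delta>_def by (rule level_approximation[of l X]) blast
    then show "\<exists>ys. set ys \<subseteq> {l} \<times> {..n} \<times> {..n} \<and> length ys \<le> 4 * n \<and>
      (\<Sum>i=1..n. \<Sum>j=1..n. X i j * \<delta> l i j) \<le> (\<Sum>i=1..n. \<Sum>j=1..n. X i j * block_matrix n ys i j) \<and>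
      (\<Sum>i=1..n. \<Sum>j=1..n. (block_matrix n ys i j - \<delta> l i j)\<^sup>2) \<le> 6 * real n \<and>
      (\<forall>i\<in>{1..n}. \<forall>j\<in>{1..n}. \<bar>block_matrix n ys i j - \<delta> l i j\<bar> \<le> 1 / 2 ^ l)"
      by (intro exI[of _ ys] conjI ballI) auto
  qed
  then obtain ys where ys: "\<And>l. set (ys l) \<subseteq> {l} \<times> {..n} \<times> {..n}" "\<And>l. length (ys l) \<le> 4 * n"
    "\<And>l. (\<Sum>i=1..n. \<Sum>j=1..n. X i j * \<delta> l i j) \<le> (\<Sum>i=1..n. \<Sum>j=1..n. X i j * block_matrix n (ys l) i j)"
    "\<And>l. (\<Sum>i=1..n. \<Sum>j=1..n. (block_matrix n (ys l) i j - \<delta> l i j)\<^sup>2) \<le> 6 * real n"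
    "\<And>l i j. i \<in> {1..n} \<Longrightarrow> j \<in> {1..n} \<Longrightarrow> \<bar>block_matrix n (ys l) i j - \<delta> l i j\<bar> \<le> 1 / 2 ^ l" by blast
  define zs where "zs = concat (map ys [0..<K])"
  \<comment> \<open>The padding blocks have weight \<open>0\<close>, since
    \<open>n div 2 ^ K = 0\<close>.\<close>
  define xs where "xs = zs @ replicate (4 * n * K - length zs) (K, 0, 0)"
  have "length zs \<le> 4 * n * K"
    unfolding zs_def
  proof (induction K)
    case (Suc K)
    then show ?case using ys(2)[of K] by simp
  qed simp
  moreover have "set zs \<subseteq> {..K} \<times> {..n} \<times> {..n}"
    using ys(1) unfolding zs_def by fastforce
  ultimately have xs: "xs \<in> block_lists n K" unfolding block_lists_def xs_def by auto
  have bm: "block_matrix n xs i j = (\<Sum>l<K. block_matrix n (ys l) i j)" for i j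
  proof -
    have "block_matrix n (replicate k (K, 0, 0)) i j = 0" for k
      using K by (simp add: block_matrix_def sum_list_replicate)
    then show ?thesis unfolding xs_def block_matrix_append by (simp add: zs_def block_matrix_concat)
  qed
  \<comment> \<open>The index is below \<open>2 ^ K\<close>, so the last term of the telescoping sum
    is \<open>g 0 0 = 0\<close>.\<close>
  have gd: "g i j = (\<Sum>l<K. \<delta> l i j)" if "i \<in> {1..n}" "j \<in> {1..n}" for i j
    using that K g0 unfolding \<delta>_def level_increment_telescope by simp
  have swp: "(\<Sum>i=1..n. \<Sum>j=1..n. \<Sum>l<K. f i j l) = (\<Sum>l<K. \<Sum>i=1..n. \<Sum>j=1..n. f i j l)" for f :: "nat \<Rightarrow> nat \<Rightarrow> nat \<Rightarrow> real"
    by (subst sum.swap[of _ "{..<K}"]) (intro sum.cong refl sum.swap)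
  have "(\<Sum>i=1..n. \<Sum>j=1..n. X i j * g i j) = (\<Sum>l<K. \<Sum>i=1..n. \<Sum>j=1..n. X i j * \<delta> l i j)"
    unfolding swp[symmetric] by (intro sum.cong refl) (simp add: gd sum_distrib_left)
  also have "\<dots> \<le> (\<Sum>l<K. \<Sum>i=1..n. \<Sum>j=1..n. X i j * block_matrix n (ys l) i j)"
    by (intro sum_mono ys)
  also have "\<dots> = (\<Sum>i=1..n. \<Sum>j=1..n. X i j * block_matrix n xs i j)"
    unfolding bm swp[symmetric] by (simp add: sum_distrib_left)
  finally have lin: "(\<Sum>i=1..n. \<Sum>j=1..n. X i j * g i j) \<le> (\<Sum>i=1..n. \<Sum>j=1..n. X i j * block_matrix n xs i j)" .
  have diff: "block_matrix n xs i j - g i j = (\<Sum>l<K. block_matrix n (ys l) i j - \<delta> l i j)"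
    if "i \<in> {1..n}" "j \<in> {1..n}" for i j
    unfolding bm gd[OF that] by (simp add: sum_subtractf)
  have "(\<Sum>i=1..n. \<Sum>j=1..n. (block_matrix n xs i j - g i j)\<^sup>2) \<le>
      (\<Sum>i=1..n. \<Sum>j=1..n. \<Sum>l<K. real K * (block_matrix n (ys l) i j - \<delta> l i j)\<^sup>2)"
  proof (intro sum_mono)
    fix i j assume ij: "i \<in> {1..n}" "j \<in> {1..n}"
    show "(block_matrix n xs i j - g i j)\<^sup>2 \<le> (\<Sum>l<K. real K * (block_matrix n (ys l) i j - \<delta> l i j)\<^sup>2)"
      unfolding diff[OF ij]
      using sum_squared_le_sum_of_squares[of "\<lambda>l. block_matrix n (ys l) i j - \<delta> l i j" "{..<K}"]
      by (simp add: sum_distrib_left sum_distrib_right mult.commute)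
  qed
  also have "\<dots> = (\<Sum>l<K. real K * (\<Sum>i=1..n. \<Sum>j=1..n. (block_matrix n (ys l) i j - \<delta> l i j)\<^sup>2))"
    unfolding swp by (simp add: sum_distrib_left)
  also have "\<dots> \<le> (\<Sum>l<K. real K * (6 * real n))"
    by (intro sum_mono mult_left_mono ys) auto
  also have "\<dots> = 6 * real n * (real K)\<^sup>2" by (simp add: power2_eq_square)
  finally have sq: "(\<Sum>i=1..n. \<Sum>j=1..n. (block_matrix n xs i j - g i j)\<^sup>2) \<le> 6 * real n * (real K)\<^sup>2" .
  \<comment> \<open>The entrywise errors of the levels form a geometric series of sum at most
    \<open>2\<close>, added to \<open>g \<le> 1\<close>.\<close>
  have "block_matrix n xs i j \<le> 3" if "i \<in> {1..n}" "j \<in> {1..n}" for i j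
  proof -
    have "block_matrix n xs i j - g i j \<le> (\<Sum>l<K. 1 / 2 ^ l)"
      unfolding diff[OF that] using ys(5)[OF that] by (intro sum_mono) (meson abs_le_D1)
    also have "(\<Sum>l<K. 1 / 2 ^ l :: real) \<le> 2"
    proof -
      have "(\<Sum>l<K. 1 / 2 ^ l :: real) = 2 - 2 / 2 ^ K"
        by (induction K) (auto simp: field_simps)
      then show ?thesis by simp
    qed
    finally show ?thesis using g01[of i j] that by simp
  qed
  then show thesis using that xs lin sq by blast
qed

end

section \<open>Exponential moments of the noise\<close>

lemma exp_le_quadratic:
  fixes x :: real
  assumes "\<bar>x\<bar> \<le> 1"
  shows "exp x \<le> 1 + x + x\<^sup>2"
proof (cases "x \<ge> 0")
  case True
  then show ?thesis using assms exp_bound[of x] by simp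
next
  case False
  have "1 \<le> (1 + x + x\<^sup>2) * (1 - x)"
  proof -
    have "(1 + x + x\<^sup>2) * (1 - x) = 1 + (- x) ^ 3" by (simp add: algebra_simps power3_eq_cube power2_eq_square)
    then show ?thesis using False by simp
  qed
  also have "\<dots> \<le> (1 + x + x\<^sup>2) * exp (- x)"
    using exp_ge_add_one_self[of "-x"] assms by (intro mult_left_mono) (auto simp: add_nonneg_nonneg)
  finally show ?thesis by (simp add: exp_minus field_simps)
qed

lemma expectation_pair_pmf_finite:
  fixes f :: "'a \<times> 'b \<Rightarrow> real"
  assumes "finite (set_pmf M)" "finite (set_pmf N)"
  shows "measure_pmf.expectation (pair_pmf M N) f =
    measure_pmf.expectation N (\<lambda>b. measure_pmf.expectation M (\<lambda>a. f (a, b)))"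
proof -
  have "measure_pmf.expectation (pair_pmf M N) f =
      (\<Sum>x\<in>set_pmf M \<times> set_pmf N. f x * pmf (pair_pmf M N) x)"
    using assms by (intro integral_measure_pmf_real) auto
  also have "\<dots> = (\<Sum>a\<in>set_pmf M. \<Sum>b\<in>set_pmf N. f (a, b) * pmf M a * pmf N b)"
    unfolding sum.cartesian_product by (intro sum.cong) (auto simp: pmf_pair)
  also have "\<dots> = (\<Sum>b\<in>set_pmf N. \<Sum>a\<in>set_pmf M. f (a, b) * pmf M a * pmf N b)"
    by (rule sum.swap)
  also have "\<dots> = measure_pmf.expectation N (\<lambda>b. measure_pmf.expectation M (\<lambda>a. f (a, b)))"
    using assms by (simp add: integral_measure_pmf_real[of "set_pmf M"] integral_measure_pmf_real[of "set_pmf N"] sum_distrib_right)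
  finally show ?thesis .
qed

text \<open>Chernoff's bound: the indicator of the event is at most
  \<open>exp (f s - u - v)\<close>.\<close>

lemma prob_le_exp_moment:
  fixes f :: "'a \<Rightarrow> real"
  assumes "finite (set_pmf M)" "measure_pmf.expectation M (\<lambda>s. exp (f s)) \<le> exp u"
  shows "measure_pmf.prob M {s. f s > u + v} \<le> exp (- v)"
proof -
  have int: "integrable (measure_pmf M) g" for g :: "'a \<Rightarrow> real"
    using assms(1) by (rule integrable_measure_pmf_finite)
  have "measure_pmf.prob M {s. f s > u + v} = measure_pmf.expectation M (indicator {s. f s > u + v})"
    by simp
  also have "\<dots> \<le> measure_pmf.expectation M (\<lambda>s. exp (f s) * exp (- u - v))"
    by (intro integral_mono int) (auto simp: indicator_def simp flip: exp_add)
  also have "\<dots> = measure_pmf.expectation M (\<lambda>s. exp (f s)) * exp (- u - v)" by simp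
  also have "\<dots> \<le> exp u * exp (- u - v)" using assms(2) by (intro mult_right_mono) auto
  also have "\<dots> = exp (- v)" by (simp flip: exp_add)
  finally show ?thesis .
qed

lemma finite_set_Pi_pmf_bool: "finite U \<Longrightarrow> finite (set_pmf (Pi_pmf U False (f :: 'a \<Rightarrow> bool pmf)))"
  by (simp add: set_Pi_pmf finite_PiE_dflt)

text \<open>By independence the exponential moment is a product over the entries, and each factor is
  at most \<open>1 + v e\<close> because the mean vanishes and
  \<open>exp x \<le> 1 + x + x\<^sup>2\<close> on \<open>[-1, 1]\<close>. Writing
  \<open>mean\<close> as an explicit four-term average over outcome and observation reduces the
  moment conditions to algebra.\<close>

lemma exp_moment_sum_le:
  fixes h :: "'a \<Rightarrow> bool \<Rightarrow> bool \<Rightarrow> real" and a :: "'a \<Rightarrow> real"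
  assumes U: "finite U" and b: "0 \<le> b" "b \<le> 1" and a: "\<And>e. e \<in> U \<Longrightarrow> 0 \<le> a e \<and> a e \<le> 1"
  defines "mean \<equiv> \<lambda>e k. b * (a e * k True True + (1 - a e) * k False True)
      + (1 - b) * (a e * k True False + (1 - a e) * k False False)"
  assumes h1: "\<And>e z w. e \<in> U \<Longrightarrow> \<bar>h e z w\<bar> \<le> 1"
    and h0: "\<And>e. e \<in> U \<Longrightarrow> mean e (h e) = 0"
    and h2: "\<And>e. e \<in> U \<Longrightarrow> mean e (\<lambda>z w. (h e z w)\<^sup>2) \<le> v e"
  shows "measure_pmf.expectation
      (pair_pmf (Pi_pmf U False (\<lambda>e. bernoulli_pmf (a e))) (Pi_pmf U False (\<lambda>_. bernoulli_pmf b)))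
      (\<lambda>s. exp (\<Sum>e\<in>U. h e (fst s e) (snd s e))) \<le> exp (\<Sum>e\<in>U. v e)"
proof -
  have int: "integrable (measure_pmf (bernoulli_pmf q)) g" for q and g :: "bool \<Rightarrow> real"
    by (intro integrable_measure_pmf_finite) (rule finite_subset[OF subset_UNIV], simp)
  let ?E = "\<lambda>e. measure_pmf.expectation (bernoulli_pmf b)
      (\<lambda>w. measure_pmf.expectation (bernoulli_pmf (a e)) (\<lambda>z. exp (h e z w)))"
  have "measure_pmf.expectation
      (pair_pmf (Pi_pmf U False (\<lambda>e. bernoulli_pmf (a e))) (Pi_pmf U False (\<lambda>_. bernoulli_pmf b)))
      (\<lambda>s. exp (\<Sum>e\<in>U. h e (fst s e) (snd s e))) = (\<Prod>e\<in>U. ?E e)"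
  proof -
    have "measure_pmf.expectation (Pi_pmf U False (\<lambda>e. bernoulli_pmf (a e)))
        (\<lambda>z. exp (\<Sum>e\<in>U. h e (z e) (w e))) =
        (\<Prod>e\<in>U. measure_pmf.expectation (bernoulli_pmf (a e)) (\<lambda>z. exp (h e z (w e))))" for w
      using expectation_prod_Pi_pmf[OF U, of "\<lambda>e. bernoulli_pmf (a e)" "\<lambda>e z. exp (h e z (w e))" False] U
      by (simp add: exp_sum int)
    moreover have "measure_pmf.expectation (Pi_pmf U False (\<lambda>_. bernoulli_pmf b))
        (\<lambda>w. \<Prod>e\<in>U. measure_pmf.expectation (bernoulli_pmf (a e)) (\<lambda>z. exp (h e z (w e)))) = (\<Prod>e\<in>U. ?E e)"
      by (rule expectation_prod_Pi_pmf[OF U, of "\<lambda>_. bernoulli_pmf b"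
            "\<lambda>e w. measure_pmf.expectation (bernoulli_pmf (a e)) (\<lambda>z. exp (h e z w))"])
        (auto intro: int Bochner_Integration.integral_nonneg)
    ultimately show ?thesis
      using U by (simp add: expectation_pair_pmf_finite finite_set_Pi_pmf_bool)
  qed
  also have "\<dots> \<le> (\<Prod>e\<in>U. exp (v e))"
  proof (intro prod_mono conjI)
    fix e assume e: "e \<in> U"
    have "?E e = mean e (\<lambda>z w. exp (h e z w))"
      using a[OF e] b by (simp add: mean_def mult.commute)
    also have "\<dots> \<le> mean e (\<lambda>z w. 1 + h e z w + (h e z w)\<^sup>2)"
      unfolding mean_def using a[OF e] b h1[OF e]
      by (intro add_mono mult_left_mono exp_le_quadratic) auto
    also have "\<dots> = 1 + mean e (h e) + mean e (\<lambda>z w. (h e z w)\<^sup>2)"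
      unfolding mean_def by (simp add: algebra_simps)
    also have "\<dots> \<le> 1 + v e" using h0[OF e] h2[OF e] by simp
    also have "\<dots> \<le> exp (v e)" by (rule exp_ge_add_one_self)
    finally show "?E e \<le> exp (v e)" .
  qed (auto intro!: Bochner_Integration.integral_nonneg)
  also have "\<dots> = exp (\<Sum>e\<in>U. v e)" using U by (simp add: exp_sum)
  finally show ?thesis .
qed

section \<open>The noise matrix and its symmetry\<close>

text \<open>A missing entry equals \<open>1/2\<close>, so after subtraction of \<open>J/2\<close> it
  is zero; dividing by the true \<open>p > 0\<close> and adding \<open>J/2\<close> back gives an
  unbiased estimate of \<open>\<theta>\<close> above the diagonal.\<close>

definition noise :: "model \<Rightarrow> nat \<Rightarrow> real \<Rightarrow> matrix \<Rightarrow> sample \<Rightarrow> matrix" where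
  "noise md n p \<theta> s = (\<lambda>i j. (data_matrix md n s i j - J n i j / 2) / p + J n i j / 2 - \<theta> i j)"

fun reflect :: "model \<Rightarrow> real \<Rightarrow> real" where
  "reflect Tournament x = 1 - x"
| "reflect Graph x = x"

text \<open>The slope of \<open>reflect\<close>: the factor by which the noise changes under
  transposition.\<close>

fun reflect_sign :: "model \<Rightarrow> real" where
  "reflect_sign Tournament = - 1"
| "reflect_sign Graph = 1"

lemma finite_upper: "finite (upper n)"
  by (rule finite_subset[of _ "{1..n} \<times> {1..n}"]) (auto simp: upper_def)

lemma square_eq_upper: "{1..n} \<times> {1..n} = upper n \<union> prod.swap ` upper n \<union> (\<lambda>i. (i, i)) ` {1..n}"
proof -
  have "(a, b) \<in> prod.swap ` upper n" if "a \<in> {1..n}" "b \<in> {1..n}" "b < a" for a b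
    using that by (intro image_eqI[of _ _ "(b, a)"]) (auto simp: upper_def)
  then show ?thesis by (force simp: upper_def)
qed

lemma sum_square_eq_upper:
  fixes F :: matrix
  assumes "\<And>i. i \<in> {1..n} \<Longrightarrow> F i i = 0"
  shows "(\<Sum>i=1..n. \<Sum>j=1..n. F i j) = (\<Sum>(i, j)\<in>upper n. F i j + F j i)"
proof -
  have "(\<Sum>i=1..n. \<Sum>j=1..n. F i j) = (\<Sum>(i, j)\<in>{1..n} \<times> {1..n}. F i j)"
    by (simp add: sum.cartesian_product)
  also have "\<dots> = (\<Sum>(i, j)\<in>upper n \<union> prod.swap ` upper n. F i j) + (\<Sum>(i, j)\<in>(\<lambda>i. (i, i)) ` {1..n}. F i j)"
    unfolding square_eq_upper by (rule sum.union_disjoint) (simp_all add: finite_upper, auto simp: upper_def)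
  also have "(\<Sum>(i, j)\<in>(\<lambda>i. (i, i)) ` {1..n}. F i j) = 0"
    using assms by (intro sum.neutral) auto
  also have "(\<Sum>(i, j)\<in>upper n \<union> prod.swap ` upper n. F i j) =
      (\<Sum>(i, j)\<in>upper n. F i j) + (\<Sum>(i, j)\<in>prod.swap ` upper n. F i j)"
    by (rule sum.union_disjoint) (simp_all add: finite_upper, auto simp: upper_def)
  also have "(\<Sum>(i, j)\<in>prod.swap ` upper n. F i j) = (\<Sum>(i, j)\<in>upper n. F j i)"
    by (subst sum.reindex) (auto simp: case_prod_unfold)
  finally show ?thesis by (simp add: case_prod_unfold sum.distrib)
qed

lemma Theta_cases:
  assumes "\<theta> \<in> Theta md n"
  obtains \<phi> \<pi> where "\<phi> \<in> ordered_class md n" "\<pi> permutes {1..n}" "\<theta> = mat_perm \<phi> \<pi>"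
  using assms unfolding Theta_def by blast

lemma ordered_class_unit: "\<phi> \<in> ordered_class md n \<Longrightarrow> \<phi> \<in> unit_matrices n"
  by (cases md) (auto simp: tournament_matrices_def graph_matrices_def)

lemma ordered_class_reflect:
  assumes "\<phi> \<in> ordered_class md n" "i \<in> {1..n}" "j \<in> {1..n}" "i \<noteq> j"
  shows "\<phi> j i = reflect md (\<phi> i j)"
proof (cases md)
  case Tournament
  then have "\<phi> j i = 1 - \<phi> i j"
    using assms unfolding Tournament ordered_class.simps tournament_matrices_def by blast
  then show ?thesis unfolding Tournament reflect.simps .
next
  case Graph
  then have "\<phi> j i = \<phi> i j"
    using assms unfolding Graph ordered_class.simps graph_matrices_def by blast
  then show ?thesis unfolding Graph reflect.simps .
qed

lemma ordered_class_diag: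
  assumes "\<phi> \<in> ordered_class md n"
  shows "\<phi> i i = 0"
proof (cases "i \<in> {1..n}")
  case True
  then show ?thesis using assms
    by (cases md) (simp_all only: ordered_class.simps tournament_matrices_def graph_matrices_def mem_Collect_eq)
next
  case False
  then show ?thesis using ordered_class_unit[OF assms] by (simp add: unit_matrices_def)
qed

lemma Theta_unit:
  assumes "\<theta> \<in> Theta md n"
  shows "\<theta> \<in> unit_matrices n"
proof -
  obtain \<phi> \<pi> where *: "\<phi> \<in> ordered_class md n" "\<pi> permutes {1..n}" "\<theta> = mat_perm \<phi> \<pi>"
    using assms by (rule Theta_cases)
  have u: "\<phi> \<in> unit_matrices n" using * by (simp add: ordered_class_unit)
  have m: "\<pi> i \<in> {1..n} \<longleftrightarrow> i \<in> {1..n}" for i using *(2) by (rule permutes_in_image)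
  have "0 \<le> \<phi> (\<pi> i) (\<pi> j) \<and> \<phi> (\<pi> i) (\<pi> j) \<le> 1" if "i \<in> {1..n}" "j \<in> {1..n}" for i j
    using u that m unfolding unit_matrices_def by blast
  moreover have "\<phi> (\<pi> i) (\<pi> j) = 0" if "i \<notin> {1..n} \<or> j \<notin> {1..n}" for i j
    using u that m unfolding unit_matrices_def by blast
  ultimately show ?thesis unfolding *(3) mat_perm_def unit_matrices_def by simp
qed

lemma Theta_reflect:
  assumes "\<theta> \<in> Theta md n" "i \<in> {1..n}" "j \<in> {1..n}" "i \<noteq> j"
  shows "\<theta> j i = reflect md (\<theta> i j)"
proof -
  obtain \<phi> \<pi> where *: "\<phi> \<in> ordered_class md n" "\<pi> permutes {1..n}" "\<theta> = mat_perm \<phi> \<pi>"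
    using assms(1) by (rule Theta_cases)
  have "\<pi> i \<noteq> \<pi> j" using *(2) assms(4) by (metis permutes_inv_eq)
  then show ?thesis
    using ordered_class_reflect[OF *(1), of "\<pi> i" "\<pi> j"] permutes_in_image[OF *(2)] assms
    unfolding *(3) mat_perm_def by simp
qed

lemma Theta_diag: "\<theta> \<in> Theta md n \<Longrightarrow> \<theta> i i = 0"
  by (erule Theta_cases) (simp add: mat_perm_def ordered_class_diag)

lemma noise_upper:
  assumes "e \<in> upper n"
  shows "noise md n p \<theta> s (fst e) (snd e) =
    (if snd s e then of_bool (fst s e) - 1 / 2 else 0) / p + 1 / 2 - \<theta> (fst e) (snd e)"
  using assms by (cases e) (auto simp: noise_def data_matrix_def entry_def J_def upper_def)

lemma noise_lower:
  assumes "\<theta> \<in> Theta md n" "(i, j) \<in> upper n"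
  shows "noise md n p \<theta> s j i = reflect_sign md * noise md n p \<theta> s i j"
proof -
  have ij: "i \<in> {1..n}" "j \<in> {1..n}" "i \<noteq> j" "(j, i) \<notin> upper n" using assms(2) by (auto simp: upper_def)
  then show ?thesis using Theta_reflect[OF assms(1) ij(1-3)] assms(2)
    by (cases md) (auto simp: noise_def data_matrix_def J_def add_divide_distrib diff_divide_distrib)
qed

lemma noise_diag: "\<theta> \<in> Theta md n \<Longrightarrow> noise md n p \<theta> s i i = 0"
  by (auto simp: noise_def data_matrix_def J_def upper_def Theta_diag)

text \<open>The entries above the diagonal are the independent ones, so each of them collects the
  weights of its two positions.\<close>

lemma sum_noise_eq_upper:
  assumes "\<theta> \<in> Theta md n"
  shows "(\<Sum>i=1..n. \<Sum>j=1..n. noise md n p \<theta> s i j * D i j) =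
    (\<Sum>e\<in>upper n. noise md n p \<theta> s (fst e) (snd e) * (D (fst e) (snd e) + reflect_sign md * D (snd e) (fst e)))"
  using noise_diag[OF assms] noise_lower[OF assms]
  by (subst sum_square_eq_upper) (auto simp: case_prod_unfold algebra_simps intro!: sum.cong)

lemma finite_set_sample_pmf: "finite (set_pmf (sample_pmf n p \<theta>))"
  by (simp add: sample_pmf_def finite_set_Pi_pmf_bool finite_upper)

text \<open>A noise entry is at most \<open>1/p\<close> in absolute value, and the bound on
  \<open>D\<close> keeps the combined weight \<open>c\<close> of a pair at most \<open>p\<close>, so
  the products are at most \<open>1\<close> as \<open>exp_moment_sum_le\<close> requires.\<close>

lemma exp_moment_noise_le:
  assumes \<theta>: "\<theta> \<in> Theta md n" and p: "0 < p" "p \<le> 1"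
    and D: "\<And>i j. i \<in> {1..n} \<Longrightarrow> j \<in> {1..n} \<Longrightarrow> 2 * \<bar>D i j\<bar> \<le> p"
  shows "measure_pmf.expectation (sample_pmf n p \<theta>)
      (\<lambda>s. exp (\<Sum>i=1..n. \<Sum>j=1..n. noise md n p \<theta> s i j * D i j))
    \<le> exp ((\<Sum>i=1..n. \<Sum>j=1..n. (D i j)\<^sup>2) / (2 * p))"
proof -
  define c where "c = (\<lambda>e. D (fst e) (snd e) + reflect_sign md * D (snd e) (fst e))"
  define a where "a = (\<lambda>e. \<theta> (fst e) (snd e))"
  define h where "h = (\<lambda>e z w. ((if w then of_bool z - 1 / 2 else 0) / p + 1 / 2 - a e) * c e)"
  have sq: "e \<in> upper n \<Longrightarrow> fst e \<in> {1..n} \<and> snd e \<in> {1..n}" for e by (auto simp: upper_def)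
  have a01: "0 \<le> a e \<and> a e \<le> 1" if "e \<in> upper n" for e
    using Theta_unit[OF \<theta>] sq[OF that] by (auto simp: a_def unit_matrices_def)
  have c1: "\<bar>c e\<bar> \<le> p" if "e \<in> upper n" for e
    using D[of "fst e" "snd e"] D[of "snd e" "fst e"] sq[OF that] by (cases md) (auto simp: c_def)
  have c2: "(c e)\<^sup>2 \<le> 2 * ((D (fst e) (snd e))\<^sup>2 + (D (snd e) (fst e))\<^sup>2)" for e
  proof -
    have "(x + y)\<^sup>2 \<le> 2 * (x\<^sup>2 + y\<^sup>2)" "(x - y)\<^sup>2 \<le> 2 * (x\<^sup>2 + y\<^sup>2)" for x y :: real
      using zero_le_power2[of "x - y"] zero_le_power2[of "x + y"] by (simp_all add: power2_sum power2_diff)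
    then show ?thesis by (cases md) (simp_all add: c_def)
  qed
  have eq: "(\<Sum>i=1..n. \<Sum>j=1..n. noise md n p \<theta> s i j * D i j) = (\<Sum>e\<in>upper n. h e (fst s e) (snd s e))" for s
    unfolding sum_noise_eq_upper[OF \<theta>] by (intro sum.cong refl) (simp add: noise_upper h_def c_def a_def)
  have sp: "sample_pmf n p \<theta> = pair_pmf (Pi_pmf (upper n) False (\<lambda>e. bernoulli_pmf (a e)))
      (Pi_pmf (upper n) False (\<lambda>_. bernoulli_pmf p))"
    by (simp add: sample_pmf_def a_def case_prod_unfold)
  have "measure_pmf.expectation (sample_pmf n p \<theta>)
      (\<lambda>s. exp (\<Sum>i=1..n. \<Sum>j=1..n. noise md n p \<theta> s i j * D i j)) \<le> exp (\<Sum>e\<in>upper n. (c e)\<^sup>2 / (4 * p))"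
    unfolding eq sp
  proof (rule exp_moment_sum_le)
    fix e z w assume e: "e \<in> upper n"
    have "\<bar>(if w then of_bool z - 1 / 2 else 0) / p\<bar> \<le> (1 / 2) / p"
      using p unfolding abs_divide by (intro frac_le) auto
    moreover have "\<bar>1 / 2 - a e\<bar> \<le> (1 / 2) / p"
    proof -
      have "1 / 2 \<le> (1 / 2) / p" using p by (simp add: field_simps)
      then show ?thesis using a01[OF e] by linarith
    qed
    ultimately have "\<bar>(if w then of_bool z - 1 / 2 else 0) / p + 1 / 2 - a e\<bar> \<le> 1 / p" by linarith
    then have "\<bar>h e z w\<bar> \<le> (1 / p) * p"
      unfolding h_def abs_mult using c1[OF e] p by (intro mult_mono) auto
    then show "\<bar>h e z w\<bar> \<le> 1" using p by simp
  next
    fix e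
    show "p * (a e * h e True True + (1 - a e) * h e False True) +
         (1 - p) * (a e * h e True False + (1 - a e) * h e False False) = 0"
      using p by (simp add: h_def field_simps)
  next
    fix e assume e: "e \<in> upper n"
    \<comment> \<open>The square of an observed centred outcome is always \<open>1/4\<close>, so the
      second moment is \<open>1 / (4 * p)\<close> minus the square of the mean, times the squared
      weight.\<close>
    have "p * (a e * (h e True True)\<^sup>2 + (1 - a e) * (h e False True)\<^sup>2) +
         (1 - p) * (a e * (h e True False)\<^sup>2 + (1 - a e) * (h e False False)\<^sup>2)
       = (c e)\<^sup>2 * (1 / (4 * p) - (1 / 2 - a e)\<^sup>2)"
      using p by (simp add: h_def field_simps power2_eq_square)
    also have "\<dots> \<le> (c e)\<^sup>2 * (1 / (4 * p))" by (intro mult_left_mono) auto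
    finally show "p * (a e * (h e True True)\<^sup>2 + (1 - a e) * (h e False True)\<^sup>2) +
         (1 - p) * (a e * (h e True False)\<^sup>2 + (1 - a e) * (h e False False)\<^sup>2) \<le> (c e)\<^sup>2 / (4 * p)" by simp
  qed (use p a01 finite_upper in auto)
  also have "\<dots> \<le> exp ((\<Sum>i=1..n. \<Sum>j=1..n. (D i j)\<^sup>2) / (2 * p))"
  proof -
    have "(\<Sum>e\<in>upper n. (c e)\<^sup>2 / (4 * p)) \<le>
        (\<Sum>e\<in>upper n. 2 * ((D (fst e) (snd e))\<^sup>2 + (D (snd e) (fst e))\<^sup>2) / (4 * p))"
      using p by (intro sum_mono divide_right_mono c2) auto
    also have "\<dots> = (\<Sum>e\<in>upper n. (D (fst e) (snd e))\<^sup>2 + (D (snd e) (fst e))\<^sup>2) / (2 * p)"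
      unfolding sum_divide_distrib using p by (intro sum.cong refl) (simp add: field_simps)
    also have "(\<Sum>e\<in>upper n. (D (fst e) (snd e))\<^sup>2 + (D (snd e) (fst e))\<^sup>2) \<le> (\<Sum>i=1..n. \<Sum>j=1..n. (D i j)\<^sup>2)"
    proof -
      let ?F = "\<lambda>i j. if i = j then 0 else (D i j)\<^sup>2"
      have "(\<Sum>e\<in>upper n. (D (fst e) (snd e))\<^sup>2 + (D (snd e) (fst e))\<^sup>2) = (\<Sum>(i, j)\<in>upper n. ?F i j + ?F j i)"
        by (intro sum.cong) (auto simp: upper_def)
      also have "\<dots> = (\<Sum>i=1..n. \<Sum>j=1..n. ?F i j)" by (rule sum_square_eq_upper[symmetric]) simp
      also have "\<dots> \<le> (\<Sum>i=1..n. \<Sum>j=1..n. (D i j)\<^sup>2)" by (intro sum_mono) auto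
      finally show ?thesis .
    qed
    finally show ?thesis using p by (simp add: divide_right_mono)
  qed
  finally show ?thesis .
qed

lemma prob_noise_large:
  assumes "\<theta> \<in> Theta md n" "0 < p" "p \<le> 1"
    and "\<And>i j. i \<in> {1..n} \<Longrightarrow> j \<in> {1..n} \<Longrightarrow> 2 * \<bar>D i j\<bar> \<le> p"
  shows "measure_pmf.prob (sample_pmf n p \<theta>)
      {s. (\<Sum>i=1..n. \<Sum>j=1..n. noise md n p \<theta> s i j * D i j) > (\<Sum>i=1..n. \<Sum>j=1..n. (D i j)\<^sup>2) / (2 * p) + v}
    \<le> exp (- v)"
  by (rule prob_le_exp_moment[OF finite_set_sample_pmf exp_moment_noise_le]) (use assms in auto)

section \<open>The ordered classes and the projection\<close>

text \<open>
  The zero diagonal is the only obstruction to monotonicity of a matrix of the class in both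
  indices; the diagonal values chosen here remove it. Reversing the columns in the tournament model then
  makes both models increasing in both indices.
\<close>

definition fill_diag :: "model \<Rightarrow> nat \<Rightarrow> matrix \<Rightarrow> matrix" where
  "fill_diag md n t = (\<lambda>i j. if i = j \<and> i \<in> {1..n}
     then (case md of Tournament \<Rightarrow> 1 / 2 | Graph \<Rightarrow> t i (i - 1)) else t i j)"

definition orient :: "model \<Rightarrow> nat \<Rightarrow> nat \<Rightarrow> nat" where
  "orient md n j = (case md of Tournament \<Rightarrow> n + 1 - j | Graph \<Rightarrow> j)"

lemma tournament_matricesD:
  assumes "t \<in> tournament_matrices n"
  shows "\<And>i j k. i \<in> {1..n} \<Longrightarrow> j \<in> {1..n} \<Longrightarrow> k \<in> {1..n} \<Longrightarrow> i \<noteq> k \<Longrightarrow> i \<noteq> j \<Longrightarrow> k \<le> j \<Longrightarrow> t i j \<le> t i k"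
    "\<And>i j. i \<in> {1..n} \<Longrightarrow> j \<in> {1..n} \<Longrightarrow> i < j \<Longrightarrow> t i j \<le> 1 / 2"
    "\<And>i j. i \<in> {1..n} \<Longrightarrow> j \<in> {1..n} \<Longrightarrow> i < j \<Longrightarrow> 1 / 2 \<le> t j i"
proof -
  fix i j k assume *: "i \<in> {1..n}" "j \<in> {1..n}" "k \<in> {1..n}" "i \<noteq> k" "i \<noteq> j" "k \<le> j"
  show "t i j \<le> t i k"
  proof (cases "k = j")
    case False
    then have "k < j" using * by simp
    then show ?thesis using assms * unfolding tournament_matrices_def by blast
  qed simp
next
  fix i j assume ij: "i \<in> {1..n}" "j \<in> {1..n}" "i < j"
  then show 1: "t i j \<le> 1 / 2" using assms unfolding tournament_matrices_def by blast
  have "i \<noteq> j" using ij by simp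
  then have "t j i = 1 - t i j" using assms ij unfolding tournament_matrices_def by blast
  then show "1 / 2 \<le> t j i" using 1 by simp
qed

lemma graph_matricesD:
  assumes "t \<in> graph_matrices n" "i \<in> {1..n}" "j \<in> {1..n}" "k \<in> {1..n}" "i \<noteq> k" "i \<noteq> j" "j \<le> k"
  shows "t i j \<le> t i k"
proof (cases "k = j")
  case False
  then have "j < k" using assms by simp
  then show ?thesis using assms unfolding graph_matrices_def by blast
qed simp

lemma ordered_class_bounds:
  assumes "t \<in> ordered_class md n"
  shows "0 \<le> t i j" "t i j \<le> 1"
proof -
  have "0 \<le> t i j \<and> t i j \<le> 1"
    using ordered_class_unit[OF assms] unfolding unit_matrices_def
    by (cases "i \<in> {1..n} \<and> j \<in> {1..n}") auto
  then show "0 \<le> t i j" "t i j \<le> 1" by auto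
qed

lemma fill_diag_bounds:
  assumes "t \<in> ordered_class md n"
  shows "0 \<le> fill_diag md n t i j" "fill_diag md n t i j \<le> 1"
  using ordered_class_bounds[OF assms] by (auto simp: fill_diag_def split: model.split)

lemma fill_diag_outside:
  assumes "t \<in> ordered_class md n" "i \<notin> {1..n} \<or> j \<notin> {1..n}"
  shows "fill_diag md n t i j = 0"
proof -
  have "t i j = 0" using ordered_class_unit[OF assms(1)] assms(2) unfolding unit_matrices_def by blast
  then show ?thesis using assms(2) by (auto simp: fill_diag_def)
qed

lemma fill_diag_reflect:
  assumes "t \<in> ordered_class md n" "i \<in> {1..n}" "j \<in> {1..n}"
  shows "fill_diag md n t j i = reflect md (fill_diag md n t i j)"
proof (cases "i = j")
  case True
  then show ?thesis using assms by (cases md) (simp_all add: fill_diag_def)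
next
  case False
  then show ?thesis using ordered_class_reflect[OF assms False] by (simp add: fill_diag_def)
qed

lemma fill_diag_graph_mono:
  assumes t: "t \<in> graph_matrices n" and *: "i \<in> {1..n}" "j \<in> {1..n}" "k \<in> {1..n}" "j \<le> k"
  shows "fill_diag Graph n t i j \<le> fill_diag Graph n t i k"
proof -
  have t': "t \<in> ordered_class Graph n" using t by simp
  consider "j = k" | "j < k" "i \<noteq> j" "i \<noteq> k" | "j < k" "i = j" "i = 1" | "j < k" "i = j" "i > 1" | "j < k" "i = k"
    using * by fastforce
  then show ?thesis
  proof cases
    case 2
    then show ?thesis using graph_matricesD[OF t, of i j k] * by (simp add: fill_diag_def)
  next
    case 3
    \<comment> \<open>In the first row the diagonal is filled from column \<open>0\<close>, which
      lies outside the square.\<close>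
    then have "t i (i - 1) = 0" using ordered_class_unit[OF t'] by (simp add: unit_matrices_def)
    then show ?thesis using 3 * ordered_class_bounds[OF t'] by (simp add: fill_diag_def)
  next
    case 4
    then show ?thesis using graph_matricesD[OF t, of i "i - 1" k] * by (simp add: fill_diag_def)
  next
    case 5
    then show ?thesis using graph_matricesD[OF t, of i j "i - 1"] * by (simp add: fill_diag_def)
  qed simp
qed

text \<open>Along a row the entries are at least \<open>1/2\<close> before the diagonal and at most
  \<open>1/2\<close> after it, so the diagonal value \<open>1/2\<close> fits between them.\<close>

lemma fill_diag_tournament_mono:
  assumes t: "t \<in> tournament_matrices n" and *: "i \<in> {1..n}" "j \<in> {1..n}" "k \<in> {1..n}" "k \<le> j"
  shows "fill_diag Tournament n t i j \<le> fill_diag Tournament n t i k"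
proof -
  consider "j = k" | "k < j" "i \<noteq> j" "i \<noteq> k" | "k < j" "i = j" | "k < j" "i = k"
    using * by fastforce
  then show ?thesis
  proof cases
    case 2
    then show ?thesis using tournament_matricesD(1)[OF t, of i j k] * by (simp add: fill_diag_def)
  next
    case 3
    then show ?thesis using tournament_matricesD(3)[OF t, of k i] * by (simp add: fill_diag_def)
  next
    case 4
    then show ?thesis using tournament_matricesD(2)[OF t, of i j] * by (simp add: fill_diag_def)
  qed simp
qed

text \<open>Obtained from monotonicity along rows by transposition. In the tournament model the map
  \<open>x \<mapsto> 1 - x\<close> turns the decreasing order into an increasing one, so both models
  increase in the first index.\<close>

lemma fill_diag_row_mono:
  assumes t: "t \<in> ordered_class md n" and *: "i \<in> {1..n}" "k \<in> {1..n}" "j \<in> {1..n}" "i \<le> k"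
  shows "fill_diag md n t i j \<le> fill_diag md n t k j"
proof (cases md)
  case Tournament
  then show ?thesis
    using fill_diag_tournament_mono[of t n j k i] fill_diag_reflect[OF t, of j i] fill_diag_reflect[OF t, of j k] t * by simp
next
  case Graph
  then show ?thesis
    using fill_diag_graph_mono[of t n j i k] fill_diag_reflect[OF t, of j i] fill_diag_reflect[OF t, of j k] t * by simp
qed

lemma bij_betw_orient: "bij_betw (orient md n) {1..n} {1..n}"
proof (cases md)
  case Tournament
  then show ?thesis by (intro bij_betwI[where g = "\<lambda>j. n + 1 - j"]) (auto simp: orient_def)
next
  case Graph
  then have "orient md n = id" by (auto simp: orient_def)
  then show ?thesis by simp
qed

lemma monotone_grid_fill_diag:
  assumes t: "t \<in> ordered_class md n" and n: "n \<ge> 1"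
  shows "monotone_grid n (\<lambda>i j. fill_diag md n t i (orient md n j))"
proof
  fix i i' j j' assume *: "i \<le> i'" "j \<le> j'" "i' \<le> n" "j' \<le> n"
  show "fill_diag md n t i (orient md n j) \<le> fill_diag md n t i' (orient md n j')"
  proof (cases "i = 0 \<or> j = 0")
    case True
    then have "fill_diag md n t i (orient md n j) = 0"
      by (intro fill_diag_outside[OF t]) (auto simp: orient_def split: model.split)
    then show ?thesis using fill_diag_bounds[OF t] by simp
  next
    case False
    have o: "orient md n j \<in> {1..n}" "orient md n j' \<in> {1..n}"
      using bij_betw_orient[of md n, THEN bij_betwE] False * by auto
    have "fill_diag md n t i (orient md n j) \<le> fill_diag md n t i (orient md n j')"
    proof (cases md)
      case Tournament
      then show ?thesis using fill_diag_tournament_mono[of t n i "orient md n j" "orient md n j'"] t o * False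
        by (simp add: orient_def)
    next
      case Graph
      then show ?thesis using fill_diag_graph_mono[of t n i "orient md n j" "orient md n j'"] t o * False
        by (simp add: orient_def)
    qed
    also have "\<dots> \<le> fill_diag md n t i' (orient md n j')"
      using fill_diag_row_mono[OF t, of i i'] o * False by simp
    finally show ?thesis .
  qed
next
  show "fill_diag md n t 0 (orient md n j) = 0" for j
    by (rule fill_diag_outside[OF t]) simp
  \<comment> \<open>In the tournament model column \<open>0\<close> is sent to \<open>n + 1\<close>,
    again outside the square.\<close>
  show "fill_diag md n t i (orient md n 0) = 0" for i
    by (rule fill_diag_outside[OF t]) (simp add: orient_def split: model.split)
qed (use n fill_diag_bounds[OF t] in auto)

section \<open>Compactness of the classes and existence of the projection\<close>

lemma frob_power2: "(frob n a)\<^sup>2 = (\<Sum>i=1..n. \<Sum>j=1..n. (a i j)\<^sup>2)"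
  by (simp add: frob_def L2_set_def sum.cartesian_product case_prod_unfold sum_nonneg)

lemma closed_Collect_imp_const: "(P \<Longrightarrow> closed {x. Q x}) \<Longrightarrow> closed {x. P \<longrightarrow> Q x}"
  by (cases P) auto

lemma continuous_on_entry: "continuous_on A (\<lambda>t :: matrix. t i j)"
  by (rule continuous_on_subset[of UNIV])
    (auto intro: continuous_on_product_coordinates
      continuous_on_compose2[OF continuous_on_product_coordinates continuous_on_product_coordinates])

text \<open>By Tychonoff's theorem the functions with values in \<open>[0, 1]\<close> are compact in
  the product topology. The class is cut out of them by equations and weak inequalities between
  entries, which are closed conditions.\<close>

lemma compact_ordered_class: "compact (ordered_class md n)"
proof -
  let ?B = "Pi\<^sub>E UNIV (\<lambda>_ :: nat. Pi\<^sub>E UNIV (\<lambda>_ :: nat. {0..1 :: real}))"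
  have "compact (Pi\<^sub>E UNIV (\<lambda>_ :: nat. {0..1 :: real}))"
    using compactin_PiE[of "\<lambda>_ :: nat. euclideanreal" UNIV "\<lambda>_. {0..1}"]
    by (simp add: euclidean_product_topology)
  then have B: "compact ?B"
    using compactin_PiE[of "\<lambda>_ :: nat. euclidean :: (nat \<Rightarrow> real) topology" UNIV "\<lambda>_. Pi\<^sub>E UNIV (\<lambda>_ :: nat. {0..1 :: real})"]
    by (simp add: euclidean_product_topology)
  have sub: "ordered_class md n \<subseteq> ?B" using ordered_class_bounds by (auto simp: PiE_iff)
  note closed = closed_Collect_conj closed_Collect_all closed_Collect_imp_const closed_Collect_le
    closed_Collect_eq continuous_on_entry continuous_on_const continuous_on_diff
  have U: "closed {t. t \<in> unit_matrices n}"
    unfolding unit_matrices_def Ball_def mem_Collect_eq by (intro closed)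
  have "closed {t. t \<in> ordered_class md n}"
    by (cases md; simp only: ordered_class.simps tournament_matrices_def graph_matrices_def Ball_def mem_Collect_eq;
      intro closed U)
  then have "closed (ordered_class md n)" by simp
  then have "compact (?B \<inter> ordered_class md n)" by (rule compact_Int_closed[OF B])
  then show ?thesis using sub by (simp add: Int_absorb1)
qed

text \<open>A continuous function attains its minimum on the compact class, which contains
  \<open>\<phi>\<close>; hence the choice made by \<open>arg_min_on\<close> is a genuine
  minimizer.\<close>

lemma Proj_minimizes:
  assumes "\<phi> \<in> ordered_class md n"
  shows "Proj md n a \<in> ordered_class md n"
    and "\<And>b. b \<in> ordered_class md n \<Longrightarrow> frob n (\<lambda>i j. a i j - Proj md n a i j) \<le> frob n (\<lambda>i j. a i j - b i j)"
proof -
  let ?f = "\<lambda>b. frob n (\<lambda>i j. a i j - b i j)"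
  have "continuous_on (ordered_class md n) ?f"
    unfolding frob_def L2_set_def case_prod_unfold by (intro continuous_intros continuous_on_entry)
  then obtain x where x: "x \<in> ordered_class md n" "\<And>b. b \<in> ordered_class md n \<Longrightarrow> ?f x \<le> ?f b"
    using continuous_attains_inf[OF compact_ordered_class] assms by blast
  then have "is_arg_min ?f (\<lambda>b. b \<in> ordered_class md n) x" by (force simp: is_arg_min_def not_less)
  then have "is_arg_min ?f (\<lambda>b. b \<in> ordered_class md n) (Proj md n a)"
    unfolding Proj_def arg_min_on_def arg_min_def by (rule someI[of "is_arg_min ?f (\<lambda>b. b \<in> ordered_class md n)"])
  then show "Proj md n a \<in> ordered_class md n"
    "\<And>b. b \<in> ordered_class md n \<Longrightarrow> ?f (Proj md n a) \<le> ?f b"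
    by (auto simp: is_arg_min_def not_less)
qed

lemma sorting_perms_finite: "finite (sorting_perms n y)"
  by (rule finite_subset[OF _ finite_permutations[of "{1..n}"]]) (auto simp: sorting_perms_def)

text \<open>Together with finiteness this makes \<open>pmf_of_set\<close> the uniform law on the
  sorting permutations. The witness reads off a list of indices sorted by row sum; list positions
  start at \<open>0\<close>, hence the shift by one.\<close>

lemma sorting_perms_nonempty: "sorting_perms n y \<noteq> {}"
proof -
  define xs where "xs = sort_key (row_sum n y) [1..<Suc n]"
  have xs: "distinct xs" "set xs = {1..n}" "length xs = n" "sorted (map (row_sum n y) xs)"
    unfolding xs_def by auto
  define \<sigma> where "\<sigma> = (\<lambda>i. if i \<in> {1..n} then xs ! (i - 1) else i)"
  have "bij_betw (\<lambda>i. xs ! i) {..<n} {1..n}" using xs by (intro bij_betw_nth) auto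
  moreover have "bij_betw (\<lambda>i. i - 1) {1..n} {..<n}"
    by (intro bij_betwI[where g = Suc]) auto
  ultimately have "bij_betw ((\<lambda>i. xs ! i) \<circ> (\<lambda>i. i - 1)) {1..n} {1..n}" by (rule bij_betw_trans[rotated])
  then have "bij_betw \<sigma> {1..n} {1..n}"
    by (rule bij_betw_cong[THEN iffD1, rotated]) (simp add: \<sigma>_def)
  then have "\<sigma> permutes {1..n}" by (rule bij_imp_permutes) (auto simp: \<sigma>_def)
  moreover have "mono_on {1..n} (\<lambda>i. row_sum n y (\<sigma> i))"
  proof (rule mono_onI)
    fix r s assume "r \<in> {1..n}" "s \<in> {1..n}" "r \<le> s"
    then show "row_sum n y (\<sigma> r) \<le> row_sum n y (\<sigma> s)"
      using sorted_nth_mono[OF xs(4), of "r - 1" "s - 1"] xs(3) by (auto simp: \<sigma>_def)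
  qed
  ultimately show ?thesis unfolding sorting_perms_def by blast
qed

section \<open>Stability of sorting and Hoelder rows\<close>

text \<open>By counting, \<open>\<rho>\<close> cannot map all of \<open>{i..n}\<close> above
  \<open>i\<close>, so some \<open>k \<ge> i\<close> has \<open>\<rho> k \<le> i\<close>, and
  \<open>x i \<le> x k \<le> v (\<rho> k) + u \<le> v i + u\<close>. The lower bound is symmetric,
  and passing from \<open>x i\<close> to \<open>v (\<rho> i)\<close> costs another
  \<open>u\<close>.\<close>

lemma sorting_stability:
  fixes v x :: "nat \<Rightarrow> real"
  assumes \<rho>: "\<rho> permutes {1..n}" and v: "mono_on {1..n} v" and x: "mono_on {1..n} x"
    and u: "\<And>i. i \<in> {1..n} \<Longrightarrow> \<bar>x i - v (\<rho> i)\<bar> \<le> u" and i: "i \<in> {1..n}"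
  shows "\<bar>v (\<rho> i) - v i\<bar> \<le> 2 * u"
proof -
  have inj: "inj_on \<rho> A" for A using permutes_inj[OF \<rho>] by (rule inj_on_subset) simp
  have im: "\<rho> k \<in> {1..n}" if "k \<in> {1..n}" for k using permutes_in_image[OF \<rho>] that by simp
  have "\<exists>k\<in>{i..n}. \<rho> k \<le> i"
  proof (rule ccontr)
    assume no: "\<not> ?thesis"
    have "\<rho> ` {i..n} \<subseteq> {Suc i..n}"
    proof (intro image_subsetI)
      fix k assume k: "k \<in> {i..n}"
      then have "i < \<rho> k" using no by (simp add: not_le)
      moreover have "\<rho> k \<le> n" using im[of k] k i by simp
      ultimately show "\<rho> k \<in> {Suc i..n}" by simp
    qed
    then have "card (\<rho> ` {i..n}) \<le> card {Suc i..n}" by (intro card_mono) auto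
    then show False using i by (simp add: card_image[OF inj] Suc_diff_le)
  qed
  then obtain k where k: "k \<in> {i..n}" "\<rho> k \<le> i" by blast
  have "x i \<le> x k" using k i by (intro mono_onD[OF x]) auto
  moreover have "v (\<rho> k) \<le> v i" using k i im[of k] by (intro mono_onD[OF v]) auto
  moreover have "x k \<le> v (\<rho> k) + u" using u[of k] k i by auto
  ultimately have up: "x i \<le> v i + u" by linarith
  have "\<exists>k\<in>{1..i}. i \<le> \<rho> k"
  proof (rule ccontr)
    assume no: "\<not> ?thesis"
    have "\<rho> ` {1..i} \<subseteq> {1..<i}"
    proof (intro image_subsetI)
      fix k assume k: "k \<in> {1..i}"
      then have "\<rho> k < i" using no by (simp add: not_le)
      moreover have "1 \<le> \<rho> k" using im[of k] k i by simp
      ultimately show "\<rho> k \<in> {1..<i}" by simp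
    qed
    then have "card (\<rho> ` {1..i}) \<le> card {1..<i}" by (intro card_mono) auto
    then have "i \<le> i - 1" by (simp add: card_image[OF inj])
    then show False using i by (cases i) auto
  qed
  then obtain m where m: "m \<in> {1..i}" "i \<le> \<rho> m" by blast
  have "x m \<le> x i" using m i by (intro mono_onD[OF x]) auto
  moreover have "v i \<le> v (\<rho> m)" using m i im[of m] by (intro mono_onD[OF v]) auto
  moreover have "v (\<rho> m) \<le> x m + u" using u[of m] m i by auto
  ultimately have "v i \<le> x i + u" by linarith
  then show ?thesis using up u[OF i] by linarith
qed

section \<open>From the l1 norm to the sup norm of Hoelder rows\<close>

lemma card_near_ge:
  fixes X :: real
  assumes k0: "k0 \<in> {1..n}" and X: "X \<ge> 0"
  shows "min (real n) X \<le> real (card {k \<in> {1..n}. \<bar>real k - real k0\<bar> \<le> X})"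
proof -
  define q where "q = min (n - 1) (nat \<lfloor>X\<rfloor>)"
  \<comment> \<open>The \<open>q + 1\<close> integers from \<open>a\<close> on form a window inside
    \<open>{1..n}\<close> that contains \<open>k0\<close>: it starts at \<open>k0\<close> if there
    is room and otherwise ends at \<open>n\<close>.\<close>
  define a where "a = (if k0 + q \<le> n then k0 else n - q)"
  have qX: "real q \<le> X"
  proof -
    have "real (nat \<lfloor>X\<rfloor>) \<le> X" using X by simp
    moreover have "real q \<le> real (nat \<lfloor>X\<rfloor>)" unfolding q_def by simp
    ultimately show ?thesis by linarith
  qed
  have qn: "q \<le> n - 1" by (simp add: q_def)
  have "{a..a + q} \<subseteq> {k \<in> {1..n}. \<bar>real k - real k0\<bar> \<le> X}"
  proof
    fix k assume k: "k \<in> {a..a + q}"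
    then have "k \<in> {1..n}" using qn k0 by (auto simp: a_def split: if_splits)
    moreover have "\<bar>real k - real k0\<bar> \<le> real q"
    proof -
      have "k \<le> k0 + q" "k0 \<le> k + q" using k qn k0 by (auto simp: a_def split: if_splits)
      then show ?thesis by linarith
    qed
    ultimately show "k \<in> {k \<in> {1..n}. \<bar>real k - real k0\<bar> \<le> X}" using qX by auto
  qed
  then have "card {a..a + q} \<le> card {k \<in> {1..n}. \<bar>real k - real k0\<bar> \<le> X}" by (intro card_mono) auto
  moreover have "min (real n) X \<le> real (q + 1)"
  proof (cases "n - 1 \<le> nat \<lfloor>X\<rfloor>")
    case True
    then show ?thesis using k0 by (auto simp: q_def)
  next
    case False
    then have "q = nat \<lfloor>X\<rfloor>" by (simp add: q_def)
    then have "X \<le> real q + 1" using X by linarith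
    then show ?thesis by simp
  qed
  ultimately show ?thesis by simp
qed

lemma Hoelder_sup_le:
  fixes f :: "nat \<Rightarrow> real"
  assumes L: "L > 0" and \<alpha>: "\<alpha> > 0" and B: "finite B" "card B \<le> 2"
    and H: "\<And>k k'. k \<in> {1..n} - B \<Longrightarrow> k' \<in> {1..n} - B \<Longrightarrow>
      \<bar>f k - f k'\<bar> \<le> 2 * (L * (\<bar>real k - real k'\<bar> powr \<alpha> / real n powr \<alpha>))"
    and w: "(\<Sum>k=1..n. \<bar>f k\<bar>) \<le> w" and k0: "k0 \<in> {1..n} - B"
  shows "\<bar>f k0\<bar> \<le> max (6 * w / real n) ((6 * w / real n) powr (\<alpha> / (\<alpha> + 1)) * (4 * L) powr (1 / (\<alpha> + 1)))"
proof -
  define M where "M = \<bar>f k0\<bar>"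
  have n: "n \<ge> 1" using k0 by auto
  have w0: "w \<ge> 0" using w by (rule order_trans[rotated]) (simp add: sum_nonneg)
  show ?thesis
  proof (cases "M = 0")
    case True
    then show ?thesis using w0 n by (simp add: M_def le_max_iff_disj)
  next
    case False
    then have M: "M > 0" by (simp add: M_def)
    \<comment> \<open>The radius at which the Hoelder bound
      \<open>2 * L * (X / n) powr \<alpha>\<close> equals \<open>M / 2\<close>.\<close>
    define X where "X = real n * (M / (4 * L)) powr (1 / \<alpha>)"
    define I where "I = {k \<in> {1..n}. \<bar>real k - real k0\<bar> \<le> X}"
    have X0: "X \<ge> 0" by (simp add: X_def)
    have Xa: "X powr \<alpha> / real n powr \<alpha> = M / (4 * L)"
      using n M L \<alpha> by (simp add: X_def powr_mult powr_powr)
    have big: "M / 2 \<le> \<bar>f k\<bar>" if k: "k \<in> I - B" for k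
    proof -
      have "\<bar>f k0 - f k\<bar> \<le> 2 * (L * (\<bar>real k0 - real k\<bar> powr \<alpha> / real n powr \<alpha>))"
        using k k0 by (intro H) (auto simp: I_def)
      also have "\<dots> \<le> 2 * (L * (X powr \<alpha> / real n powr \<alpha>))"
        using k L \<alpha> by (intro mult_left_mono divide_right_mono powr_mono2) (auto simp: I_def abs_minus_commute)
      also have "\<dots> = M / 2" using L by (simp add: Xa)
      finally show ?thesis unfolding M_def by linarith
    qed
    have finI: "finite I" by (simp add: I_def)
    have k0I: "k0 \<in> I - B" using k0 X0 by (simp add: I_def)
    have "card I \<le> card (I - B) + 2"
      using B card_Diff_subset_Int[of I B] finI card_mono[of B "I \<inter> B"] by auto
    moreover have "1 \<le> card (I - B)" using k0I finI by (metis One_nat_def Suc_leI card_gt_0_iff empty_iff finite_Diff)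
    \<comment> \<open>Removing at most two points from a window that keeps \<open>k0\<close> leaves
      at least a third of it; with the \<open>2\<close> from \<open>M / 2\<close> this yields the
      constant \<open>6\<close>.\<close>
    ultimately have "real (card I) \<le> 3 * real (card (I - B))" by linarith
    then have c3: "min (real n) X \<le> 3 * real (card (I - B))"
      using card_near_ge[of k0 n X] k0 X0 unfolding I_def by simp
    have "real (card (I - B)) * (M / 2) = (\<Sum>k\<in>I - B. M / 2)" by simp
    also have "\<dots> \<le> (\<Sum>k\<in>I - B. \<bar>f k\<bar>)" by (intro sum_mono big)
    also have "\<dots> \<le> (\<Sum>k=1..n. \<bar>f k\<bar>)" by (intro sum_mono2) (auto simp: I_def)
    also have "\<dots> \<le> w" by (rule w)
    finally have "real (card (I - B)) * M \<le> 2 * w" by simp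
    moreover have "min (real n) X * M \<le> 3 * real (card (I - B)) * M" using c3 M by (intro mult_right_mono) auto
    ultimately have main: "min (real n) X * M \<le> 6 * w" by linarith
    show ?thesis
    proof (cases "real n \<le> X")
      case True
      then have "M \<le> 6 * w / real n" using main n by (simp add: field_simps)
      then show ?thesis by (simp add: M_def)
    next
      case False
      then have "(M / (4 * L)) powr (1 / \<alpha>) * M \<le> 6 * w / real n"
        using main n by (simp add: X_def field_simps)
      \<comment> \<open>This power makes the total exponent of \<open>M\<close> equal to
        \<open>1\<close>.\<close>
      then have "((M / (4 * L)) powr (1 / \<alpha>) * M) powr (\<alpha> / (\<alpha> + 1)) \<le> (6 * w / real n) powr (\<alpha> / (\<alpha> + 1))"
        using \<alpha> M L by (intro powr_mono2) auto
      moreover have "((M / (4 * L)) powr (1 / \<alpha>) * M) powr (\<alpha> / (\<alpha> + 1)) = M / (4 * L) powr (1 / (\<alpha> + 1))"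
      proof -
        have "((M / (4 * L)) powr (1 / \<alpha>) * M) powr (\<alpha> / (\<alpha> + 1)) =
            (M / (4 * L)) powr (1 / (\<alpha> + 1)) * M powr (\<alpha> / (\<alpha> + 1))"
          using M L \<alpha> by (simp add: powr_mult powr_powr)
        also have "\<dots> = M powr (1 / (\<alpha> + 1) + \<alpha> / (\<alpha> + 1)) / (4 * L) powr (1 / (\<alpha> + 1))"
          using M L by (simp add: powr_divide powr_add)
        also have "1 / (\<alpha> + 1) + \<alpha> / (\<alpha> + 1) = 1" using \<alpha> by (simp add: field_simps)
        finally show ?thesis using M by simp
      qed
      ultimately have "M / (4 * L) powr (1 / (\<alpha> + 1)) \<le> (6 * w / real n) powr (\<alpha> / (\<alpha> + 1))"
        by (simp only:)
      moreover have "(4 * L) powr (1 / (\<alpha> + 1)) > 0" using L by simp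
      ultimately have "M \<le> (6 * w / real n) powr (\<alpha> / (\<alpha> + 1)) * (4 * L) powr (1 / (\<alpha> + 1))"
        by (simp only: pos_divide_le_eq)
      then show ?thesis by (simp add: M_def)
    qed
  qed
qed

text \<open>The permutation of the Hoelder condition is kept separate from the order in which the
  matrix is monotone; the two may differ.\<close>

definition Hoelder_ordering :: "nat \<Rightarrow> real \<Rightarrow> real \<Rightarrow> matrix \<Rightarrow> (nat \<Rightarrow> nat) \<Rightarrow> bool" where
  "Hoelder_ordering n \<alpha> L t \<eta> \<longleftrightarrow> \<eta> permutes {1..n} \<and>
     (\<forall>i\<in>{1..n}. \<forall>j\<in>{1..n}. \<forall>k\<in>{1..n}. i \<noteq> j \<longrightarrow> i \<noteq> k \<longrightarrow>
       \<bar>mat_perm t \<eta> i j - mat_perm t \<eta> i k\<bar> \<le> L * (\<bar>real j - real k\<bar> powr \<alpha> / real n powr \<alpha>))"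

text \<open>Two rows of a monotone matrix are comparable entry by entry, so the l1 norm of their
  difference is the difference of their sums. \<open>Hoelder_sup_le\<close>, applied along
  \<open>\<eta>\<close>, bounds the difference off the columns \<open>x\<close> and
  \<open>y\<close>, where a diagonal entry interferes; these two contribute at most \<open>1\<close>
  each.\<close>

lemma row_difference_le:
  assumes t: "t \<in> ordered_class md n" and L: "L > 0" and \<alpha>: "\<alpha> > 0"
    and \<eta>: "Hoelder_ordering n \<alpha> L t \<eta>"
    and xy: "x \<in> {1..n}" "y \<in> {1..n}"
  defines "F \<equiv> fill_diag md n t"
  assumes w: "\<bar>(\<Sum>c=1..n. F y c) - (\<Sum>c=1..n. F x c)\<bar> \<le> w"
  shows "(\<Sum>c=1..n. (F y c - F x c)\<^sup>2) \<le>
    2 + w * max (6 * w / real n) ((6 * w / real n) powr (\<alpha> / (\<alpha> + 1)) * (4 * L) powr (1 / (\<alpha> + 1)))"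
    (is "_ \<le> 2 + w * ?M")
proof -
  define f where "f = (\<lambda>c. F y c - F x c)"
  have \<eta>p: "\<eta> permutes {1..n}" using \<eta> by (simp add: Hoelder_ordering_def)
  have "(\<Sum>c=1..n. \<bar>f c\<bar>) = \<bar>\<Sum>c=1..n. f c\<bar>"
  proof (cases "x \<le> y")
    case True
    then have "f c \<ge> 0" if "c \<in> {1..n}" for c
      using fill_diag_row_mono[OF t, of x y c] xy that by (simp add: f_def F_def)
    then have "(\<Sum>c=1..n. \<bar>f c\<bar>) = sum f {1..n}" "sum f {1..n} \<ge> 0"
      by (intro sum.cong sum_nonneg; simp)+
    then show ?thesis by simp
  next
    case False
    then have "f c \<le> 0" if "c \<in> {1..n}" for c
      using fill_diag_row_mono[OF t, of y x c] xy that by (simp add: f_def F_def)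
    then have "(\<Sum>c=1..n. \<bar>f c\<bar>) = (\<Sum>c=1..n. - f c)" "sum f {1..n} \<le> 0"
      by (intro sum.cong sum_nonpos; simp)+
    then show ?thesis by (simp add: sum_negf)
  qed
  then have f1: "(\<Sum>c=1..n. \<bar>f c\<bar>) \<le> w" using w by (simp add: f_def sum_subtractf)
  have fb: "\<bar>f c\<bar> \<le> 1" for c
    using fill_diag_bounds[OF t, of y c] fill_diag_bounds[OF t, of x c] by (simp add: f_def F_def)
  have M: "\<bar>f c\<bar> \<le> ?M" if c: "c \<in> {1..n} - {x, y}" for c
  proof -
    have \<eta>in: "\<eta> (inv \<eta> z) = z" "inv \<eta> (\<eta> z) = z" for z using permutes_inverses[OF \<eta>p] by auto
    have iin: "inv \<eta> z \<in> {1..n} \<longleftrightarrow> z \<in> {1..n}" for z using permutes_in_image[OF permutes_inv[OF \<eta>p]] .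
    have "\<bar>f (\<eta> (inv \<eta> c))\<bar> \<le> ?M"
    proof (rule Hoelder_sup_le[where f = "\<lambda>k. f (\<eta> k)" and B = "{inv \<eta> x, inv \<eta> y}", OF L \<alpha>])
      show "card {inv \<eta> x, inv \<eta> y} \<le> 2" by (simp add: card_insert_if)
      have "(\<Sum>k=1..n. \<bar>f (\<eta> k)\<bar>) = (\<Sum>c=1..n. \<bar>f c\<bar>)"
        using sum.permute[OF \<eta>p, of "\<lambda>c. \<bar>f c\<bar>"] by (simp add: o_def)
      then show "(\<Sum>k=1..n. \<bar>f (\<eta> k)\<bar>) \<le> w" using f1 by simp
      show "inv \<eta> c \<in> {1..n} - {inv \<eta> x, inv \<eta> y}" using c iin[of c] \<eta>in(1) by (metis Diff_iff insert_iff singletonD)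
    next
      fix k k' assume k: "k \<in> {1..n} - {inv \<eta> x, inv \<eta> y}" "k' \<in> {1..n} - {inv \<eta> x, inv \<eta> y}"
      let ?h = "L * (\<bar>real k - real k'\<bar> powr \<alpha> / real n powr \<alpha>)"
      have row: "\<bar>F z (\<eta> k) - F z (\<eta> k')\<bar> \<le> ?h" if z: "z \<in> {x, y}" for z
      proof -
        have ne: "inv \<eta> z \<noteq> k" "inv \<eta> z \<noteq> k'" using z k by auto
        have "inv \<eta> z \<in> {1..n}" using z xy iin by auto
        then have "\<bar>t z (\<eta> k) - t z (\<eta> k')\<bar> \<le> ?h"
          using \<eta> k ne unfolding Hoelder_ordering_def mat_perm_def by (metis Diff_iff \<eta>in(1))
        moreover have "z \<noteq> \<eta> k" "z \<noteq> \<eta> k'" using ne \<eta>in(2) by auto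
        ultimately show ?thesis by (simp add: F_def fill_diag_def)
      qed
      show "\<bar>f (\<eta> k) - f (\<eta> k')\<bar> \<le> 2 * ?h"
        using row[of x] row[of y] unfolding f_def by simp
    qed simp
    then show ?thesis by (simp add: \<eta>in)
  qed
  have w0: "w \<ge> 0" using w by linarith
  have M0: "?M \<ge> 0" using w0 by (simp add: le_max_iff_disj)
  have "(\<Sum>c=1..n. (f c)\<^sup>2) \<le> (\<Sum>c=1..n. (if c = x then 1 else 0) + (if c = y then 1 else 0) + ?M * \<bar>f c\<bar>)"
  proof (rule sum_mono)
    fix c assume c: "c \<in> {1..n}"
    have sq: "(f c)\<^sup>2 = \<bar>f c\<bar> * \<bar>f c\<bar>" by (simp add: power2_eq_square)
    show "(f c)\<^sup>2 \<le> (if c = x then 1 else 0) + (if c = y then 1 else 0) + ?M * \<bar>f c\<bar>"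
    proof (cases "c \<in> {x, y}")
      case True
      have "(f c)\<^sup>2 \<le> 1" unfolding sq using fb[of c] by (intro mult_le_one) auto
      moreover have "0 \<le> ?M * \<bar>f c\<bar>" using M0 by (intro mult_nonneg_nonneg) auto
      ultimately show ?thesis using True by auto
    next
      case False
      then have "(f c)\<^sup>2 \<le> ?M * \<bar>f c\<bar>" unfolding sq using M[of c] c by (intro mult_right_mono) auto
      then show ?thesis using False by simp
    qed
  qed
  also have "\<dots> = 2 + ?M * (\<Sum>c=1..n. \<bar>f c\<bar>)"
    using xy by (simp add: sum.distrib sum_distrib_left)
  also have "\<dots> \<le> 2 + ?M * w" using f1 M0 by (intro add_left_mono mult_left_mono) auto
  finally show ?thesis by (simp add: f_def mult.commute)
qed

text \<open>The row index is changed first and the column index afterwards. Reflection turns the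
  second change into another change of rows, so both are sums of the row bound.\<close>

lemma permutation_error_le:
  assumes t: "t \<in> ordered_class md n" and L: "L > 0" and \<alpha>: "\<alpha> > 0"
    and \<eta>: "Hoelder_ordering n \<alpha> L t \<eta>" and \<rho>: "\<rho> permutes {1..n}"
    and w: "\<And>i. i \<in> {1..n} \<Longrightarrow>
      \<bar>(\<Sum>c=1..n. fill_diag md n t (\<rho> i) c) - (\<Sum>c=1..n. fill_diag md n t i c)\<bar> \<le> w"
  shows "(\<Sum>i=1..n. \<Sum>j=1..n. (t (\<rho> i) (\<rho> j) - t i j)\<^sup>2) \<le> 4 * real n *
    (2 + w * max (6 * w / real n) ((6 * w / real n) powr (\<alpha> / (\<alpha> + 1)) * (4 * L) powr (1 / (\<alpha> + 1))))"
    (is "_ \<le> 4 * real n * ?M")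
proof -
  let ?F = "fill_diag md n t"
  have im: "\<rho> k \<in> {1..n}" if "k \<in> {1..n}" for k using permutes_in_image[OF \<rho>] that by simp
  have row: "(\<Sum>c=1..n. (?F (\<rho> i) c - ?F i c)\<^sup>2) \<le> ?M" if "i \<in> {1..n}" for i
    by (rule row_difference_le[OF t L \<alpha> \<eta> that im[OF that] w[OF that]])
  have "(\<Sum>i=1..n. \<Sum>j=1..n. (t (\<rho> i) (\<rho> j) - t i j)\<^sup>2) \<le>
     (\<Sum>i=1..n. \<Sum>j=1..n. 2 * (?F (\<rho> i) (\<rho> j) - ?F i (\<rho> j))\<^sup>2 + 2 * (?F i (\<rho> j) - ?F i j)\<^sup>2)"
  proof (intro sum_mono)
    fix i j assume ij: "i \<in> {1..n}" "j \<in> {1..n}"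
    have "(t (\<rho> i) (\<rho> j) - t i j)\<^sup>2 \<le> (?F (\<rho> i) (\<rho> j) - ?F i j)\<^sup>2"
    proof (cases "i = j")
      case False
      then have "\<rho> i \<noteq> \<rho> j" using \<rho> by (metis permutes_inv_eq)
      then show ?thesis using False by (simp add: fill_diag_def)
    qed (simp add: ordered_class_diag[OF t])
    also have "\<dots> = ((?F (\<rho> i) (\<rho> j) - ?F i (\<rho> j)) + (?F i (\<rho> j) - ?F i j))\<^sup>2" by simp
    also have "\<dots> \<le> 2 * (?F (\<rho> i) (\<rho> j) - ?F i (\<rho> j))\<^sup>2 + 2 * (?F i (\<rho> j) - ?F i j)\<^sup>2"
    proof -
      have "(a + b)\<^sup>2 \<le> 2 * a\<^sup>2 + 2 * b\<^sup>2" for a b :: real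
        using zero_le_power2[of "a - b"] by (simp add: power2_sum power2_diff)
      then show ?thesis .
    qed
    finally show "(t (\<rho> i) (\<rho> j) - t i j)\<^sup>2 \<le>
      2 * (?F (\<rho> i) (\<rho> j) - ?F i (\<rho> j))\<^sup>2 + 2 * (?F i (\<rho> j) - ?F i j)\<^sup>2" .
  qed
  also have "\<dots> = 2 * (\<Sum>i=1..n. \<Sum>j=1..n. (?F (\<rho> i) (\<rho> j) - ?F i (\<rho> j))\<^sup>2) +
      2 * (\<Sum>i=1..n. \<Sum>j=1..n. (?F i (\<rho> j) - ?F i j)\<^sup>2)"
    by (simp add: sum.distrib sum_distrib_left)
  also have "(\<Sum>i=1..n. \<Sum>j=1..n. (?F (\<rho> i) (\<rho> j) - ?F i (\<rho> j))\<^sup>2) = (\<Sum>i=1..n. \<Sum>c=1..n. (?F (\<rho> i) c - ?F i c)\<^sup>2)"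
    using sum.permute[OF \<rho>, of "\<lambda>c. (?F (\<rho> i) c - ?F i c)\<^sup>2" for i] by (simp add: o_def)
  also have "(\<Sum>i=1..n. \<Sum>j=1..n. (?F i (\<rho> j) - ?F i j)\<^sup>2) = (\<Sum>j=1..n. \<Sum>i=1..n. (?F (\<rho> j) i - ?F j i)\<^sup>2)"
  proof (subst sum.swap, intro sum.cong refl)
    fix i j assume ij: "i \<in> {1..n}" "j \<in> {1..n}"
    have "(reflect md a - reflect md b)\<^sup>2 = (a - b)\<^sup>2" for a b
      by (cases md) (simp_all add: power2_commute)
    then show "(?F j (\<rho> i) - ?F j i)\<^sup>2 = (?F (\<rho> i) j - ?F i j)\<^sup>2"
      using fill_diag_reflect[OF t, of "\<rho> i" j] fill_diag_reflect[OF t, of i j] ij im by simp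
  qed
  also have "2 * (\<Sum>i=1..n. \<Sum>c=1..n. (?F (\<rho> i) c - ?F i c)\<^sup>2) + 2 * (\<Sum>i=1..n. \<Sum>c=1..n. (?F (\<rho> i) c - ?F i c)\<^sup>2)
     = 4 * (\<Sum>i=1..n. \<Sum>c=1..n. (?F (\<rho> i) c - ?F i c)\<^sup>2)" by simp
  also have "\<dots> \<le> 4 * (\<Sum>i=1..n. ?M)" by (intro mult_left_mono sum_mono row) auto
  finally show ?thesis by simp
qed

text \<open>Here \<open>r\<close> stands for \<open>log n / (n p)\<close>. The exponents
  \<open>\<alpha> / (\<alpha> + 1)\<close> and \<open>1 / (\<alpha> + 1)\<close> are at most
  \<open>1\<close>, so the powers of \<open>72 = 6 * 12\<close> and of \<open>4\<close> are bounded
  by \<open>72\<close> and \<open>4\<close>, uniformly in \<open>\<alpha>\<close>; then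
  \<open>864 = 12 * 72\<close> and \<open>3456 = 12 * 72 * 4\<close>.\<close>

lemma Hoelder_rate_le:
  fixes r w L \<alpha> :: real
  assumes L: "L > 0" and \<alpha>: "\<alpha> > 0" and r: "r > 0" and n: "n \<ge> 1" and w: "0 \<le> w" "w \<le> 12 * real n * sqrt r"
  shows "w * max (6 * w / real n) ((6 * w / real n) powr (\<alpha> / (\<alpha> + 1)) * (4 * L) powr (1 / (\<alpha> + 1)))
    \<le> real n * (864 * r + 3456 * (L powr (1 / (\<alpha> + 1)) * r powr ((2 * \<alpha> + 1) / (2 * \<alpha> + 2))))"
proof -
  let ?s = "sqrt r"
  have W: "0 \<le> 6 * w / real n" "6 * w / real n \<le> 72 * ?s" using w n by (auto simp: field_simps)
  have e: "0 \<le> \<alpha> / (\<alpha> + 1)" "\<alpha> / (\<alpha> + 1) \<le> 1" "0 \<le> 1 / (\<alpha> + 1)" "1 / (\<alpha> + 1) \<le> 1" using \<alpha> by auto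
  have "w * (6 * w / real n) \<le> (12 * real n * ?s) * (72 * ?s)" using W w r n by (intro mult_mono) auto
  also have "\<dots> = real n * (864 * r)" using r by simp
  finally have 1: "w * (6 * w / real n) \<le> real n * (864 * r)" .
  have "(6 * w / real n) powr (\<alpha> / (\<alpha> + 1)) \<le> (72 * ?s) powr (\<alpha> / (\<alpha> + 1))" using W e by (intro powr_mono2) auto
  also have "\<dots> = 72 powr (\<alpha> / (\<alpha> + 1)) * ?s powr (\<alpha> / (\<alpha> + 1))" using r by (simp add: powr_mult)
  also have "\<dots> \<le> 72 * ?s powr (\<alpha> / (\<alpha> + 1))"
    using powr_mono[of "\<alpha> / (\<alpha> + 1)" 1 "72 :: real"] e by (intro mult_right_mono) auto
  finally have a: "(6 * w / real n) powr (\<alpha> / (\<alpha> + 1)) \<le> 72 * ?s powr (\<alpha> / (\<alpha> + 1))" .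
  have "(4 * L) powr (1 / (\<alpha> + 1)) = 4 powr (1 / (\<alpha> + 1)) * L powr (1 / (\<alpha> + 1))" using L by (simp add: powr_mult)
  also have "\<dots> \<le> 4 * L powr (1 / (\<alpha> + 1))"
    using powr_mono[of "1 / (\<alpha> + 1)" 1 "4 :: real"] e by (intro mult_right_mono) auto
  finally have b: "(4 * L) powr (1 / (\<alpha> + 1)) \<le> 4 * L powr (1 / (\<alpha> + 1))" .
  have "w * ((6 * w / real n) powr (\<alpha> / (\<alpha> + 1)) * (4 * L) powr (1 / (\<alpha> + 1))) \<le>
      (12 * real n * ?s) * ((72 * ?s powr (\<alpha> / (\<alpha> + 1))) * (4 * L powr (1 / (\<alpha> + 1))))"
    using a b w by (intro mult_mono) auto
  also have "\<dots> = real n * (3456 * (L powr (1 / (\<alpha> + 1)) * (?s powr 1 * ?s powr (\<alpha> / (\<alpha> + 1)))))" using r by simp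
  also have "?s powr 1 * ?s powr (\<alpha> / (\<alpha> + 1)) = r powr (1 / 2 * (1 + \<alpha> / (\<alpha> + 1)))"
    using r by (simp add: powr_half_sqrt[symmetric] powr_powr powr_add[symmetric] algebra_simps)
  also have "1 / 2 * (1 + \<alpha> / (\<alpha> + 1)) = (2 * \<alpha> + 1) / (2 * \<alpha> + 2)" using \<alpha> by (simp add: field_simps)
  finally have 2: "w * ((6 * w / real n) powr (\<alpha> / (\<alpha> + 1)) * (4 * L) powr (1 / (\<alpha> + 1))) \<le>
      real n * (3456 * (L powr (1 / (\<alpha> + 1)) * r powr ((2 * \<alpha> + 1) / (2 * \<alpha> + 2))))" .
  have n1: "0 \<le> real n * (864 * r)" "0 \<le> real n * (3456 * (L powr (1 / (\<alpha> + 1)) * r powr ((2 * \<alpha> + 1) / (2 * \<alpha> + 2))))"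
    using r by auto
  have "max (6 * w / real n) ((6 * w / real n) powr (\<alpha> / (\<alpha> + 1)) * (4 * L) powr (1 / (\<alpha> + 1))) \<in>
      {6 * w / real n, (6 * w / real n) powr (\<alpha> / (\<alpha> + 1)) * (4 * L) powr (1 / (\<alpha> + 1))}"
    by (simp add: max_def)
  then show ?thesis
    unfolding distrib_left[of "real n"] using 1 2 n1 by (elim insertE emptyE) linarith+
qed

section \<open>Tail bounds\<close>

lemma sum_permute_square:
  fixes F :: matrix
  assumes "\<sigma> permutes {1..n}"
  shows "(\<Sum>i=1..n. \<Sum>j=1..n. F (\<sigma> i) (\<sigma> j)) = (\<Sum>i=1..n. \<Sum>j=1..n. F i j)"
  using sum.permute[OF assms, of "\<lambda>i. \<Sum>j=1..n. F i j"] sum.permute[OF assms, of "F i" for i]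
  by (simp add: o_def)

lemma card_upper: "real (card (upper n)) = real n * (real n - 1) / 2"
proof -
  have "(\<Sum>i=1..n. \<Sum>j=1..n. if i = j then 0 else 1 :: real) = (\<Sum>(i, j)\<in>upper n. (if i = j then 0 else 1) + (if j = i then 0 else 1))"
    by (rule sum_square_eq_upper) simp
  also have "\<dots> = (\<Sum>(i, j)\<in>upper n. 2)" by (intro sum.cong) (auto simp: upper_def)
  also have "\<dots> = 2 * real (card (upper n))" by (simp add: case_prod_unfold)
  also have "(\<Sum>i=1..n. \<Sum>j=1..n. if i = j then 0 else 1 :: real) = (\<Sum>i=1..n. \<Sum>j=1..n. 1 - (if i = j then 1 else 0 :: real))"
    by (intro sum.cong) auto
  also have "\<dots> = (\<Sum>i=1..n. real n - 1)"
    by (intro sum.cong refl) (simp add: sum_subtractf)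
  also have "\<dots> = real n * (real n - 1)" by simp
  finally show ?thesis by simp
qed

lemma real_choose_two: "real (n choose 2) = real n * (real n - 1) / 2"
proof (cases n)
  case (Suc m)
  have "even (n * (n - 1))" by (simp add: Suc)
  then have "real (n choose 2) = real (n * (n - 1)) / 2" by (simp add: choose_two real_of_nat_div)
  then show ?thesis by (simp add: Suc algebra_simps)
qed simp

text \<open>From \<open>n = 33\<close> on there are at least \<open>16 * n\<close> pairs above the
  diagonal, which the concentration of \<open>p_hat\<close> uses. Smaller \<open>n\<close> are
  covered by the trivial risk bound.\<close>

locale observation_model =
  fixes md :: model and n :: nat and p :: real and \<theta> :: matrix
  assumes \<theta>: "\<theta> \<in> Theta md n" and n: "n \<ge> 33" and p: "0 \<le> p" "p \<le> 1" and p_ge: "p \<ge> 2 * ln (real n) / real n"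
begin

text \<open>The scale of the deviations: row sums of the noise are of order \<open>n * R\<close>,
  and the relative error of \<open>p_hat\<close> is of order \<open>R\<close>.\<close>

definition R :: real where "R = sqrt (ln (real n) / (real n * p))"

abbreviation "Z \<equiv> noise md n p \<theta>"

lemma ln_ge_1: "ln (real n) \<ge> 1"
proof -
  have "exp 1 \<le> real n" using exp_le n by linarith
  then show ?thesis using n by (simp add: ln_ge_iff)
qed

lemma p_pos: "p > 0"
proof -
  have "2 * ln (real n) / real n > 0" using ln_ge_1 n by simp
  then show ?thesis using p_ge by linarith
qed

lemma R2: "R\<^sup>2 = ln (real n) / (real n * p)"
  using ln_ge_1 p_pos n by (simp add: R_def)

lemma ln_eq: "ln (real n) = real n * p * R\<^sup>2"
  using R2 p_pos n by simp

lemma R_pos: "R > 0"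
  using ln_ge_1 p_pos n by (simp add: R_def)

lemma R2_le: "R\<^sup>2 \<le> 1 / 2"
  unfolding R2 using p_ge p_pos n by (simp add: field_simps)

lemma R_le: "R \<le> 3 / 4"
proof -
  have "R\<^sup>2 \<le> (3 / 4)\<^sup>2" using R2_le by (simp add: power2_eq_square)
  then show ?thesis by (rule power2_le_imp_le) simp
qed

text \<open>
  The exponent \<open>p/16\<close> is fixed instead of optimized, which leaves the quadratic term \<open>D\<^sup>2/32\<close>; this
  is small enough to be absorbed into the left-hand side of the basic inequality.
\<close>

lemma prob_noise_net:
  assumes Ds: "finite Ds" and D: "\<And>D i j. D \<in> Ds \<Longrightarrow> i \<in> {1..n} \<Longrightarrow> j \<in> {1..n} \<Longrightarrow> \<bar>D i j\<bar> \<le> 3"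
  shows "measure_pmf.prob (sample_pmf n p \<theta>) {s. \<exists>\<sigma>. \<sigma> permutes {1..n} \<and> (\<exists>D\<in>Ds.
      (\<Sum>i=1..n. \<Sum>j=1..n. Z s (\<sigma> i) (\<sigma> j) * D i j) > (\<Sum>i=1..n. \<Sum>j=1..n. (D i j)\<^sup>2) / 32 + 16 * H / p)}
    \<le> fact n * real (card Ds) * exp (- H)"
proof -
  let ?P = "{\<sigma>. \<sigma> permutes {1..n}}"
  let ?A = "\<lambda>(\<sigma>, D). {s. (\<Sum>i=1..n. \<Sum>j=1..n. Z s (\<sigma> i) (\<sigma> j) * D i j) > (\<Sum>i=1..n. \<Sum>j=1..n. (D i j)\<^sup>2) / 32 + 16 * H / p}"
  have fin: "finite (?P \<times> Ds)" using Ds finite_permutations[of "{1..n}"] by simp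
  have one: "measure_pmf.prob (sample_pmf n p \<theta>) (?A (\<sigma>, D)) \<le> exp (- H)"
    if \<sigma>: "\<sigma> permutes {1..n}" and DD: "D \<in> Ds" for \<sigma> D
  proof -
    \<comment> \<open>The permutation is moved from the noise to the weights. The factor
      \<open>p / 16\<close> and \<open>\<bar>D i j\<bar> \<le> 3\<close> give
      \<open>2 * \<bar>E i j\<bar> \<le> 3 / 8 * p\<close>.\<close>
    define E where "E = (\<lambda>i j. p / 16 * D (inv \<sigma> i) (inv \<sigma> j))"
    have E\<sigma>: "E (\<sigma> i) (\<sigma> j) = p / 16 * D i j" for i j
      using permutes_inverses[OF \<sigma>] by (simp add: E_def)
    have "(\<Sum>i=1..n. \<Sum>j=1..n. Z s i j * E i j) = (\<Sum>i=1..n. \<Sum>j=1..n. Z s (\<sigma> i) (\<sigma> j) * E (\<sigma> i) (\<sigma> j))" for s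
      using sum_permute_square[OF \<sigma>, of "\<lambda>i j. Z s i j * E i j"] by simp
    then have 1: "(\<Sum>i=1..n. \<Sum>j=1..n. Z s i j * E i j) = p / 16 * (\<Sum>i=1..n. \<Sum>j=1..n. Z s (\<sigma> i) (\<sigma> j) * D i j)" for s
      by (simp add: E\<sigma> sum_distrib_left mult_ac)
    have 2: "(\<Sum>i=1..n. \<Sum>j=1..n. (E i j)\<^sup>2) = (p / 16)\<^sup>2 * (\<Sum>i=1..n. \<Sum>j=1..n. (D i j)\<^sup>2)"
    proof -
      have "(\<Sum>i=1..n. \<Sum>j=1..n. (E i j)\<^sup>2) = (\<Sum>i=1..n. \<Sum>j=1..n. (E (\<sigma> i) (\<sigma> j))\<^sup>2)"
        by (rule sum_permute_square[OF \<sigma>, symmetric])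
      then show ?thesis by (simp only: E\<sigma> sum_distrib_left power_mult_distrib)
    qed
    have scale: "(p / 16)\<^sup>2 * a / (2 * p) + H = p / 16 * (a / 32 + 16 * H / p)" for a
      using p_pos by (simp add: field_simps power2_eq_square)
    have "?A (\<sigma>, D) \<subseteq> {s. (\<Sum>i=1..n. \<Sum>j=1..n. Z s i j * E i j) > (\<Sum>i=1..n. \<Sum>j=1..n. (E i j)\<^sup>2) / (2 * p) + H}"
    proof
      fix s assume "s \<in> ?A (\<sigma>, D)"
      then have "p / 16 * ((\<Sum>i=1..n. \<Sum>j=1..n. (D i j)\<^sup>2) / 32 + 16 * H / p)
          < p / 16 * (\<Sum>i=1..n. \<Sum>j=1..n. Z s (\<sigma> i) (\<sigma> j) * D i j)"
        using p_pos by (intro mult_strict_left_mono) auto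
      then show "s \<in> {s. (\<Sum>i=1..n. \<Sum>j=1..n. Z s i j * E i j) > (\<Sum>i=1..n. \<Sum>j=1..n. (E i j)\<^sup>2) / (2 * p) + H}"
        unfolding mem_Collect_eq 1 2 scale .
    qed
    then have "measure_pmf.prob (sample_pmf n p \<theta>) (?A (\<sigma>, D)) \<le> measure_pmf.prob (sample_pmf n p \<theta>)
        {s. (\<Sum>i=1..n. \<Sum>j=1..n. Z s i j * E i j) > (\<Sum>i=1..n. \<Sum>j=1..n. (E i j)\<^sup>2) / (2 * p) + H}"
      by (intro measure_pmf.finite_measure_mono) auto
    also have "\<dots> \<le> exp (- H)"
    proof (rule prob_noise_large[OF \<theta> p_pos p(2)])
      fix i j assume "i \<in> {1..n}" "j \<in> {1..n}"
      then have "inv \<sigma> i \<in> {1..n}" "inv \<sigma> j \<in> {1..n}" using permutes_in_image[OF permutes_inv[OF \<sigma>]] by auto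
      then have "\<bar>D (inv \<sigma> i) (inv \<sigma> j)\<bar> \<le> 3" by (rule D[OF DD])
      then have "p / 16 * \<bar>D (inv \<sigma> i) (inv \<sigma> j)\<bar> \<le> p / 16 * 3" using p_pos by (intro mult_left_mono) auto
      then show "2 * \<bar>E i j\<bar> \<le> p" using p_pos by (simp add: E_def abs_mult)
    qed
    finally show ?thesis .
  qed
  have "measure_pmf.prob (sample_pmf n p \<theta>) {s. \<exists>\<sigma>. \<sigma> permutes {1..n} \<and> (\<exists>D\<in>Ds.
      (\<Sum>i=1..n. \<Sum>j=1..n. Z s (\<sigma> i) (\<sigma> j) * D i j) > (\<Sum>i=1..n. \<Sum>j=1..n. (D i j)\<^sup>2) / 32 + 16 * H / p)}
      = measure_pmf.prob (sample_pmf n p \<theta>) (\<Union>x\<in>?P \<times> Ds. ?A x)"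
    by (intro arg_cong[where f = "measure_pmf.prob (sample_pmf n p \<theta>)"]) auto
  also have "\<dots> \<le> (\<Sum>x\<in>?P \<times> Ds. measure_pmf.prob (sample_pmf n p \<theta>) (?A x))"
    using fin by (intro measure_UNION_le) auto
  also have "\<dots> \<le> (\<Sum>x\<in>?P \<times> Ds. exp (- H))"
    using one by (intro sum_mono) auto
  also have "\<dots> = fact n * real (card Ds) * exp (- H)"
    using card_permutations[of "{1..n}" n] by (simp add: card_cartesian_product)
  finally show ?thesis .
qed

text \<open>The weights are \<open>p * R / 2\<close> on one row, with either sign. Allowing
  probability \<open>1 / n\<^sup>2\<close> for each of the \<open>2 * n\<close> events leaves
  \<open>2 / n\<close> in total.\<close>

lemma prob_row_noise:
  "measure_pmf.prob (sample_pmf n p \<theta>) {s. \<exists>i\<in>{1..n}. \<bar>\<Sum>j=1..n. Z s i j\<bar> > 5 * real n * R} \<le> 2 / real n"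
proof -
  let ?A = "\<lambda>(i, e). {s. e * (\<Sum>j=1..n. Z s i j) > 5 * real n * R}"
  have one: "measure_pmf.prob (sample_pmf n p \<theta>) (?A (i, e)) \<le> 1 / (real n)\<^sup>2"
    if i: "i \<in> {1..n}" and e: "e \<in> {-1, 1 :: real}" for i e
  proof -
    define D where "D = (\<lambda>k (j :: nat). if k = i then e * (p * R / 2) else 0)"
    have 1: "(\<Sum>k=1..n. \<Sum>j=1..n. Z s k j * D k j) = p * R / 2 * (e * (\<Sum>j=1..n. Z s i j))" for s
    proof -
      have "(\<Sum>k=1..n. \<Sum>j=1..n. Z s k j * D k j) = (\<Sum>k=1..n. if k = i then (\<Sum>j=1..n. Z s i j) * (e * (p * R / 2)) else 0)"
        by (intro sum.cong refl) (simp add: D_def sum_distrib_right)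
      then show ?thesis using i by (simp add: mult_ac)
    qed
    have 2: "(\<Sum>k=1..n. \<Sum>j=1..n. (D k j)\<^sup>2) = real n * (p * R / 2)\<^sup>2"
    proof -
      have "(\<Sum>k=1..n. \<Sum>j=1..n. (D k j)\<^sup>2) = (\<Sum>k=1..n. if k = i then real n * (p * R / 2)\<^sup>2 else 0)"
        using e by (intro sum.cong refl) (auto simp: D_def)
      then show ?thesis using i by simp
    qed
    have "?A (i, e) \<subseteq> {s. (\<Sum>k=1..n. \<Sum>j=1..n. Z s k j * D k j) > (\<Sum>k=1..n. \<Sum>j=1..n. (D k j)\<^sup>2) / (2 * p) + 2 * ln (real n)}"
    proof
      fix s assume "s \<in> ?A (i, e)"
      then have "p * R / 2 * (5 * real n * R) < p * R / 2 * (e * (\<Sum>j=1..n. Z s i j))"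
        using p_pos R_pos by (intro mult_strict_left_mono) auto
      \<comment> \<open>The quadratic term is \<open>ln n / 8\<close>; with \<open>2 * ln n\<close>
        it stays below \<open>5/2 * (n * p * R\<^sup>2)\<close>, the exponent reached at the
        threshold \<open>5 * n * R\<close>.\<close>
      moreover have "real n * (p * R / 2)\<^sup>2 / (2 * p) + 2 * ln (real n) = 17 / 8 * (real n * p * R\<^sup>2)"
        unfolding ln_eq using p_pos by (simp add: field_simps power2_eq_square)
      moreover have "17 / 8 * (real n * p * R\<^sup>2) \<le> p * R / 2 * (5 * real n * R)"
        using p_pos R_pos by (simp add: power2_eq_square)
      ultimately show "s \<in> {s. (\<Sum>k=1..n. \<Sum>j=1..n. Z s k j * D k j) > (\<Sum>k=1..n. \<Sum>j=1..n. (D k j)\<^sup>2) / (2 * p) + 2 * ln (real n)}"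
        unfolding mem_Collect_eq 1 2 by linarith
    qed
    then have "measure_pmf.prob (sample_pmf n p \<theta>) (?A (i, e)) \<le> measure_pmf.prob (sample_pmf n p \<theta>)
        {s. (\<Sum>k=1..n. \<Sum>j=1..n. Z s k j * D k j) > (\<Sum>k=1..n. \<Sum>j=1..n. (D k j)\<^sup>2) / (2 * p) + 2 * ln (real n)}"
      by (intro measure_pmf.finite_measure_mono) auto
    also have "\<dots> \<le> exp (- (2 * ln (real n)))"
    proof (rule prob_noise_large[OF \<theta> p_pos p(2)])
      fix k j
      have "p * R \<le> p * 1" using p_pos R_le by (intro mult_left_mono) auto
      then show "2 * \<bar>D k j\<bar> \<le> p" using p_pos R_pos e by (auto simp: D_def abs_mult)
    qed
    also have "\<dots> = 1 / (real n)\<^sup>2"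
    proof -
      have "exp (ln (real n)) = real n" using n by simp
      then show ?thesis unfolding exp_minus mult_2 exp_add by (simp only: power2_eq_square inverse_eq_divide)
    qed
    finally show ?thesis .
  qed
  have "measure_pmf.prob (sample_pmf n p \<theta>) {s. \<exists>i\<in>{1..n}. \<bar>\<Sum>j=1..n. Z s i j\<bar> > 5 * real n * R}
      \<le> measure_pmf.prob (sample_pmf n p \<theta>) (\<Union>x\<in>{1..n} \<times> {-1, 1}. ?A x)"
  proof (intro measure_pmf.finite_measure_mono subsetI)
    fix s assume "s \<in> {s. \<exists>i\<in>{1..n}. \<bar>\<Sum>j=1..n. Z s i j\<bar> > 5 * real n * R}"
    then obtain i where i: "i \<in> {1..n}" "\<bar>\<Sum>j=1..n. Z s i j\<bar> > 5 * real n * R" by blast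
    from i(2) have "1 * (\<Sum>j=1..n. Z s i j) > 5 * real n * R \<or> - 1 * (\<Sum>j=1..n. Z s i j) > 5 * real n * R"
      by linarith
    then have "s \<in> ?A (i, 1) \<or> s \<in> ?A (i, -1)" by (simp only: prod.case mem_Collect_eq)
    then show "s \<in> (\<Union>x\<in>{1..n} \<times> {-1, 1}. ?A x)" using i(1) by blast
  qed simp
  also have "\<dots> \<le> (\<Sum>x\<in>{1..n} \<times> {-1, 1}. measure_pmf.prob (sample_pmf n p \<theta>) (?A x))"
    by (intro measure_UNION_le) auto
  also have "\<dots> \<le> (\<Sum>x\<in>{1..n} \<times> {-1, 1 :: real}. 1 / (real n)\<^sup>2)"
  proof (rule sum_mono)
    fix x assume "x \<in> {1..n} \<times> {-1, 1 :: real}"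
    then obtain i e where x: "x = (i, e)" "i \<in> {1..n}" "e \<in> {-1, 1}" by blast
    show "measure_pmf.prob (sample_pmf n p \<theta>) (?A x) \<le> 1 / (real n)\<^sup>2"
      unfolding x(1) using x(2,3) by (rule one)
  qed
  also have "\<dots> = 2 / real n"
    using n by (simp add: card_cartesian_product power2_eq_square)
  finally show ?thesis .
qed

text \<open>The same method with weight \<open>R / 2\<close> on every pair, applied to summands that
  depend on the observation indicator alone.\<close>

lemma prob_p_hat:
  "measure_pmf.prob (sample_pmf n p \<theta>) {s. \<bar>p_hat n s - p\<bar> > 5 / 8 * p * R} \<le> 2 / real n"
proof -
  let ?W = "\<lambda>s :: sample. \<Sum>e\<in>upper n. of_bool (snd s e) - p"
  let ?N = "real (card (upper n))"
  let ?A = "\<lambda>e. {s. R / 2 * (e * ?W s) > ?N * (R\<^sup>2 / 4 * p) + ln (real n)}"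
  have N: "?N > 0" unfolding card_upper using n by simp
  have ph: "?N * (p_hat n s - p) = ?W s" for s
  proof -
    have c2: "real (n choose 2) = ?N" by (simp only: real_choose_two card_upper)
    have "?W s = real (card {e \<in> upper n. snd s e}) - ?N * p"
      by (simp add: sum_subtractf finite_upper of_bool_def flip: sum.inter_filter)
    then show ?thesis unfolding p_hat_def c2 using N by (simp add: right_diff_distrib)
  qed
  have one: "measure_pmf.prob (sample_pmf n p \<theta>) (?A e) \<le> 1 / real n" if e: "e \<in> {-1, 1 :: real}" for e
  proof -
    define h where "h = (\<lambda>(_ :: nat \<times> nat) (_ :: bool) w. R / 2 * e * (of_bool w - p))"
    define a where "a = (\<lambda>e. \<theta> (fst e) (snd e))"
    have sp: "sample_pmf n p \<theta> = pair_pmf (Pi_pmf (upper n) False (\<lambda>e. bernoulli_pmf (a e)))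
        (Pi_pmf (upper n) False (\<lambda>_. bernoulli_pmf p))"
      by (simp add: sample_pmf_def a_def case_prod_unfold)
    have a01: "0 \<le> a e \<and> a e \<le> 1" if "e \<in> upper n" for e
      using Theta_unit[OF \<theta>] that by (auto simp: a_def unit_matrices_def upper_def)
    have "measure_pmf.expectation (sample_pmf n p \<theta>) (\<lambda>s. exp (\<Sum>e\<in>upper n. h e (fst s e) (snd s e)))
        \<le> exp (\<Sum>e\<in>upper n. R\<^sup>2 / 4 * p)"
      unfolding sp
    proof (rule exp_moment_sum_le)
      fix x z w
      have "\<bar>of_bool w - p\<bar> \<le> 1" using p by (cases w) auto
      then have "R / 2 * \<bar>of_bool w - p\<bar> \<le> 1 * 1" using R_pos R_le by (intro mult_mono) auto
      then show "\<bar>h x z w\<bar> \<le> 1" using R_pos e by (auto simp: h_def abs_mult)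
    next
      fix x
      show "p * (a x * h x True True + (1 - a x) * h x False True) +
         (1 - p) * (a x * h x True False + (1 - a x) * h x False False) = 0"
        by (simp add: h_def algebra_simps)
    next
      fix x
      have e2: "e\<^sup>2 = 1" using e by auto
      have "p * (a x * (h x True True)\<^sup>2 + (1 - a x) * (h x False True)\<^sup>2) +
         (1 - p) * (a x * (h x True False)\<^sup>2 + (1 - a x) * (h x False False)\<^sup>2) = R\<^sup>2 / 4 * p * (1 - p)"
        unfolding h_def power_mult_distrib e2 by (simp add: field_simps power2_eq_square)
      also have "\<dots> \<le> R\<^sup>2 / 4 * p * 1" using p by (intro mult_left_mono) auto
      finally show "p * (a x * (h x True True)\<^sup>2 + (1 - a x) * (h x False True)\<^sup>2) +
         (1 - p) * (a x * (h x True False)\<^sup>2 + (1 - a x) * (h x False False)\<^sup>2) \<le> R\<^sup>2 / 4 * p" by simp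
    qed (use p a01 finite_upper in auto)
    then have "measure_pmf.prob (sample_pmf n p \<theta>)
        {s. (\<Sum>e\<in>upper n. h e (fst s e) (snd s e)) > (\<Sum>e\<in>upper n. R\<^sup>2 / 4 * p) + ln (real n)} \<le> exp (- ln (real n))"
      by (rule prob_le_exp_moment[OF finite_set_sample_pmf])
    also have "exp (- ln (real n)) = 1 / real n" using n by (simp add: exp_minus field_simps)
    also have "{s. (\<Sum>e\<in>upper n. h e (fst s e) (snd s e)) > (\<Sum>e\<in>upper n. R\<^sup>2 / 4 * p) + ln (real n)} = ?A e"
      by (simp add: h_def sum_distrib_left mult.assoc)
    finally show ?thesis .
  qed
  have "{s. \<bar>p_hat n s - p\<bar> > 5 / 8 * p * R} \<subseteq> (\<Union>e\<in>{-1, 1}. ?A e)"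
  proof
    fix s assume "s \<in> {s. \<bar>p_hat n s - p\<bar> > 5 / 8 * p * R}"
    then have "\<exists>e\<in>{-1, 1}. e * (p_hat n s - p) > 5 / 8 * p * R" by (auto simp: abs_if split: if_splits)
    then obtain e where e: "e \<in> {-1, 1}" "e * (p_hat n s - p) > 5 / 8 * p * R" by blast
    have "R / 2 * ?N * (5 / 8 * p * R) < R / 2 * ?N * (e * (p_hat n s - p))"
      using e N R_pos by (intro mult_strict_left_mono) auto
    also have "\<dots> = R / 2 * (e * ?W s)" unfolding ph[symmetric] by simp
    finally have 1: "R / 2 * ?N * (5 / 8 * p * R) < R / 2 * (e * ?W s)" .
    \<comment> \<open>Then \<open>ln n = n * p * R\<^sup>2\<close> costs at most \<open>1/16\<close>
      of \<open>?N * p * R\<^sup>2\<close>. Added to the \<open>1/4\<close> from the variance it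
      makes \<open>5/16\<close>, which explains the constant \<open>5/8\<close>.\<close>
    have "real n \<le> ?N / 16" unfolding card_upper using n by (simp add: field_simps)
    then have "real n * (p * R\<^sup>2) \<le> ?N / 16 * (p * R\<^sup>2)" using p by (intro mult_right_mono) auto
    then have "?N * (R\<^sup>2 / 4 * p) + ln (real n) \<le> R / 2 * ?N * (5 / 8 * p * R)"
      unfolding ln_eq by (simp add: power2_eq_square algebra_simps)
    then have "s \<in> ?A e" unfolding mem_Collect_eq using 1 by (rule order.strict_trans1)
    then show "s \<in> (\<Union>e\<in>{-1, 1}. ?A e)" using e(1) by (rule UN_I[rotated])
  qed
  then have "measure_pmf.prob (sample_pmf n p \<theta>) {s. \<bar>p_hat n s - p\<bar> > 5 / 8 * p * R} \<le>
      measure_pmf.prob (sample_pmf n p \<theta>) (\<Union>e\<in>{-1, 1}. ?A e)"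
    by (intro measure_pmf.finite_measure_mono) auto
  also have "\<dots> \<le> (\<Sum>e\<in>{-1, 1}. measure_pmf.prob (sample_pmf n p \<theta>) (?A e))"
    by (intro measure_UNION_le) auto
  also have "\<dots> \<le> (\<Sum>e\<in>{-1, 1 :: real}. 1 / real n)" using one by (intro sum_mono) auto
  also have "\<dots> = 2 / real n" by simp
  finally show ?thesis .
qed

end

section \<open>The good event\<close>

lemma orient_orient: "j \<in> {1..n} \<Longrightarrow> orient md n (orient md n j) = j"
  by (auto simp: orient_def split: model.split)

lemma sum_orient:
  fixes f :: "nat \<Rightarrow> real"
  shows "(\<Sum>j=1..n. f (orient md n j)) = (\<Sum>j=1..n. f j)"
  by (rule sum.reindex_bij_betw[OF bij_betw_orient])

section \<open>Depth and number of the block lists\<close>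

lemma ex_dyadic_depth:
  assumes n: "n \<ge> 3"
  obtains K :: nat where "n < 2 ^ K" "K \<le> n" "real K \<le> 3 * ln (real n)"
proof -
  \<comment> \<open>\<open>m\<close> is the integer part of the binary logarithm of
    \<open>n\<close>, and the depth is \<open>m + 1\<close>.\<close>
  obtain m where m: "2 ^ m \<le> n" "n < 2 ^ (m + 1)" using ex_power_ivl1[of 2 n] n by auto
  have "m < n" using m(1) less_exp[of m] by linarith
  have "real (2 ^ m) \<le> real n" using m(1) by (simp only: of_nat_le_iff)
  then have "ln (2 ^ m) \<le> ln (real n)" using n by (subst ln_le_cancel_iff) auto
  then have "real m * ln 2 \<le> ln (real n)" by (simp add: ln_realpow)
  moreover have "real m * (1 / 2) \<le> real m * ln 2" using ln2_ge_two_thirds by (intro mult_left_mono) auto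
  moreover have "1 \<le> ln (real n)"
  proof -
    have "exp 1 \<le> real n" using exp_le n by linarith
    then show ?thesis using n by (simp add: ln_ge_iff)
  qed
  ultimately have "real (m + 1) \<le> 3 * ln (real n)" by simp
  then show thesis using m \<open>m < n\<close> by (intro that[of "m + 1"]) auto
qed

lemma finite_block_lists: "finite (block_lists n K)"
  unfolding block_lists_def by (rule finite_lists_length_eq) simp

text \<open>There are at most \<open>n ^ 6\<close> triples because \<open>n + 1 \<le> n * n\<close>,
  and a list has length \<open>4 * n * K\<close>.\<close>

lemma card_block_lists_le:
  assumes n: "n \<ge> 2" and K: "K \<le> n"
  shows "real (card (block_lists n K)) \<le> exp (24 * real n * real K * ln (real n))"
proof -
  have "card (block_lists n K) = card ({..K} \<times> {..n} \<times> {..n}) ^ (4 * n * K)"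
    unfolding block_lists_def by (rule card_lists_length_eq) simp
  also have "card ({..K} \<times> {..n} \<times> {..n}) = (K + 1) * ((n + 1) * (n + 1))" by (simp add: card_cartesian_product)
  also have "\<dots> ^ (4 * n * K) \<le> (n ^ 6) ^ (4 * n * K)"
  proof (rule power_mono)
    have "n + 1 \<le> 2 * n" using n by simp
    also have "\<dots> \<le> n * n" using n by (intro mult_right_mono) auto
    finally have n2: "n + 1 \<le> n * n" .
    have "(K + 1) * ((n + 1) * (n + 1)) \<le> (n * n) * ((n * n) * (n * n))"
      using n2 K by (intro mult_le_mono) auto
    then show "(K + 1) * ((n + 1) * (n + 1)) \<le> n ^ 6" by (simp add: power_numeral_reduce mult.assoc)
  qed simp
  also have "\<dots> = n ^ (24 * n * K)" by (simp add: mult.assoc flip: power_mult)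
  finally have "real (card (block_lists n K)) \<le> real (n ^ (24 * n * K))" by (simp only: of_nat_le_iff)
  also have "\<dots> = exp (real (24 * n * K) * ln (real n))"
    using n by (simp add: exp_of_nat_mult del: of_nat_mult)
  finally show ?thesis by simp
qed

section \<open>Reduction of the risk to a good event\<close>

lemma estimation_error_bounded:
  assumes \<theta>: "\<theta> \<in> Theta md n" and \<phi>: "\<phi> \<in> ordered_class md n" and \<sigma>: "\<sigma> permutes {1..n}"
  shows "(frob n (\<lambda>i j. estimator md n s \<sigma> i j - \<theta> i j))\<^sup>2 \<le> (real n)\<^sup>2"
proof -
  have e: "0 \<le> estimator md n s \<sigma> i j \<and> estimator md n s \<sigma> i j \<le> 1" for i j
    using ordered_class_bounds[OF Proj_minimizes(1)[OF \<phi>]]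
    by (simp add: estimator_def mat_perm_def J_def)
  have t: "0 \<le> \<theta> i j \<and> \<theta> i j \<le> 1" for i j
    using Theta_unit[OF \<theta>] unfolding unit_matrices_def by (cases "i \<in> {1..n} \<and> j \<in> {1..n}") auto
  have "(estimator md n s \<sigma> i j - \<theta> i j)\<^sup>2 \<le> 1" for i j
    using e[of i j] t[of i j] by (simp add: abs_square_le_1 abs_le_iff)
  then have "(frob n (\<lambda>i j. estimator md n s \<sigma> i j - \<theta> i j))\<^sup>2 \<le> (\<Sum>i=1..n. \<Sum>j=1..n. 1)"
    unfolding frob_power2 by (intro sum_mono)
  then show ?thesis by (simp add: power2_eq_square)
qed

text \<open>The expectation is conditioned on the sample: on bad samples all entries lie in
  \<open>[0, 1]\<close>, which bounds the squared error by \<open>n\<^sup>2\<close>.\<close>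

lemma expectation_estimator_le:
  assumes \<theta>: "\<theta> \<in> Theta md n" and \<phi>: "\<phi> \<in> ordered_class md n"
    and good: "\<And>s \<sigma>. s \<notin> bad \<Longrightarrow> \<sigma> \<in> sorting_perms n (data_matrix md n s) \<Longrightarrow>
      (frob n (\<lambda>i j. estimator md n s \<sigma> i j - \<theta> i j))\<^sup>2 \<le> b" and b: "b \<ge> 0"
  shows "measure_pmf.expectation (estimator_pmf md n p \<theta>) (\<lambda>t. (frob n (\<lambda>i j. t i j - \<theta> i j))\<^sup>2)
    \<le> b + (real n)\<^sup>2 * measure_pmf.prob (sample_pmf n p \<theta>) bad"
proof -
  let ?S = "sample_pmf n p \<theta>" and ?f = "\<lambda>t. (frob n (\<lambda>i j. t i j - \<theta> i j))\<^sup>2"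
  let ?P = "\<lambda>s. pmf_of_set (sorting_perms n (data_matrix md n s))"
  have fin: "finite (set_pmf (?P s))" for s
    by (simp add: set_pmf_of_set sorting_perms_nonempty sorting_perms_finite)
  have inner: "measure_pmf.expectation (map_pmf (estimator md n s) (?P s)) ?f \<le> b + (real n)\<^sup>2 * indicator bad s" for s
  proof -
    have "?f (estimator md n s \<sigma>) \<le> b + (real n)\<^sup>2 * indicator bad s"
      if "\<sigma> \<in> sorting_perms n (data_matrix md n s)" for \<sigma>
      using estimation_error_bounded[OF \<theta> \<phi>, of \<sigma> s] good[of s \<sigma>] that b
      by (cases "s \<in> bad") (auto simp: sorting_perms_def)
    then have "measure_pmf.expectation (?P s) (\<lambda>\<sigma>. ?f (estimator md n s \<sigma>)) \<le>
        measure_pmf.expectation (?P s) (\<lambda>_. b + (real n)\<^sup>2 * indicator bad s)"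
      by (intro integral_mono_AE integrable_measure_pmf_finite fin)
        (auto simp: AE_measure_pmf_iff set_pmf_of_set sorting_perms_nonempty sorting_perms_finite)
    then show ?thesis by simp
  qed
  have "measure_pmf.expectation (estimator_pmf md n p \<theta>) ?f =
      (\<Sum>s\<in>set_pmf ?S. pmf ?S s *\<^sub>R measure_pmf.expectation (map_pmf (estimator md n s) (?P s)) ?f)"
    unfolding estimator_pmf_def
    by (rule pmf_expectation_bind) (use finite_set_sample_pmf fin in auto)
  also have "\<dots> \<le> (\<Sum>s\<in>set_pmf ?S. pmf ?S s *\<^sub>R (b + (real n)\<^sup>2 * indicator bad s))"
    by (intro sum_mono scaleR_left_mono inner) auto
  also have "\<dots> = measure_pmf.expectation ?S (\<lambda>s. b + (real n)\<^sup>2 * indicator bad s)"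
    by (rule integral_measure_pmf[symmetric]) (auto simp: finite_set_sample_pmf)
  also have "\<dots> = b + (real n)\<^sup>2 * measure_pmf.prob ?S bad"
    by (subst Bochner_Integration.integral_add)
      (auto intro!: integrable_measure_pmf_finite simp: finite_set_sample_pmf)
  finally show ?thesis .
qed

section \<open>The finite net and the good event\<close>

context observation_model
begin

text \<open>The possible values of approximant minus target, with the columns back in their original
  order. The restriction to entries at most \<open>3\<close> keeps the exponential moments
  available.\<close>

definition net :: "nat \<Rightarrow> matrix \<Rightarrow> matrix set" where
  "net K \<phi> = (\<lambda>xs i j. block_matrix n xs i (orient md n j) - fill_diag md n \<phi> i j) `
     {xs \<in> block_lists n K. \<forall>i\<in>{1..n}. \<forall>j\<in>{1..n}. block_matrix n xs i j \<le> 3}"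

lemma finite_net: "finite (net K \<phi>)"
  unfolding net_def using finite_block_lists by simp

lemma card_net_le: "card (net K \<phi>) \<le> card (block_lists n K)"
  unfolding net_def using finite_block_lists by (intro order_trans[OF card_image_le] card_mono) auto

lemma net_bounded:
  assumes \<phi>: "\<phi> \<in> ordered_class md n" and "D \<in> net K \<phi>" "i \<in> {1..n}" "j \<in> {1..n}"
  shows "\<bar>D i j\<bar> \<le> 3"
proof -
  obtain xs where xs: "\<And>i j. i \<in> {1..n} \<Longrightarrow> j \<in> {1..n} \<Longrightarrow> block_matrix n xs i j \<le> 3"
      "D = (\<lambda>i j. block_matrix n xs i (orient md n j) - fill_diag md n \<phi> i j)"
    using assms(2) unfolding net_def by blast
  have "orient md n j \<in> {1..n}" using bij_betw_orient[of md n, THEN bij_betwE] assms by blast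
  then show ?thesis
    using xs(1)[OF assms(3)] block_matrix_nonneg[of n xs i "orient md n j"] fill_diag_bounds[OF \<phi>, of i j]
    unfolding xs(2) abs_le_iff by fastforce
qed

text \<open>The block approximation is applied to the filled and oriented \<open>t\<close>. The
  filled diagonal does not affect the inner product, since \<open>X\<close> vanishes there, and
  costs at most \<open>n\<close> in the squared distance.\<close>

lemma net_approximates:
  assumes \<phi>: "\<phi> \<in> ordered_class md n" and t: "t \<in> ordered_class md n" and K: "n < 2 ^ K"
    and X: "\<And>i. X i i = 0"
  obtains D where "D \<in> net K \<phi>"
    "(\<Sum>i=1..n. \<Sum>j=1..n. X i j * (t i j - \<phi> i j)) \<le> (\<Sum>i=1..n. \<Sum>j=1..n. X i j * D i j)"
    "(\<Sum>i=1..n. \<Sum>j=1..n. (D i j)\<^sup>2) \<le> 12 * real n * (real K)\<^sup>2 + 2 * ((\<Sum>i=1..n. \<Sum>j=1..n. (t i j - \<phi> i j)\<^sup>2) + real n)"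
proof -
  let ?o = "orient md n" and ?T = "fill_diag md n t" and ?F = "fill_diag md n \<phi>"
  have "n \<ge> 1" using n by simp
  from monotone_grid_fill_diag[OF t this] interpret monotone_grid n "\<lambda>i j. ?T i (?o j)" .
  obtain xs where xs: "xs \<in> block_lists n K"
    "(\<Sum>i=1..n. \<Sum>j=1..n. X i (?o j) * ?T i (?o j)) \<le> (\<Sum>i=1..n. \<Sum>j=1..n. X i (?o j) * block_matrix n xs i j)"
    "(\<Sum>i=1..n. \<Sum>j=1..n. (block_matrix n xs i j - ?T i (?o j))\<^sup>2) \<le> 6 * real n * (real K)\<^sup>2"
    "\<And>i j. i \<in> {1..n} \<Longrightarrow> j \<in> {1..n} \<Longrightarrow> block_matrix n xs i j \<le> 3"
    using block_approximation[OF K, of "\<lambda>i j. X i (?o j)"] by blast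
  define B where "B = (\<lambda>i j. block_matrix n xs i (?o j))"
  have B: "block_matrix n xs i j = B i (?o j)" if "j \<in> {1..n}" for i j
    using orient_orient[OF that] by (simp add: B_def)
  have "(\<Sum>i=1..n. \<Sum>j=1..n. X i (?o j) * block_matrix n xs i j) = (\<Sum>i=1..n. \<Sum>j=1..n. X i (?o j) * B i (?o j))"
    by (intro sum.cong refl) (simp add: B)
  then have lin: "(\<Sum>i=1..n. \<Sum>j=1..n. X i j * ?T i j) \<le> (\<Sum>i=1..n. \<Sum>j=1..n. X i j * B i j)"
    using xs(2) sum_orient[of "\<lambda>j. X i j * ?T i j" md n for i] sum_orient[of "\<lambda>j. X i j * B i j" md n for i] by simp
  have "(\<Sum>i=1..n. \<Sum>j=1..n. (block_matrix n xs i j - ?T i (?o j))\<^sup>2) = (\<Sum>i=1..n. \<Sum>j=1..n. (B i (?o j) - ?T i (?o j))\<^sup>2)"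
    by (intro sum.cong refl) (simp add: B)
  then have sq: "(\<Sum>i=1..n. \<Sum>j=1..n. (B i j - ?T i j)\<^sup>2) \<le> 6 * real n * (real K)\<^sup>2"
    using xs(3) sum_orient[of "\<lambda>j. (B i j - ?T i j)\<^sup>2" md n for i] by simp
  define D where "D = (\<lambda>i j. B i j - ?F i j)"
  have "D \<in> net K \<phi>" unfolding net_def D_def B_def using xs(1,4) by blast
  moreover have "(\<Sum>i=1..n. \<Sum>j=1..n. X i j * (t i j - \<phi> i j)) \<le> (\<Sum>i=1..n. \<Sum>j=1..n. X i j * D i j)"
  proof -
    have "X i j * (t i j - \<phi> i j) = X i j * ?T i j - X i j * ?F i j" for i j
      by (cases "i = j") (simp_all add: X fill_diag_def right_diff_distrib)
    then show ?thesis using lin by (simp add: D_def right_diff_distrib sum_subtractf)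
  qed
  moreover have "(\<Sum>i=1..n. \<Sum>j=1..n. (D i j)\<^sup>2) \<le> 12 * real n * (real K)\<^sup>2 + 2 * ((\<Sum>i=1..n. \<Sum>j=1..n. (t i j - \<phi> i j)\<^sup>2) + real n)"
  proof -
    have "(D i j)\<^sup>2 \<le> 2 * (B i j - ?T i j)\<^sup>2 + 2 * ((t i j - \<phi> i j)\<^sup>2 + (if i = j then 1 else 0))" for i j
    proof -
      have "(?T i j - ?F i j)\<^sup>2 \<le> (t i j - \<phi> i j)\<^sup>2 + (if i = j then 1 else 0)"
      proof (cases "i = j")
        case True
        have "\<bar>?T i j - ?F i j\<bar> \<le> 1"
          using fill_diag_bounds[OF t, of i j] fill_diag_bounds[OF \<phi>, of i j] by simp
        then have "(?T i j - ?F i j)\<^sup>2 \<le> 1" by (simp add: abs_square_le_1)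
        then show ?thesis using True by (simp add: add_increasing)
      qed (simp add: fill_diag_def)
      moreover have "(D i j)\<^sup>2 \<le> 2 * (B i j - ?T i j)\<^sup>2 + 2 * (?T i j - ?F i j)\<^sup>2"
      proof -
        have "(a + b)\<^sup>2 \<le> 2 * a\<^sup>2 + 2 * b\<^sup>2" for a b :: real
          using zero_le_power2[of "a - b"] by (simp add: power2_sum power2_diff)
        from this[of "B i j - ?T i j" "?T i j - ?F i j"] show ?thesis by (simp add: D_def)
      qed
      moreover have "d \<le> 2 * b + 2 * y" if "x \<le> y" "d \<le> 2 * b + 2 * x" for b d x y :: real
        using that by linarith
      ultimately show ?thesis by blast
    qed
    then have "(\<Sum>i=1..n. \<Sum>j=1..n. (D i j)\<^sup>2) \<le>
        (\<Sum>i=1..n. \<Sum>j=1..n. 2 * (B i j - ?T i j)\<^sup>2 + 2 * ((t i j - \<phi> i j)\<^sup>2 + (if i = j then 1 else 0)))"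
      by (intro sum_mono)
    also have "\<dots> = 2 * (\<Sum>i=1..n. \<Sum>j=1..n. (B i j - ?T i j)\<^sup>2) +
        2 * ((\<Sum>i=1..n. \<Sum>j=1..n. (t i j - \<phi> i j)\<^sup>2) + (\<Sum>i=1..n. \<Sum>j=1..n. if i = j then 1 else 0))"
      by (simp only: sum.distrib sum_distrib_left[symmetric])
    also have "(\<Sum>i=1..n. \<Sum>j=1..n. if i = j then 1 else 0) = real n" by simp
    finally show ?thesis using sq by linarith
  qed
  ultimately show thesis by (rule that)
qed

text \<open>The constant is \<open>74 = 72 + 1 + 1\<close>: \<open>72 = 24 * 3\<close> for the
  logarithm of the size of the net at depth \<open>K \<le> 3 * ln n\<close>, \<open>1\<close> for
  the \<open>n!\<close> permutations, and \<open>1\<close> for the remaining probability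
  \<open>1 / n\<close>.\<close>

definition good :: "nat \<Rightarrow> matrix \<Rightarrow> sample \<Rightarrow> bool" where
  "good K \<phi> s \<longleftrightarrow>
    (\<forall>\<sigma>. \<sigma> permutes {1..n} \<longrightarrow> (\<forall>D\<in>net K \<phi>. (\<Sum>i=1..n. \<Sum>j=1..n. Z s (\<sigma> i) (\<sigma> j) * D i j)
       \<le> (\<Sum>i=1..n. \<Sum>j=1..n. (D i j)\<^sup>2) / 32 + 16 * (74 * real n * (ln (real n))\<^sup>2) / p)) \<and>
    (\<forall>i\<in>{1..n}. \<bar>\<Sum>j=1..n. Z s i j\<bar> \<le> 5 * real n * R) \<and> \<bar>p_hat n s - p\<bar> \<le> 5 / 8 * p * R"

lemma prob_bad_le:
  assumes \<phi>: "\<phi> \<in> ordered_class md n" and K: "K \<le> n" "real K \<le> 3 * ln (real n)"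
  shows "measure_pmf.prob (sample_pmf n p \<theta>) {s. \<not> good K \<phi> s} \<le> 5 / real n"
proof -
  let ?P = "measure_pmf.prob (sample_pmf n p \<theta>)" and ?l = "ln (real n)"
  let ?H = "74 * real n * ?l\<^sup>2"
  let ?A = "{s. \<exists>\<sigma>. \<sigma> permutes {1..n} \<and> (\<exists>D\<in>net K \<phi>.
      (\<Sum>i=1..n. \<Sum>j=1..n. Z s (\<sigma> i) (\<sigma> j) * D i j) > (\<Sum>i=1..n. \<Sum>j=1..n. (D i j)\<^sup>2) / 32 + 16 * ?H / p)}"
  let ?B = "{s. \<exists>i\<in>{1..n}. \<bar>\<Sum>j=1..n. Z s i j\<bar> > 5 * real n * R}"
  let ?C = "{s. \<bar>p_hat n s - p\<bar> > 5 / 8 * p * R}"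
  have l1: "?l \<ge> 1" by (rule ln_ge_1)
  have ll: "?l \<le> ?l\<^sup>2" using l1 by (simp add: power2_eq_square)
  have "?P ?A \<le> fact n * real (card (net K \<phi>)) * exp (- ?H)"
    by (rule prob_noise_net[OF finite_net]) (rule net_bounded[OF \<phi>])
  also have "\<dots> \<le> exp (real n * ?l) * exp (24 * real n * real K * ?l) * exp (- ?H)"
  proof (intro mult_right_mono mult_mono)
    have "fact n \<le> real n ^ n" using fact_le_power[where n = n] by simp
    also have "\<dots> = exp (real n * ?l)" using n by (simp add: exp_of_nat_mult)
    finally show "fact n \<le> exp (real n * ?l)" .
    have "real (card (net K \<phi>)) \<le> real (card (block_lists n K))" using card_net_le by simp
    also have "\<dots> \<le> exp (24 * real n * real K * ?l)" using n K by (intro card_block_lists_le) auto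
    finally show "real (card (net K \<phi>)) \<le> exp (24 * real n * real K * ?l)" .
  qed auto
  also have "\<dots> = exp (real n * ?l + 24 * real n * real K * ?l - ?H)" by (simp flip: exp_add)
  also have "\<dots> \<le> exp (- ?l)"
  proof -
    have "real n * ?l \<le> real n * ?l\<^sup>2" using ll by (intro mult_left_mono) auto
    moreover have "24 * real n * real K * ?l \<le> 24 * real n * (3 * ?l) * ?l"
      using K l1 by (intro mult_right_mono mult_left_mono) auto
    moreover have "24 * real n * (3 * ?l) * ?l = 72 * (real n * ?l\<^sup>2)" by (simp add: power2_eq_square)
    moreover have "?l \<le> real n * ?l\<^sup>2"
    proof -
      have "1 * ?l\<^sup>2 \<le> real n * ?l\<^sup>2" using n by (intro mult_right_mono) auto
      then show ?thesis using ll by simp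
    qed
    moreover have "?H = 74 * (real n * ?l\<^sup>2)" by simp
    ultimately have "real n * ?l + 24 * real n * real K * ?l - ?H \<le> - ?l" by linarith
    then show ?thesis by simp
  qed
  also have "exp (- ?l) = 1 / real n" using n by (simp add: exp_minus inverse_eq_divide)
  finally have A: "?P ?A \<le> 1 / real n" .
  have "{s. \<not> good K \<phi> s} \<subseteq> ?A \<union> (?B \<union> ?C)" unfolding good_def by (auto simp: not_le)
  then have "?P {s. \<not> good K \<phi> s} \<le> ?P (?A \<union> (?B \<union> ?C))" by (intro measure_pmf.finite_measure_mono) auto
  also have "\<dots> \<le> ?P ?A + ?P (?B \<union> ?C)" by (rule measure_Un_le) auto
  also have "?P (?B \<union> ?C) \<le> ?P ?B + ?P ?C" by (rule measure_Un_le) auto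
  finally show ?thesis using A prob_row_noise prob_p_hat by simp
qed

end

section \<open>Error bounds on the good event\<close>

text \<open>The weights are such that two uses of this, together with the quarter produced by the
  noise term, leave a quarter of the left-hand side of the basic inequality.\<close>

lemma two_mult_le_squares:
  fixes x y :: real
  shows "2 * x * y \<le> 4 * x\<^sup>2 + y\<^sup>2 / 4"
proof -
  have "0 \<le> (2 * x - y / 2)\<^sup>2" by simp
  then show ?thesis by (simp add: power2_diff power_mult_distrib power_divide)
qed

context observation_model
begin

lemma data_matrix_eq: "data_matrix md n s i j = p * (Z s i j + \<theta> i j - J n i j / 2) + J n i j / 2"
  using p_pos by (simp add: noise_def field_simps)

text \<open>\<open>\<rho> = \<pi> \<circ> \<sigma>\<close> gives the true rank of the row placed at
  each position. \<open>sorting_stability\<close> compares the true row sums at positions and ranks,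
  and \<open>permutation_error_le\<close> converts this into the squared error.\<close>

lemma ordering_error_le:
  assumes \<phi>: "\<phi> \<in> ordered_class md n" and \<pi>: "\<pi> permutes {1..n}" and \<theta>eq: "\<theta> = mat_perm \<phi> \<pi>"
    and L: "L > 0" and \<alpha>: "\<alpha> > 0" and \<eta>: "Hoelder_ordering n \<alpha> L \<phi> \<eta>"
    and rows: "\<And>i. i \<in> {1..n} \<Longrightarrow> \<bar>\<Sum>j=1..n. Z s i j\<bar> \<le> 5 * real n * R"
    and \<sigma>: "\<sigma> \<in> sorting_perms n (data_matrix md n s)"
  shows "(\<Sum>i=1..n. \<Sum>j=1..n. (\<theta> (\<sigma> i) (\<sigma> j) - \<phi> i j)\<^sup>2) \<le>
    4 * real n * (2 + real n * (864 * R\<^sup>2 + 3456 * (L powr (1 / (\<alpha> + 1)) * (R\<^sup>2) powr ((2 * \<alpha> + 1) / (2 * \<alpha> + 2)))))"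
proof -
  let ?F = "fill_diag md n \<phi>"
  define \<rho> where "\<rho> = \<pi> \<circ> \<sigma>"
  define v where "v = (\<lambda>i. \<Sum>c=1..n. ?F i c)"
  define x where "x = (\<lambda>i. (\<Sum>j=1..n. Z s (\<sigma> i) j) + (\<Sum>j=1..n. \<theta> (\<sigma> i) j))"
  have \<sigma>p: "\<sigma> permutes {1..n}" and sorted: "mono_on {1..n} (\<lambda>i. row_sum n (data_matrix md n s) (\<sigma> i))"
    using \<sigma> by (auto simp: sorting_perms_def)
  have \<rho>: "\<rho> permutes {1..n}" unfolding \<rho>_def by (rule permutes_compose[OF \<sigma>p \<pi>])
  have im: "\<sigma> k \<in> {1..n}" "\<rho> k \<in> {1..n}" if "k \<in> {1..n}" for k
    using permutes_in_image[OF \<sigma>p] permutes_in_image[OF \<rho>] that by auto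
  have v: "mono_on {1..n} v"
    unfolding v_def by (intro mono_onI sum_mono fill_diag_row_mono[OF \<phi>]) auto
  \<comment> \<open>All rows of \<open>J\<close> have the same sum, so the row sums of the data are
    an increasing affine function of \<open>x\<close>, and sorting the one sorts the other.\<close>
  have row: "row_sum n (data_matrix md n s) (\<sigma> i) = p * x i + (1 - p) / 2 * (real n - 1)" if i: "i \<in> {1..n}" for i
  proof -
    have "(\<Sum>j=1..n. J n (\<sigma> i) j) = (\<Sum>j=1..n. 1 - (if j = \<sigma> i then 1 else 0))"
      using im[OF i] by (intro sum.cong) (auto simp: J_def)
    also have "\<dots> = real n - 1" using im(1)[OF i] by (simp add: sum_subtractf)
    finally have J: "(\<Sum>j=1..n. J n (\<sigma> i) j) = real n - 1" .
    have "row_sum n (data_matrix md n s) (\<sigma> i) =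
        (\<Sum>j=1..n. p * Z s (\<sigma> i) j + p * \<theta> (\<sigma> i) j + (1 - p) / 2 * J n (\<sigma> i) j)"
      unfolding row_sum_def data_matrix_eq by (intro sum.cong refl) (simp add: field_simps)
    also have "\<dots> = p * x i + (1 - p) / 2 * (\<Sum>j=1..n. J n (\<sigma> i) j)"
      by (simp only: sum.distrib sum_distrib_left[symmetric] x_def distrib_left)
    finally show ?thesis unfolding J .
  qed
  have x: "mono_on {1..n} x"
  proof (rule mono_onI)
    fix i k assume "i \<in> {1..n}" "k \<in> {1..n}" "i \<le> k"
    then have "p * x i \<le> p * x k" using mono_onD[OF sorted, of i k] row[of i] row[of k] by simp
    then show "x i \<le> x k" using p_pos by simp
  qed
  \<comment> \<open>This absorbs the \<open>1\<close> that the filled diagonal adds to a row sum: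
    \<open>2 * (5 * n * R + 1) \<le> 12 * n * R\<close>.\<close>
  have nR: "real n * R \<ge> 1"
  proof -
    have "1 * 1 \<le> real n * ln (real n)" using ln_ge_1 n by (intro mult_mono) auto
    also have "\<dots> \<le> real n * ln (real n) / p" using p_pos p(2) ln_ge_1 n by (simp add: field_simps)
    also have "\<dots> = (real n * R)\<^sup>2" unfolding power_mult_distrib R2 using n p_pos by (simp add: field_simps power2_eq_square)
    finally have "1\<^sup>2 \<le> (real n * R)\<^sup>2" by simp
    then show ?thesis using R_pos by (intro power2_le_imp_le[of 1]) auto
  qed
  have close: "\<bar>x i - v (\<rho> i)\<bar> \<le> 5 * real n * R + 1" if i: "i \<in> {1..n}" for i
  proof -
    have "(\<Sum>j=1..n. \<theta> (\<sigma> i) j) = (\<Sum>j=1..n. \<phi> (\<rho> i) (\<pi> j))"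
      by (simp add: \<theta>eq mat_perm_def \<rho>_def)
    also have "\<dots> = (\<Sum>c=1..n. \<phi> (\<rho> i) c)"
      using sum.permute[OF \<pi>, of "\<phi> (\<rho> i)"] by (simp add: o_def)
    finally have th: "(\<Sum>j=1..n. \<theta> (\<sigma> i) j) = (\<Sum>c=1..n. \<phi> (\<rho> i) c)" .
    have "v (\<rho> i) - (\<Sum>c=1..n. \<phi> (\<rho> i) c) = (\<Sum>c=1..n. if c = \<rho> i then ?F (\<rho> i) (\<rho> i) else 0)"
      unfolding v_def sum_subtractf[symmetric]
      using ordered_class_diag[OF \<phi>] by (intro sum.cong refl) (auto simp: fill_diag_def)
    also have "\<dots> = ?F (\<rho> i) (\<rho> i)" using im(2)[OF i] by simp
    finally have "\<bar>v (\<rho> i) - (\<Sum>c=1..n. \<phi> (\<rho> i) c)\<bar> \<le> 1" using fill_diag_bounds[OF \<phi>, of "\<rho> i" "\<rho> i"] by linarith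
    then show ?thesis using rows[OF im(1)[OF i]] unfolding x_def th by linarith
  qed
  define w where "w = 2 * (5 * real n * R + 1)"
  have w: "0 \<le> w" "w \<le> 12 * real n * sqrt (R\<^sup>2)" using nR R_pos by (auto simp: w_def)
  have "(\<Sum>i=1..n. \<Sum>j=1..n. (\<theta> (\<sigma> i) (\<sigma> j) - \<phi> i j)\<^sup>2) = (\<Sum>i=1..n. \<Sum>j=1..n. (\<phi> (\<rho> i) (\<rho> j) - \<phi> i j)\<^sup>2)"
    by (simp add: \<theta>eq mat_perm_def \<rho>_def)
  also have "\<dots> \<le> 4 * real n *
    (2 + w * max (6 * w / real n) ((6 * w / real n) powr (\<alpha> / (\<alpha> + 1)) * (4 * L) powr (1 / (\<alpha> + 1))))"
  proof (rule permutation_error_le[OF \<phi> L \<alpha> \<eta> \<rho>])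
    fix i assume "i \<in> {1..n}"
    from sorting_stability[OF \<rho> v x close this]
    show "\<bar>(\<Sum>c=1..n. ?F (\<rho> i) c) - (\<Sum>c=1..n. ?F i c)\<bar> \<le> w" by (simp add: v_def w_def)
  qed
  also have "\<dots> \<le> 4 * real n * (2 + real n * (864 * R\<^sup>2 + 3456 * (L powr (1 / (\<alpha> + 1)) * (R\<^sup>2) powr ((2 * \<alpha> + 1) / (2 * \<alpha> + 2)))))"
    using n R_pos by (intro mult_left_mono add_left_mono Hoelder_rate_le[OF L \<alpha> _ _ w]) auto
  finally show ?thesis .
qed

text \<open>The basic inequality for the projection, with error \<open>e = T - \<phi>\<close> in
  sorted coordinates. The sorted data differ from \<open>\<phi>\<close> by the ordering error
  \<open>g1\<close>, the effect \<open>g2\<close> of the estimated \<open>p\<close>, and the noise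
  \<open>z\<close> times \<open>1 + \<kappa>\<close>.\<close>

lemma projection_error_le:
  assumes \<phi>: "\<phi> \<in> ordered_class md n" and \<sigma>: "\<sigma> permutes {1..n}" and K: "n < 2 ^ K" and g: "good K \<phi> s"
  defines "a \<equiv> \<Sum>i=1..n. \<Sum>j=1..n. (\<theta> (\<sigma> i) (\<sigma> j) - \<phi> i j)\<^sup>2"
  shows "(frob n (\<lambda>i j. estimator md n s \<sigma> i j - \<theta> i j))\<^sup>2 \<le>
    34 * a + 16 * (real n)\<^sup>2 * R\<^sup>2 + 12 * real n * (real K)\<^sup>2 + 2 * real n + 512 * (74 * real n * (ln (real n))\<^sup>2) / p"
proof -
  let ?H = "74 * real n * (ln (real n))\<^sup>2"
  define q where "q = p_hat n s"
  have pR: "p * R \<le> p * (3 / 4)" using R_le p_pos by (intro mult_left_mono) auto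
  have q: "\<bar>q - p\<bar> \<le> 5 / 8 * p * R" using g by (simp add: good_def q_def)
  have q2: "q \<ge> p / 2" using q pR p_pos by linarith
  have q0: "q > 0" using q2 p_pos by linarith
  have "1 / real n \<le> ln (real n) / real n" using ln_ge_1 n by (intro divide_right_mono) auto
  \<comment> \<open>Hence the estimator takes its main branch:
    \<open>q \<ge> p / 2 \<ge> ln n / n \<ge> 1 / n\<close>.\<close>
  then have qn: "q \<ge> 1 / real n" using q2 p_ge by simp
  define \<kappa> where "\<kappa> = p / q - 1"
  have \<kappa>R: "\<bar>\<kappa>\<bar> \<le> 5 / 4 * R"
  proof -
    have "\<kappa> * q = p - q" using q0 by (simp add: \<kappa>_def left_diff_distrib)
    then have "\<bar>\<kappa>\<bar> * q = \<bar>p - q\<bar>" using q0 abs_mult[of \<kappa> q] by simp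
    also have "\<dots> \<le> 5 / 4 * R * (p / 2)" using q by (simp add: abs_minus_commute mult_ac)
    also have "\<dots> \<le> 5 / 4 * R * q" using q2 R_pos by (intro mult_left_mono) auto
    finally show ?thesis using q0 by simp
  qed
  have \<kappa>1: "0 \<le> 1 + \<kappa>" "1 + \<kappa> \<le> 2" using q2 q0 p_pos by (auto simp: \<kappa>_def field_simps)
  define A where "A = mat_perm (\<lambda>i j. (data_matrix md n s i j - J n i j / 2) / q + J n i j / 2) \<sigma>"
  define T where "T = Proj md n A"
  have T: "T \<in> ordered_class md n" and Tmin: "frob n (\<lambda>i j. A i j - T i j) \<le> frob n (\<lambda>i j. A i j - \<phi> i j)"
    unfolding T_def by (rule Proj_minimizes(1)[OF \<phi>], rule Proj_minimizes(2)[OF \<phi> \<phi>])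
  define e where "e = (\<lambda>i j. T i j - \<phi> i j)"
  define g1 where "g1 = (\<lambda>i j. \<theta> (\<sigma> i) (\<sigma> j) - \<phi> i j)"
  define g2 where "g2 = (\<lambda>i j. \<kappa> * (\<theta> (\<sigma> i) (\<sigma> j) - J n (\<sigma> i) (\<sigma> j) / 2))"
  define z where "z = (\<lambda>i j. Z s (\<sigma> i) (\<sigma> j))"
  define s2 where "s2 = (\<Sum>i=1..n. \<Sum>j=1..n. (e i j)\<^sup>2)"
  have A: "A i j - \<phi> i j = g1 i j + g2 i j + (1 + \<kappa>) * z i j" for i j
  proof -
    have "A i j = p / q * (Z s (\<sigma> i) (\<sigma> j) + \<theta> (\<sigma> i) (\<sigma> j) - J n (\<sigma> i) (\<sigma> j) / 2) + J n (\<sigma> i) (\<sigma> j) / 2"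
      unfolding A_def mat_perm_def data_matrix_eq by simp
    moreover have "p / q = 1 + \<kappa>" by (simp add: \<kappa>_def)
    ultimately have "A i j = (1 + \<kappa>) * (Z s (\<sigma> i) (\<sigma> j) + \<theta> (\<sigma> i) (\<sigma> j) - J n (\<sigma> i) (\<sigma> j) / 2) + J n (\<sigma> i) (\<sigma> j) / 2"
      by simp
    then show ?thesis by (simp add: g1_def g2_def z_def field_simps)
  qed
  have est: "(frob n (\<lambda>i j. estimator md n s \<sigma> i j - \<theta> i j))\<^sup>2 = (\<Sum>i=1..n. \<Sum>j=1..n. (e i j - g1 i j)\<^sup>2)"
  proof -
    have "estimator md n s \<sigma> = mat_perm T (inv \<sigma>)"
      using qn by (simp add: estimator_def q_def[symmetric] T_def A_def)
    then have "(frob n (\<lambda>i j. estimator md n s \<sigma> i j - \<theta> i j))\<^sup>2 =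
        (\<Sum>i=1..n. \<Sum>j=1..n. (T (inv \<sigma> (\<sigma> i)) (inv \<sigma> (\<sigma> j)) - \<theta> (\<sigma> i) (\<sigma> j))\<^sup>2)"
      unfolding frob_power2 mat_perm_def
      using sum_permute_square[OF \<sigma>, of "\<lambda>i j. (T (inv \<sigma> i) (inv \<sigma> j) - \<theta> i j)\<^sup>2"] by simp
    then show ?thesis by (simp add: permutes_inverses[OF \<sigma>] e_def g1_def)
  qed
  \<comment> \<open>Minimality of \<open>T\<close> is tested against \<open>\<phi>\<close>;
    expanding the square around \<open>\<phi>\<close> bounds \<open>s2\<close> by twice the inner
    product of \<open>A - \<phi>\<close> and \<open>e\<close>.\<close>
  have "(\<Sum>i=1..n. \<Sum>j=1..n. (A i j - T i j)\<^sup>2) \<le> (\<Sum>i=1..n. \<Sum>j=1..n. (A i j - \<phi> i j)\<^sup>2)"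
    using power_mono[OF Tmin, of 2] unfolding frob_power2 by (simp add: frob_def)
  moreover have "(\<Sum>i=1..n. \<Sum>j=1..n. (A i j - T i j)\<^sup>2) =
      (\<Sum>i=1..n. \<Sum>j=1..n. (A i j - \<phi> i j)\<^sup>2) - 2 * (\<Sum>i=1..n. \<Sum>j=1..n. (A i j - \<phi> i j) * e i j) + s2"
  proof -
    have "(A i j - T i j)\<^sup>2 = (A i j - \<phi> i j)\<^sup>2 - 2 * ((A i j - \<phi> i j) * e i j) + (e i j)\<^sup>2" for i j
      by (simp add: e_def power2_eq_square algebra_simps)
    then show ?thesis by (simp only: s2_def sum.distrib sum_subtractf sum_distrib_left)
  qed
  ultimately have "s2 \<le> (\<Sum>i=1..n. \<Sum>j=1..n. 2 * ((A i j - \<phi> i j) * e i j))"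
    by (simp add: sum_distrib_left)
  \<comment> \<open>The terms \<open>g1\<close> and \<open>g2\<close> are split off by
    \<open>two_mult_le_squares\<close>, with
    \<open>4 * (g2 i j)\<^sup>2 \<le> \<kappa>\<^sup>2\<close>; the noise term stays linear for the
    net.\<close>
  also have "\<dots> \<le> (\<Sum>i=1..n. \<Sum>j=1..n. (4 * (g1 i j)\<^sup>2 + (e i j)\<^sup>2 / 4) + (\<kappa>\<^sup>2 + (e i j)\<^sup>2 / 4) + 2 * (1 + \<kappa>) * (z i j * e i j))"
  proof (intro sum_mono)
    fix i j
    have "\<bar>\<theta> (\<sigma> i) (\<sigma> j) - J n (\<sigma> i) (\<sigma> j) / 2\<bar> \<le> 1 / 2"
    proof -
      have t: "0 \<le> \<theta> k l \<and> \<theta> k l \<le> 1 \<and> (J n k l = 0 \<longrightarrow> \<theta> k l = 0)" for k l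
        using Theta_unit[OF \<theta>] Theta_diag[OF \<theta>, of k] unfolding unit_matrices_def J_def
        by (cases "k \<in> {1..n} \<and> l \<in> {1..n}") auto
      show ?thesis
      proof (cases "J n (\<sigma> i) (\<sigma> j) = 0")
        case True
        then show ?thesis using t[of "\<sigma> i" "\<sigma> j"] by simp
      next
        case False
        then have "J n (\<sigma> i) (\<sigma> j) = 1" by (auto simp: J_def split: if_splits)
        then show ?thesis using t[of "\<sigma> i" "\<sigma> j"] by (simp only: abs_le_iff) linarith
      qed
    qed
    then have "(\<theta> (\<sigma> i) (\<sigma> j) - J n (\<sigma> i) (\<sigma> j) / 2)\<^sup>2 \<le> (1 / 2)\<^sup>2"
      by (metis abs_ge_zero power2_abs power_mono)
    then have "\<kappa>\<^sup>2 * (\<theta> (\<sigma> i) (\<sigma> j) - J n (\<sigma> i) (\<sigma> j) / 2)\<^sup>2 \<le> \<kappa>\<^sup>2 * (1 / 2)\<^sup>2" by (intro mult_left_mono) auto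
    then have "4 * (g2 i j)\<^sup>2 \<le> \<kappa>\<^sup>2" by (simp add: g2_def power_mult_distrib power_divide)
    then show "2 * ((A i j - \<phi> i j) * e i j) \<le> (4 * (g1 i j)\<^sup>2 + (e i j)\<^sup>2 / 4) + (\<kappa>\<^sup>2 + (e i j)\<^sup>2 / 4) + 2 * (1 + \<kappa>) * (z i j * e i j)"
      unfolding A using two_mult_le_squares[of "g1 i j" "e i j"] two_mult_le_squares[of "g2 i j" "e i j"]
      by (simp add: algebra_simps)
  qed
  also have "\<dots> = (4 * a + s2 / 4) + ((real n)\<^sup>2 * \<kappa>\<^sup>2 + s2 / 4) + 2 * (1 + \<kappa>) * (\<Sum>i=1..n. \<Sum>j=1..n. z i j * e i j)"
  proof -
    have "(\<Sum>i=1..n. \<Sum>j=1..n. \<kappa>\<^sup>2) = (real n)\<^sup>2 * \<kappa>\<^sup>2" by (simp add: power2_eq_square)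
    then show ?thesis
      by (simp only: sum.distrib sum_distrib_left[symmetric] sum_divide_distrib[symmetric] a_def g1_def s2_def)
  qed
  \<comment> \<open>The net element \<open>D\<close> dominates the inner product, and on the good
    event its noise is at most a 32nd of its squared norm plus \<open>16 * ?H / p\<close>. Since
    \<open>2 * (1 + \<kappa>) \<le> 4\<close>, the part of that norm due to \<open>s2\<close> costs
    \<open>s2 / 4\<close>.\<close>
  also have "2 * (1 + \<kappa>) * (\<Sum>i=1..n. \<Sum>j=1..n. z i j * e i j) \<le> 3 / 2 * real n * (real K)\<^sup>2 + (s2 + real n) / 4 + 64 * ?H / p"
  proof -
    have "z i i = 0" for i by (simp add: z_def noise_diag[OF \<theta>])
    then obtain D where D: "D \<in> net K \<phi>" "(\<Sum>i=1..n. \<Sum>j=1..n. z i j * e i j) \<le> (\<Sum>i=1..n. \<Sum>j=1..n. z i j * D i j)"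
      "(\<Sum>i=1..n. \<Sum>j=1..n. (D i j)\<^sup>2) \<le> 12 * real n * (real K)\<^sup>2 + 2 * (s2 + real n)"
      unfolding e_def s2_def by (rule net_approximates[OF \<phi> T K])
    have "(\<Sum>i=1..n. \<Sum>j=1..n. z i j * D i j) \<le> (\<Sum>i=1..n. \<Sum>j=1..n. (D i j)\<^sup>2) / 32 + 16 * ?H / p"
      using g \<sigma> D(1) unfolding good_def z_def by blast
    then have zV: "(\<Sum>i=1..n. \<Sum>j=1..n. z i j * e i j) \<le> (12 * real n * (real K)\<^sup>2 + 2 * (s2 + real n)) / 32 + 16 * ?H / p"
      (is "_ \<le> ?V") using D(2) divide_right_mono[OF D(3), of 32] by linarith
    have "0 \<le> s2" unfolding s2_def by (intro sum_nonneg) auto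
    then have V: "0 \<le> ?V" using p_pos by (intro add_nonneg_nonneg divide_nonneg_nonneg) auto
    have "2 * (1 + \<kappa>) * (\<Sum>i=1..n. \<Sum>j=1..n. z i j * e i j) \<le> 2 * (1 + \<kappa>) * ?V"
      using zV \<kappa>1 by (intro mult_left_mono) auto
    also have "\<dots> \<le> 4 * ?V" using \<kappa>1 V by (intro mult_right_mono) auto
    also have "\<dots> = 3 / 2 * real n * (real K)\<^sup>2 + (s2 + real n) / 4 + 64 * ?H / p" by (simp add: field_simps)
    finally show ?thesis .
  qed
  finally have main: "s2 \<le> (4 * a + s2 / 4) + ((real n)\<^sup>2 * \<kappa>\<^sup>2 + s2 / 4) +
      (3 / 2 * real n * (real K)\<^sup>2 + (s2 + real n) / 4 + 64 * ?H / p)" by simp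
  have assoc: "c * ?H / p = c * (?H / p)" "c * real n * (real K)\<^sup>2 = c * (real n * (real K)\<^sup>2)"
    "c * (real n)\<^sup>2 * R\<^sup>2 = c * ((real n)\<^sup>2 * R\<^sup>2)" for c by simp_all
  \<comment> \<open>Three quarters of \<open>s2\<close> move to the left, and the rest is multiplied
    by \<open>4\<close>.\<close>
  have s2: "s2 \<le> 16 * a + 4 * ((real n)\<^sup>2 * \<kappa>\<^sup>2) + 6 * (real n * (real K)\<^sup>2) + real n + 256 * (?H / p)"
  proof -
    have "s \<le> 16 * a + 4 * k + 6 * m + N + 256 * h"
      if "s \<le> (4 * a + s / 4) + (k + s / 4) + (3 / 2 * m + (s + N) / 4 + 64 * h)" for s a k m N h :: real
      using that by (simp add: field_simps)
    then show ?thesis using main unfolding assoc by blast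
  qed
  have "\<kappa>\<^sup>2 \<le> (5 / 4 * R)\<^sup>2" using \<kappa>R R_pos by (intro power2_le_iff_abs_le[THEN iffD2]) auto
  then have "\<kappa>\<^sup>2 \<le> 25 / 16 * R\<^sup>2" by (simp add: power_mult_distrib power_divide)
  then have "\<kappa>\<^sup>2 \<le> 2 * R\<^sup>2" using zero_le_power2[of R] by linarith
  then have "(real n)\<^sup>2 * \<kappa>\<^sup>2 \<le> (real n)\<^sup>2 * (2 * R\<^sup>2)" by (rule mult_left_mono) simp
  then have "(real n)\<^sup>2 * \<kappa>\<^sup>2 \<le> 2 * ((real n)\<^sup>2 * R\<^sup>2)" by simp
  moreover have "(\<Sum>i=1..n. \<Sum>j=1..n. (e i j - g1 i j)\<^sup>2) \<le> 2 * s2 + 2 * a"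
  proof -
    have "(e i j - g1 i j)\<^sup>2 \<le> 2 * (e i j)\<^sup>2 + 2 * (g1 i j)\<^sup>2" for i j
      using zero_le_power2[of "e i j + g1 i j"] by (simp add: power2_sum power2_diff)
    then have "(\<Sum>i=1..n. \<Sum>j=1..n. (e i j - g1 i j)\<^sup>2) \<le> (\<Sum>i=1..n. \<Sum>j=1..n. 2 * (e i j)\<^sup>2 + 2 * (g1 i j)\<^sup>2)"
      by (intro sum_mono)
    then show ?thesis by (simp only: sum.distrib sum_distrib_left[symmetric] s2_def a_def g1_def)
  qed
  moreover have "f \<le> 34 * a + 16 * r + 12 * m + 2 * N + 512 * h"
    if "s \<le> 16 * a + 4 * k + 6 * m + N + 256 * h" "k \<le> 2 * r" "f \<le> 2 * s + 2 * a"
    for f a r m N h s k :: real using that by linarith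
  ultimately show ?thesis unfolding est assoc using s2 by blast
qed

end

section \<open>The risk bound\<close>

text \<open>The Hoelder permutation of \<open>\<theta>\<close> composed with \<open>\<pi>\<close> is
  one for the sorted matrix \<open>\<phi>\<close>.\<close>

lemma Theta_Hoelder_cases:
  assumes "\<theta> \<in> Theta_Hoelder md n \<alpha> L"
  obtains \<phi> \<pi> \<eta> where "\<phi> \<in> ordered_class md n" "\<pi> permutes {1..n}" "\<theta> = mat_perm \<phi> \<pi>"
    "Hoelder_ordering n \<alpha> L \<phi> \<eta>"
proof -
  have "\<theta> \<in> Theta md n" using assms by (simp add: Theta_Hoelder_def)
  then obtain \<phi> \<pi> where \<phi>: "\<phi> \<in> ordered_class md n" "\<pi> permutes {1..n}" "\<theta> = mat_perm \<phi> \<pi>"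
    by (rule Theta_cases)
  obtain \<eta> where \<eta>: "Hoelder_ordering n \<alpha> L \<theta> \<eta>"
    using assms unfolding Theta_Hoelder_def Hoelder_ordering_def by blast
  have "mat_perm \<theta> \<eta> = mat_perm \<phi> (\<pi> \<circ> \<eta>)" by (simp add: \<phi>(3) mat_perm_def)
  moreover have "\<pi> \<circ> \<eta> permutes {1..n}"
    using \<eta> \<phi>(2) unfolding Hoelder_ordering_def by (blast intro: permutes_compose)
  ultimately have "Hoelder_ordering n \<alpha> L \<phi> (\<pi> \<circ> \<eta>)" using \<eta> unfolding Hoelder_ordering_def by simp
  then show thesis using \<phi> that by blast
qed

text \<open>Every sample is counted as bad, with error \<open>0\<close> elsewhere.\<close>

lemma risk_le_one:
  assumes "\<theta> \<in> Theta md n" "n \<ge> 1"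
  shows "risk md n p \<theta> \<le> 1"
proof -
  obtain \<phi> \<pi> where "\<phi> \<in> ordered_class md n" using assms(1) by (rule Theta_cases)
  from expectation_estimator_le[OF assms(1) this, of UNIV 0 p]
  have "measure_pmf.expectation (estimator_pmf md n p \<theta>) (\<lambda>t. (frob n (\<lambda>i j. t i j - \<theta> i j))\<^sup>2) \<le> (real n)\<^sup>2"
    by simp
  then show ?thesis using assms(2) by (simp add: risk_def field_simps)
qed

lemma (in observation_model) risk_le:
  assumes h: "\<theta> \<in> Theta_Hoelder md n \<alpha> L" and \<alpha>: "\<alpha> > 0" and L: "L > 0"
  shows "risk md n p \<theta> \<le> 500000 * (L powr (1 / (\<alpha> + 1)) *
      (ln (real n) / (real n * p) powr ((2 * \<alpha> + 1) / (2 * \<alpha> + 2))) + (ln (real n))\<^sup>2 / (real n * p))"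
proof -
  define l where "l = ln (real n)"
  define N where "N = real n"
  define H where "H = L powr (1 / (\<alpha> + 1)) * (R\<^sup>2) powr ((2 * \<alpha> + 1) / (2 * \<alpha> + 2))"
  \<comment> \<open>All error terms other than the Hoelder term are bounded by multiples of
    \<open>W\<close>, which becomes \<open>(ln n)\<^sup>2 / (n * p)\<close> after division by
    \<open>n\<^sup>2\<close>.\<close>
  define W where "W = N * l\<^sup>2 / p"
  obtain \<phi> \<pi> \<eta> where \<phi>: "\<phi> \<in> ordered_class md n" and \<pi>: "\<pi> permutes {1..n}" and eq: "\<theta> = mat_perm \<phi> \<pi>"
    and \<eta>: "Hoelder_ordering n \<alpha> L \<phi> \<eta>"
    using h by (rule Theta_Hoelder_cases)
  obtain K where K: "n < 2 ^ K" "K \<le> n" "real K \<le> 3 * l"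
    using ex_dyadic_depth[of n] n unfolding l_def by auto
  have N: "N \<ge> 33" "N > 0" using n by (auto simp: N_def)
  have l1: "l \<ge> 1" "l \<le> l\<^sup>2" "1 \<le> l\<^sup>2" using ln_ge_1 by (auto simp: l_def power2_eq_square intro: order_trans mult_mono[of 1 _ 1])
  have W0: "N * l\<^sup>2 \<le> W"
    unfolding W_def using p(2) p_pos N mult_right_mono[OF p(2), of "l\<^sup>2"] by (simp add: field_simps)
  have NW: "N \<le> W"
  proof -
    have "N * 1 \<le> N * l\<^sup>2" using l1 N by (intro mult_left_mono) auto
    then show ?thesis using W0 by simp
  qed
  have NR: "N\<^sup>2 * R\<^sup>2 \<le> W"
  proof -
    have "N\<^sup>2 * R\<^sup>2 = N * l / p" unfolding R2 using N p_pos by (simp add: N_def l_def power2_eq_square)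
    also have "\<dots> \<le> W" unfolding W_def using l1 N p_pos by (intro divide_right_mono mult_left_mono) auto
    finally show ?thesis .
  qed
  have NK: "N * (real K)\<^sup>2 \<le> 9 * W"
  proof -
    have "(real K)\<^sup>2 \<le> (3 * l)\<^sup>2" using K by (intro power_mono) auto
    then have "N * (real K)\<^sup>2 \<le> N * (3 * l)\<^sup>2" using N by (intro mult_left_mono) auto
    also have "\<dots> = 9 * (N * l\<^sup>2)" by (simp add: power_mult_distrib)
    finally show ?thesis using W0 by simp
  qed
  have H0: "0 \<le> N\<^sup>2 * H" unfolding H_def by simp
  have bound: "(frob n (\<lambda>i j. estimator md n s \<sigma> i j - \<theta> i j))\<^sup>2 \<le> 470016 * (N\<^sup>2 * H) + 160000 * W"
    if "s \<notin> {s. \<not> good K \<phi> s}" and \<sigma>: "\<sigma> \<in> sorting_perms n (data_matrix md n s)" for s \<sigma>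
  proof -
    have g: "good K \<phi> s" using that by simp
    have \<sigma>p: "\<sigma> permutes {1..n}" using \<sigma> by (simp add: sorting_perms_def)
    have rows: "\<bar>\<Sum>j=1..n. Z s i j\<bar> \<le> 5 * real n * R" if "i \<in> {1..n}" for i
      using g that unfolding good_def by blast
    let ?a = "\<Sum>i=1..n. \<Sum>j=1..n. (\<theta> (\<sigma> i) (\<sigma> j) - \<phi> i j)\<^sup>2"
    have "?a \<le> 4 * N * (2 + N * (864 * R\<^sup>2 + 3456 * H))"
      unfolding H_def N_def by (rule ordering_error_le[OF \<phi> \<pi> eq L \<alpha> \<eta> rows \<sigma>])
    also have "\<dots> = 8 * N + 3456 * (N\<^sup>2 * R\<^sup>2) + 13824 * (N\<^sup>2 * H)" by (simp add: power2_eq_square algebra_simps)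
    finally have a: "?a \<le> 8 * N + 3456 * (N\<^sup>2 * R\<^sup>2) + 13824 * (N\<^sup>2 * H)" .
    have "(frob n (\<lambda>i j. estimator md n s \<sigma> i j - \<theta> i j))\<^sup>2 \<le>
        34 * ?a + 16 * N\<^sup>2 * R\<^sup>2 + 12 * N * (real K)\<^sup>2 + 2 * N + 512 * (74 * N * l\<^sup>2) / p"
      unfolding N_def l_def by (rule projection_error_le[OF \<phi> \<sigma>p K(1) g])
    moreover have "512 * (74 * N * l\<^sup>2) / p = 37888 * W" by (simp add: W_def)
    ultimately show ?thesis using a NR NK NW N(2) unfolding mult.assoc by linarith
  qed
  have "measure_pmf.expectation (estimator_pmf md n p \<theta>) (\<lambda>t. (frob n (\<lambda>i j. t i j - \<theta> i j))\<^sup>2)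
      \<le> (470016 * (N\<^sup>2 * H) + 160000 * W) + (real n)\<^sup>2 * measure_pmf.prob (sample_pmf n p \<theta>) {s. \<not> good K \<phi> s}"
    using NW N H0 by (intro expectation_estimator_le[OF \<theta> \<phi> bound]) auto
  also have "(real n)\<^sup>2 * measure_pmf.prob (sample_pmf n p \<theta>) {s. \<not> good K \<phi> s} \<le> N\<^sup>2 * (5 / N)"
    using prob_bad_le[OF \<phi> K(2)] K(3) unfolding N_def l_def by (intro mult_left_mono) auto
  also have "N\<^sup>2 * (5 / N) = 5 * N" using N by (simp add: power2_eq_square)
  finally have E: "measure_pmf.expectation (estimator_pmf md n p \<theta>) (\<lambda>t. (frob n (\<lambda>i j. t i j - \<theta> i j))\<^sup>2)
      \<le> 500000 * (N\<^sup>2 * H) + 500000 * W" using NW N H0 by linarith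
  have "risk md n p \<theta> \<le> 1 / N\<^sup>2 * (500000 * (N\<^sup>2 * H) + 500000 * W)"
    unfolding risk_def N_def[symmetric] by (intro mult_left_mono E) auto
  also have "\<dots> = 500000 * (H + l\<^sup>2 / (N * p))"
    using N p_pos by (simp add: W_def field_simps power2_eq_square)
  also have "\<dots> \<le> 500000 * (L powr (1 / (\<alpha> + 1)) * (l / (N * p) powr ((2 * \<alpha> + 1) / (2 * \<alpha> + 2))) + l\<^sup>2 / (N * p))"
  proof (intro mult_left_mono add_right_mono)
    let ?e = "(2 * \<alpha> + 1) / (2 * \<alpha> + 2)"
    have "(R\<^sup>2) powr ?e = l powr ?e / (N * p) powr ?e"
      unfolding R2 N_def l_def by (rule powr_divide)
    \<comment> \<open>The exponent is at most \<open>1\<close> and \<open>l \<ge> 1\<close>; this is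
      how the full logarithm enters the first term of the rate.\<close>
    also have "\<dots> \<le> l powr 1 / (N * p) powr ?e"
      using l1 \<alpha> by (intro divide_right_mono powr_mono) auto
    finally show "H \<le> L powr (1 / (\<alpha> + 1)) * (l / (N * p) powr ?e)"
      unfolding H_def using l1 by (intro mult_left_mono) auto
  qed auto
  finally show ?thesis unfolding N_def l_def .
qed

theorem corollary2p4:
  "\<exists>C::real. \<forall>md::model. \<forall>\<alpha>::real. \<forall>L::real. \<forall>n::nat. \<forall>p::real.
     \<alpha> > 0 \<longrightarrow> L > 0 \<longrightarrow> n \<ge> 2 \<longrightarrow> 0 \<le> p \<longrightarrow> p \<le> 1 \<longrightarrow> p \<ge> 2 * ln (real n) / real n \<longrightarrow>
     (SUP \<theta>\<in>Theta_Hoelder md n \<alpha> L. ereal (risk md n p \<theta>))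
       \<le> ereal (C * (L powr (1 / (\<alpha> + 1)) *
                      (ln (real n) / (real n * p) powr ((2 * \<alpha> + 1) / (2 * \<alpha> + 2)))
                    + (ln (real n))\<^sup>2 / (real n * p)))"
proof (intro exI[of _ 500000] allI impI SUP_least)
  fix md \<alpha> L n p \<theta>
  assume \<alpha>: "(\<alpha> :: real) > 0" and L: "(L :: real) > 0" and n: "(n :: nat) \<ge> 2"
    and p: "0 \<le> (p :: real)" "p \<le> 1" "p \<ge> 2 * ln (real n) / real n"
    and h: "\<theta> \<in> Theta_Hoelder md n \<alpha> L"
  have \<theta>': "\<theta> \<in> Theta md n" using h by (simp add: Theta_Hoelder_def)
  let ?H = "L powr (1 / (\<alpha> + 1)) * (ln (real n) / (real n * p) powr ((2 * \<alpha> + 1) / (2 * \<alpha> + 2)))"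
  let ?Q = "(ln (real n))\<^sup>2 / (real n * p)"
  have "risk md n p \<theta> \<le> 500000 * (?H + ?Q)"
  proof (cases "n \<ge> 33")
    case True
    interpret observation_model md n p \<theta> by standard (use True p \<theta>' in auto)
    show ?thesis by (rule risk_le[OF h \<alpha> L])
  next
    \<comment> \<open>For \<open>n \<le> 32\<close> the second term of the rate is at least
      \<open>1/128\<close>, so the constant makes the right-hand side exceed the trivial bound
      \<open>1\<close>.\<close>
    case False
    have l: "1 / 2 \<le> ln (real n)"
    proof -
      have "ln 2 \<le> ln (real n)" using n by (subst ln_le_cancel_iff) auto
      then show ?thesis using ln2_ge_two_thirds by linarith
    qed
    then have "0 < 2 * ln (real n) / real n" using n by simp
    then have p0: "p > 0" using p by linarith
    have "real n * p \<le> 32 * 1" using False p by (intro mult_mono) auto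
    moreover have "(1 / 2)\<^sup>2 \<le> (ln (real n))\<^sup>2" using l by (intro power_mono) auto
    ultimately have "(1 / 2)\<^sup>2 / 32 \<le> ?Q" using n p0 by (intro frac_le) auto
    moreover have "0 \<le> ?H" using l by (intro mult_nonneg_nonneg divide_nonneg_nonneg) auto
    ultimately have "1 \<le> 500000 * (?H + ?Q)" by (simp add: power2_eq_square)
    moreover have "risk md n p \<theta> \<le> 1" using risk_le_one[OF \<theta>'] n by simp
    ultimately show ?thesis by linarith
  qed
  then show "ereal (risk md n p \<theta>) \<le> ereal (500000 * (?H + ?Q))" by simp
qed

end
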